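(* Let $d \ge 3$ and $n \ge 1$ be integers, let $\mathbb{k}$ be an algebraically closed field with $\operatorname{char}\mathbb{k} = 0$ or $\operatorname{char}\mathbb{k} > d$, and let $V_{n,d}\subset \mathbb{k}[x_1,\dots,x_n]$ be the space of forms of degree $d$ in $n$ variables. Suppose $f \in V_{n,d}$ is nondegenerate. Then the following are equivalent. (1) $f$ can be reconstructed from its Jacobian ideal $J(f)$. (2) $f$ is a central form, i.e. $Z(f) \cong \mathbb{k}$. (3) $\operatorname{Rank} B = n^2 - 1$, where $B$ is the $n^d \times n^2$ matrix associated to $f$ defined in the context. (4) $f$ is indecomposable and is not an LDS form.
   Context: A form of degree $d$ in $n$ variables is a homogeneous polynomial of degree $d$ in $\mathbb{k}[x_1,\dots,x_n]$ (a linear combination of monomials of degree $d$). It is nondegenerate if no variable can be removed by an invertible linear change of variables; equivalently, its first partial derivatives are linearly independent over $\mathbb{k}$. Reconstruction: for $f \in V_{n,d}$, $J(f)$ is the ideal of $\mathbb{k}[x_1,\dots,x_n]$ generated by $\frac{\partial f}{\partial x_1},\dots,\frac{\partial f}{\partial x_n}$. One says $f$ can be reconstructed from $J(f)$ if, whenever $g \in V_{n,d}$ satisfies $J(g) = J(f)$, then $g = \lambda f$ for some $\lambda \in \mathbb{k}^* = \mathbb{k}\setminus\{0\}$. (Equivalently, $J$ may be replaced by the $\mathbb{k}$-span of the first partial derivatives.) Center: for $f$ with Hessian matrix $H = \left(\frac{\partial^2 f}{\partial x_i \partial x_j}\right)_{1\le i,j\le n}$, the center of $f$ is $Z(f) :=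 \{X \in \mathbb{k}^{n\times n} \mid (HX)^T = HX\}$; it contains the scalar matrices, and $Z(f)\cong\mathbb{k}$ means it consists exactly of the scalar matrices. The matrix $B$: write $f = \sum_{1\le i_1,\dots,i_d\le n} a_{i_1\cdots i_d} x_{i_1}\cdots x_{i_d}$ with $a_{i_1\cdots i_d}\in\mathbb{k}$ invariant under all permutations of the subscripts. For $1 \le i_3,\dots,i_d \le n$ let $A^{(i_3\cdots i_d)}$ be the $n\times n$ matrix $(a_{i_1 i_2 i_3\cdots i_d})_{1\le i_1,i_2\le n}$. For an $n\times n$ matrix $X$ let $X_{\mathrm v}$ be the $n^2$-dimensional column vector obtained by stacking the columns of $X$ (first column on top), and let $P$ be the $n^2\times n^2$ permutation matrix with $(X^T)_{\mathrm v} = P X_{\mathrm v}$ for all $X$. Then $B$ is the $n^d\times n^2$ matrix obtained by stacking vertically, over all $(i_3,\dots,i_d)\in\{1,\dots,n\}^{d-2}$ (from $(1,\dots,1)$ to $(n,\dots,n)$), the $n^2\times n^2$ blocks $$I_n\otimes A^{(i_3\cdots i_d)} - (A^{(i_3\cdots i_d)}\otimes I_n)P,$$ where $\otimes$ is the Kronecker product. Indecomposability: a form $f$ is called a direct sum if, after an invertible linear change of variables, it can be written as a sum of $t\ge 2$ forms in disjoint (nonempty) sets of variables, $f = f_1(x_1,\dots,x_{a_1}) + \cdots + f_t(x_{a_{t-1}+1},\dots,x_n)$; otherwise $f$ is called indecomposable. LDS: a form $f$ of degree $d$ is called a limit of direct sums (LDS) form if, after an invertible linear change of variables, $$f(x_1,\dots,x_n)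 = \sum_{i=1}^{l} x_i \frac{\partial h(x_{l+1},\dots,x_{2l})}{\partial x_{l+i}} + g(x_{l+1},\dots,x_n)$$ for some integer $l$ with $l \ge 1$ and $2l \le n$, where $h$ and $g$ are forms of degree $d$ in $l$ and $n-l$ variables respectively. *)

theory Defs
  imports
    "HOL-Library.Poly_Mapping"
    "HOL-Algebra.Ideal"
    "HOL-Combinatorics.Multiset_Permutations"
    "Jordan_Normal_Form.Matrix"
    "Jordan_Normal_Form.DL_Rank"
begin

section \<open>Polynomials in the variables \<open>x\<^sub>0, x\<^sub>1, \<dots>\<close>\<close>

text \<open>
  A monomial is its exponent function; multiplication of polynomials is the convolution product
  of \<^theory>\<open>HOL-Library.Poly_Mapping\<close>.  Indices start at 0, so that the ring in \<open>n\<close>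
  variables consists of the polynomials in \<open>x\<^sub>0, \<dots>, x\<^sub>n\<^sub>-\<^sub>1\<close>.
\<close>

type_synonym 'a mpoly = "(nat \<Rightarrow>\<^sub>0 nat) \<Rightarrow>\<^sub>0 'a"

definition Const :: "'a::zero \<Rightarrow> 'a mpoly" where
  "Const c = Poly_Mapping.single 0 c"

definition Var :: "nat \<Rightarrow> 'a::zero_neq_one mpoly" where
  "Var i = Poly_Mapping.single (Poly_Mapping.single i 1) 1"

definition mdeg :: "(nat \<Rightarrow>\<^sub>0 nat) \<Rightarrow> nat" where
  "mdeg m = (\<Sum>i\<in>Poly_Mapping.keys m. Poly_Mapping.lookup m i)"

definition mpoly_ring :: "nat \<Rightarrow> 'a::comm_ring_1 mpoly ring" where
  "mpoly_ring n =
     \<lparr> carrier = {p. \<forall>m\<in>Poly_Mapping.keys p. Poly_Mapping.keys m \<subseteq> {..<n}},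
       monoid.mult = (*), one = 1, zero = 0, add = (+) \<rparr>"

text \<open>
  \<open>forms S d\<close>: the forms of degree \<open>d\<close> in the variables \<open>x\<^sub>i\<close>, \<open>i \<in> S\<close> (the zero polynomial is one
  of them).  The space \<open>V\<^bsub>n,d\<^esub>\<close> is \<open>forms {..<n} d\<close>.
\<close>

definition forms :: "nat set \<Rightarrow> nat \<Rightarrow> 'a::zero mpoly set" where
  "forms S d = {p. \<forall>m\<in>Poly_Mapping.keys p. Poly_Mapping.keys m \<subseteq> S \<and> mdeg m = d}"

text \<open>
  The truncated subtraction of exponents is harmless: a monomial not containing \<open>x\<^sub>i\<close> gets
  coefficient 0.
\<close>

definition partial_deriv :: "nat \<Rightarrow> 'a::comm_semiring_1 mpoly \<Rightarrow> 'a mpoly" where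
  "partial_deriv i p =
     (\<Sum>m\<in>Poly_Mapping.keys p.
        Poly_Mapping.single (m - Poly_Mapping.single i 1)
          (of_nat (Poly_Mapping.lookup m i) * Poly_Mapping.lookup p m))"

definition subst_mpoly :: "(nat \<Rightarrow> 'a mpoly) \<Rightarrow> 'a::comm_semiring_1 mpoly \<Rightarrow> 'a mpoly" where
  "subst_mpoly \<sigma> p =
     (\<Sum>m\<in>Poly_Mapping.keys p.
        Const (Poly_Mapping.lookup p m) *
        (\<Prod>i\<in>Poly_Mapping.keys m. \<sigma> i ^ Poly_Mapping.lookup m i))"

text \<open>The polynomial \<open>p(A x)\<close>.\<close>

definition lin_change :: "nat \<Rightarrow> 'a::comm_semiring_1 mat \<Rightarrow> 'a mpoly \<Rightarrow> 'a mpoly" where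
  "lin_change n A p = subst_mpoly (\<lambda>i. \<Sum>j<n. Const (A $$ (i, j)) * Var j) p"

definition nondegenerate :: "nat \<Rightarrow> nat \<Rightarrow> 'a::comm_ring_1 mpoly \<Rightarrow> bool" where
  "nondegenerate n d f \<longleftrightarrow>
     \<not> (\<exists>A i. A \<in> carrier_mat n n \<and> invertible_mat A \<and> i < n \<and>
              lin_change n A f \<in> forms ({..<n} - {i}) d)"


section \<open>Reconstruction from the Jacobian ideal\<close>

definition jacobian_ideal :: "nat \<Rightarrow> 'a::comm_ring_1 mpoly \<Rightarrow> 'a mpoly set" where
  "jacobian_ideal n f = Idl\<^bsub>mpoly_ring n\<^esub> ((\<lambda>i. partial_deriv i f) ` {..<n})"

definition reconstructible :: "nat \<Rightarrow> nat \<Rightarrow> 'a::comm_ring_1 mpoly \<Rightarrow> bool" where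
  "reconstructible n d f \<longleftrightarrow>
     (\<forall>g\<in>forms {..<n} d. jacobian_ideal n g = jacobian_ideal n f \<longrightarrow>
        (\<exists>c. c \<noteq> 0 \<and> g = Const c * f))"


section \<open>The center\<close>

definition hessian :: "nat \<Rightarrow> 'a::comm_ring_1 mpoly \<Rightarrow> 'a mpoly mat" where
  "hessian n f = mat n n (\<lambda>(i, j). partial_deriv i (partial_deriv j f))"

definition center :: "nat \<Rightarrow> 'a::comm_ring_1 mpoly \<Rightarrow> 'a mat set" where
  "center n f =
     {X \<in> carrier_mat n n.
        transpose_mat (hessian n f * map_mat Const X) = hessian n f * map_mat Const X}"

definition central :: "nat \<Rightarrow> 'a::comm_ring_1 mpoly \<Rightarrow> bool" where
  "central n f \<longleftrightarrow> center n f = {c \<cdot>\<^sub>m 1\<^sub>m n | c. True}"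


section \<open>The matrix \<open>B\<close>\<close>

definition index_tuples :: "nat \<Rightarrow> nat \<Rightarrow> nat list set" where
  "index_tuples n d = {xs. length xs = d \<and> set xs \<subseteq> {..<n}}"

definition symmetric_coeffs :: "nat \<Rightarrow> nat \<Rightarrow> 'a::comm_ring_1 mpoly \<Rightarrow> (nat list \<Rightarrow> 'a) \<Rightarrow> bool" where
  "symmetric_coeffs n d f a \<longleftrightarrow>
     (\<forall>xs\<in>index_tuples n d. \<forall>ys\<in>index_tuples n d. mset xs = mset ys \<longrightarrow> a xs = a ys) \<and>
     f = (\<Sum>xs\<in>index_tuples n d. Const (a xs) * prod_list (map Var xs))"

text \<open>
  For a form of degree \<open>d\<close> over a field of characteristic 0 or greater than \<open>d\<close>, symmetric
  coefficients exist and are uniquely determined on the index tuples; see the lemmas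
  \<open>symmetric_coeffs_exist\<close> and \<open>symmetric_coeffs_unique\<close> below.
\<close>

definition sym_coeff :: "nat \<Rightarrow> nat \<Rightarrow> 'a::comm_ring_1 mpoly \<Rightarrow> nat list \<Rightarrow> 'a" where
  "sym_coeff n d f = (SOME a. symmetric_coeffs n d f a)"

definition slice_mat :: "nat \<Rightarrow> nat \<Rightarrow> 'a::comm_ring_1 mpoly \<Rightarrow> nat list \<Rightarrow> 'a mat" where
  "slice_mat n d f is = mat n n (\<lambda>(i, j). sym_coeff n d f (i # j # is))"

definition kronecker :: "'a::times mat \<Rightarrow> 'a mat \<Rightarrow> 'a mat" where
  "kronecker A B =
     mat (dim_row A * dim_row B) (dim_col A * dim_col B)
       (\<lambda>(i, j). A $$ (i div dim_row B, j div dim_col B) * B $$ (i mod dim_row B, j mod dim_col B))"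

definition vec_of_cols :: "'a mat \<Rightarrow> 'a vec" where
  "vec_of_cols X =
     vec (dim_row X * dim_col X) (\<lambda>k. X $$ (k mod dim_row X, k div dim_row X))"

definition transpose_perm :: "nat \<Rightarrow> 'a::{zero,one} mat" where
  "transpose_perm n =
     mat (n ^ 2) (n ^ 2) (\<lambda>(r, c). if r div n = c mod n \<and> r mod n = c div n then 1 else 0)"

definition B_block :: "nat \<Rightarrow> nat \<Rightarrow> 'a::comm_ring_1 mpoly \<Rightarrow> nat list \<Rightarrow> 'a mat" where
  "B_block n d f is =
     kronecker (1\<^sub>m n) (slice_mat n d f is)
       - kronecker (slice_mat n d f is) (1\<^sub>m n) * transpose_perm n"

text \<open>
  \<open>product_lists (replicate (d - 2) [0..<n])\<close> lists the tuples \<open>(i\<^sub>3, \<dots>, i\<^sub>d)\<close> in lexicographic order.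
\<close>

definition B_mat :: "nat \<Rightarrow> nat \<Rightarrow> 'a::comm_ring_1 mpoly \<Rightarrow> 'a mat" where
  "B_mat n d f =
     foldr (@\<^sub>r) (map (B_block n d f) (product_lists (replicate (d - 2) [0..<n]))) (0\<^sub>m 0 (n ^ 2))"


section \<open>Direct sums and limits of direct sums\<close>

text \<open>
  The \<open>i\<close>-th summand is a form in the variables with indices in \<open>{a i..<a (Suc i)}\<close>.
\<close>

definition direct_sum_form :: "nat \<Rightarrow> nat \<Rightarrow> 'a::comm_ring_1 mpoly \<Rightarrow> bool" where
  "direct_sum_form n d f \<longleftrightarrow>
     (\<exists>A t a fs. A \<in> carrier_mat n n \<and> invertible_mat A \<and>
        (2::nat) \<le> t \<and> a 0 = 0 \<and> a t = n \<and>
        (\<forall>i<t. a i < a (Suc i)) \<and>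
        (\<forall>i<t. fs i \<in> forms {a i..<a (Suc i)} d) \<and>
        lin_change n A f = (\<Sum>i<t. fs i))"

definition indecomposable :: "nat \<Rightarrow> nat \<Rightarrow> 'a::comm_ring_1 mpoly \<Rightarrow> bool" where
  "indecomposable n d f \<longleftrightarrow> \<not> direct_sum_form n d f"

definition LDS_form :: "nat \<Rightarrow> nat \<Rightarrow> 'a::comm_ring_1 mpoly \<Rightarrow> bool" where
  "LDS_form n d f \<longleftrightarrow>
     (\<exists>A l h g. A \<in> carrier_mat n n \<and> invertible_mat A \<and>
        1 \<le> l \<and> 2 * l \<le> n \<and> h \<in> forms {l..<2 * l} d \<and> g \<in> forms {l..<n} d \<and>
        lin_change n A f = (\<Sum>i<l. Var i * partial_deriv (l + i) h) + g)"


section \<open>Adequacy of the definitions\<close>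

lemma div_mod_unique:
  fixes n :: nat
  assumes "i < n" "j < n"
  shows "j * n + i < n ^ 2" "(j * n + i) div n = j" "(j * n + i) mod n = i"
proof -
  have "j * n + i < (j + 1) * n" using assms by simp
  also have "\<dots> \<le> n * n" using assms by (intro mult_right_mono) auto
  finally show "j * n + i < n ^ 2" by (simp add: power2_eq_square)
qed (use assms in auto)

lemma transpose_perm:
  fixes X :: "'a::comm_ring_1 mat"
  assumes X: "X \<in> carrier_mat n n"
  shows "transpose_perm n *\<^sub>v vec_of_cols X = vec_of_cols (transpose_mat X)"
proof (rule eq_vecI)
  show "dim_vec (transpose_perm n *\<^sub>v vec_of_cols X) = dim_vec (vec_of_cols (transpose_mat X))"
    using X by (simp add: transpose_perm_def vec_of_cols_def power2_eq_square)
next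
  fix r assume "r < dim_vec (vec_of_cols (transpose_mat X))"
  hence r: "r < n * n" using X by (simp add: vec_of_cols_def)
  hence n: "n > 0" by (cases n) auto
  define i j where "i = r mod n" and "j = r div n"
  have ij: "i < n" "j < n" using r n by (auto simp: i_def j_def less_mult_imp_div_less)
  have eq: "(r div n = c mod n \<and> r mod n = c div n) \<longleftrightarrow> c = i * n + j" for c
  proof
    assume "r div n = c mod n \<and> r mod n = c div n"
    hence "i = c div n" "j = c mod n" by (simp_all add: i_def j_def)
    thus "c = i * n + j" by simp
  next
    assume "c = i * n + j"
    hence "c div n = i" "c mod n = j" using ij div_mod_unique(2,3)[of j n i] by simp_all
    thus "r div n = c mod n \<and> r mod n = c div n" by (simp add: i_def j_def)
  qed
  have "(transpose_perm n *\<^sub>v vec_of_cols X) $ r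
      = (\<Sum>c = 0..<n * n. (if r div n = c mod n \<and> r mod n = c div n then 1 else 0)
           * X $$ (c mod n, c div n))"
    using X r by (simp add: transpose_perm_def vec_of_cols_def scalar_prod_def power2_eq_square)
  also have "\<dots> = (\<Sum>c = 0..<n * n. if c = i * n + j then X $$ (c mod n, c div n) else 0)"
    by (intro sum.cong refl) (use eq in auto)
  also have "\<dots> = X $$ (j, i)"
    using div_mod_unique[of j n i] ij by (simp add: power2_eq_square)
  also have "\<dots> = vec_of_cols (transpose_mat X) $ r"
    using X r ij by (simp add: vec_of_cols_def i_def j_def)
  finally show "(transpose_perm n *\<^sub>v vec_of_cols X) $ r = vec_of_cols (transpose_mat X) $ r" .
qed

lemma keys_exponent_add:
  "Poly_Mapping.keys (m + m' :: nat \<Rightarrow>\<^sub>0 nat) = Poly_Mapping.keys m \<union> Poly_Mapping.keys m'"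
  by (auto simp: in_keys_iff lookup_add)

lemma cring_mpoly_ring: "cring (mpoly_ring n :: 'a::comm_ring_1 mpoly ring)"
proof (rule cringI)
  show "abelian_group (mpoly_ring n :: 'a mpoly ring)"
  proof (rule abelian_groupI)
    fix x y :: "'a mpoly"
    assume "x \<in> carrier (mpoly_ring n)" "y \<in> carrier (mpoly_ring n)"
    thus "x \<oplus>\<^bsub>mpoly_ring n\<^esub> y \<in> carrier (mpoly_ring n)"
      using Poly_Mapping.keys_add[of x y] by (fastforce simp: mpoly_ring_def)
  next
    fix x :: "'a mpoly" assume "x \<in> carrier (mpoly_ring n)"
    thus "\<exists>y\<in>carrier (mpoly_ring n). y \<oplus>\<^bsub>mpoly_ring n\<^esub> x = \<zero>\<^bsub>mpoly_ring n\<^esub>"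
      by (intro bexI[of _ "-x"]) (auto simp: mpoly_ring_def)
  qed (auto simp: mpoly_ring_def algebra_simps)
  show "comm_monoid (mpoly_ring n :: 'a mpoly ring)"
  proof (rule comm_monoidI)
    fix x y :: "'a mpoly"
    assume "x \<in> carrier (mpoly_ring n)" "y \<in> carrier (mpoly_ring n)"
    thus "x \<otimes>\<^bsub>mpoly_ring n\<^esub> y \<in> carrier (mpoly_ring n)"
      using keys_mult[of x y] by (fastforce simp: mpoly_ring_def keys_exponent_add)
  qed (auto simp: mpoly_ring_def algebra_simps)
qed (auto simp: mpoly_ring_def algebra_simps)

definition list_exponent :: "nat list \<Rightarrow> (nat \<Rightarrow>\<^sub>0 nat)" where
  "list_exponent xs = sum_list (map (\<lambda>i. Poly_Mapping.single i 1) xs)"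

lemma lookup_list_exponent: "Poly_Mapping.lookup (list_exponent xs) i = count (mset xs) i"
  by (induction xs) (auto simp: list_exponent_def lookup_add lookup_single when_def)

lemma list_exponent_eq_iff: "list_exponent xs = list_exponent ys \<longleftrightarrow> mset xs = mset ys"
  by (auto simp: poly_mapping_eq_iff fun_eq_iff lookup_list_exponent multiset_eq_iff)

lemma Const_mult_prod_list_Var:
  "Const c * prod_list (map Var xs) = Poly_Mapping.single (list_exponent xs) (c::'a::comm_ring_1)"
proof -
  have "prod_list (map Var xs) = (Poly_Mapping.single (list_exponent xs) 1 :: 'a mpoly)"
    by (induction xs) (auto simp: list_exponent_def Var_def mult_single)
  thus ?thesis by (simp add: Const_def mult_single)
qed

lemma finite_index_tuples: "finite (index_tuples n d)"
  using finite_lists_length_eq[of "{..<n}" d] by (simp add: index_tuples_def conj_commute)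

lemma permutations_index_tuple:
  assumes "xs \<in> index_tuples n d"
  shows "{ys \<in> index_tuples n d. mset ys = mset xs} = permutations_of_multiset (mset xs)"
  using assms by (auto simp: index_tuples_def permutations_of_multiset_def dest: mset_eq_setD mset_eq_length)

lemma lookup_symmetric_sum:
  fixes a :: "nat list \<Rightarrow> 'a::comm_ring_1"
  assumes sym: "\<forall>xs\<in>index_tuples n d. \<forall>ys\<in>index_tuples n d. mset xs = mset ys \<longrightarrow> a xs = a ys"
    and xs: "xs \<in> index_tuples n d"
  shows "Poly_Mapping.lookup (\<Sum>ys\<in>index_tuples n d. Const (a ys) * prod_list (map Var ys))
           (list_exponent xs) = of_nat (card (permutations_of_multiset (mset xs))) * a xs"
proof -
  have "Poly_Mapping.lookup (\<Sum>ys\<in>index_tuples n d. Const (a ys) * prod_list (map Var ys))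
           (list_exponent xs) = (\<Sum>ys\<in>index_tuples n d. if mset ys = mset xs then a ys else 0)"
    by (simp add: Const_mult_prod_list_Var lookup_sum lookup_single when_def list_exponent_eq_iff)
  also have "\<dots> = (\<Sum>ys\<in>{ys\<in>index_tuples n d. mset ys = mset xs}. a ys)"
    by (rule sum.inter_filter[symmetric]) (rule finite_index_tuples)
  also have "\<dots> = (\<Sum>ys\<in>{ys\<in>index_tuples n d. mset ys = mset xs}. a xs)"
  proof (rule sum.cong[OF refl])
    fix ys assume "ys \<in> {ys\<in>index_tuples n d. mset ys = mset xs}"
    thus "a ys = a xs" using sym xs by blast
  qed
  finally show ?thesis by (simp add: permutations_index_tuple[OF xs])
qed

lemma of_nat_card_permutations_nonzero:
  assumes char: "CHAR('a::field) = 0 \<or> CHAR('a) > d" and xs: "xs \<in> index_tuples n d"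
  shows "of_nat (card (permutations_of_multiset (mset xs))) \<noteq> (0::'a)"
proof
  assume "of_nat (card (permutations_of_multiset (mset xs))) = (0::'a)"
  hence dvd: "CHAR('a) dvd card (permutations_of_multiset (mset xs))"
    by (simp add: of_nat_eq_0_iff_char_dvd)
  have "card (permutations_of_multiset (mset xs)) * (\<Prod>x\<in>set_mset (mset xs). fact (count (mset xs) x))
      = fact (size (mset xs))"
    using card_permutations_of_multiset_aux[of "mset xs"] by simp
  moreover have "size (mset xs) = d" using xs by (simp add: index_tuples_def)
  ultimately have "card (permutations_of_multiset (mset xs)) dvd (fact d :: nat)"
    by (metis dvd_triv_left)
  with dvd have fact: "CHAR('a) dvd (fact d :: nat)" by (rule dvd_trans)
  show False
  proof (cases "CHAR('a) = 0")
    case False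
    hence "prime CHAR('a)" by (simp add: prime_CHAR_semidom)
    thus False using fact char False by (simp add: prime_dvd_fact_iff)
  qed (use fact in auto)
qed

lemma exponent_as_list:
  assumes "Poly_Mapping.keys m \<subseteq> {..<n}" "mdeg m = d"
  shows "\<exists>xs\<in>index_tuples n d. m = list_exponent xs"
proof -
  define M where "M = (\<Sum>i\<in>Poly_Mapping.keys m. replicate_mset (Poly_Mapping.lookup m i) i)"
  obtain xs where xs: "mset xs = M" using ex_mset by blast
  have cnt: "count M i = Poly_Mapping.lookup m i" for i
    by (simp add: M_def count_sum in_keys_iff)
  have "length xs = size M" using xs by (metis size_mset)
  also have "size M = d" using assms(2) by (simp add: M_def mdeg_def)
  finally have len: "length xs = d" .
  have "set xs = Poly_Mapping.keys m"
    using xs cnt by (auto simp: in_keys_iff simp flip: set_mset_mset count_greater_zero_iff)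
  moreover have "m = list_exponent xs"
    using xs cnt by (auto simp: poly_mapping_eq_iff fun_eq_iff lookup_list_exponent)
  ultimately show ?thesis using len assms by (auto simp: index_tuples_def)
qed

lemma symmetric_coeffs_exist:
  fixes f :: "'a::field mpoly"
  assumes char: "CHAR('a) = 0 \<or> CHAR('a) > d" and f: "f \<in> forms {..<n} d"
  shows "\<exists>a. symmetric_coeffs n d f a"
proof
  let ?a = "\<lambda>xs. Poly_Mapping.lookup f (list_exponent xs)
                   / of_nat (card (permutations_of_multiset (mset xs)))"
  have sym: "\<forall>xs\<in>index_tuples n d. \<forall>ys\<in>index_tuples n d. mset xs = mset ys \<longrightarrow> ?a xs = ?a ys"
    using list_exponent_eq_iff by metis
  have "f = (\<Sum>xs\<in>index_tuples n d. Const (?a xs) * prod_list (map Var xs))"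
  proof (rule poly_mapping_eqI)
    fix m
    show "Poly_Mapping.lookup f m =
      Poly_Mapping.lookup (\<Sum>xs\<in>index_tuples n d. Const (?a xs) * prod_list (map Var xs)) m"
    proof (cases "\<exists>xs\<in>index_tuples n d. m = list_exponent xs")
      case True
      then obtain xs where xs: "xs \<in> index_tuples n d" and m: "m = list_exponent xs" by blast
      show ?thesis
        unfolding m lookup_symmetric_sum[OF sym xs]
        using of_nat_card_permutations_nonzero[OF char xs] by simp
    next
      case False
      hence "m \<notin> Poly_Mapping.keys f" using f exponent_as_list[of m n d] by (auto simp: forms_def)
      moreover have "Poly_Mapping.lookup
          (\<Sum>xs\<in>index_tuples n d. Const (?a xs) * prod_list (map Var xs)) m = 0"
        using False
        by (auto simp: Const_mult_prod_list_Var lookup_sum lookup_single when_def intro!: sum.neutral)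
      ultimately show ?thesis by (simp add: in_keys_iff)
    qed
  qed
  with sym show "symmetric_coeffs n d f ?a" by (simp add: symmetric_coeffs_def)
qed

lemma symmetric_coeffs_unique:
  fixes f :: "'a::field mpoly"
  assumes char: "CHAR('a) = 0 \<or> CHAR('a) > d"
    and a: "symmetric_coeffs n d f a" and b: "symmetric_coeffs n d f b"
    and xs: "xs \<in> index_tuples n d"
  shows "a xs = b xs"
proof -
  let ?N = "of_nat (card (permutations_of_multiset (mset xs))) :: 'a"
  have "?N * c xs = Poly_Mapping.lookup f (list_exponent xs)" if c: "symmetric_coeffs n d f c" for c
  proof -
    from c have 1: "\<forall>xs\<in>index_tuples n d. \<forall>ys\<in>index_tuples n d. mset xs = mset ys \<longrightarrow> c xs = c ys"
      and 2: "f = (\<Sum>xs\<in>index_tuples n d. Const (c xs) * prod_list (map Var xs))"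
      unfolding symmetric_coeffs_def by blast+
    show ?thesis by (subst 2) (rule lookup_symmetric_sum[OF 1 xs, symmetric])
  qed
  from this[OF a] this[OF b] have "?N * a xs = ?N * b xs" by simp
  thus ?thesis using of_nat_card_permutations_nonzero[OF char xs] by simp
qed

lemma B_mat_carrier:
  fixes f :: "'a::comm_ring_1 mpoly"
  assumes "d \<ge> 2"
  shows "B_mat n d f \<in> carrier_mat (n ^ d) (n ^ 2)"
proof -
  have slice: "slice_mat n d f is \<in> carrier_mat n n" for "is"
    by (simp add: slice_mat_def)
  have kron: "kronecker A B \<in> carrier_mat (n ^ 2) (n ^ 2)"
    if "A \<in> carrier_mat n n" "B \<in> carrier_mat n n" for A B :: "'a mat"
    using that by (simp add: kronecker_def power2_eq_square)
  have perm: "transpose_perm n \<in> carrier_mat (n ^ 2) (n ^ 2)"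
    by (simp add: transpose_perm_def)
  have block: "B_block n d f is \<in> carrier_mat (n ^ 2) (n ^ 2)" for "is"
    unfolding B_block_def
    by (intro minus_carrier_mat mult_carrier_mat[OF _ perm] kron slice one_carrier_mat)
  have stack: "foldr (@\<^sub>r) (map (B_block n d f) xss) (0\<^sub>m 0 (n ^ 2))
      \<in> carrier_mat (length xss * n ^ 2) (n ^ 2)" for xss
  proof (induction xss)
    case (Cons x xss)
    show ?case
      using carrier_append_rows[OF block Cons.IH, of x] by simp
  qed simp
  have len: "length (product_lists (replicate k [0..<n])) = n ^ k" for k
    by (induction k) (simp_all add: length_concat o_def sum_list_triv)
  have "B_mat n d f \<in> carrier_mat (n ^ (d - 2) * n ^ 2) (n ^ 2)"
    using stack[of "product_lists (replicate (d - 2) [0..<n])"] unfolding B_mat_def len .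
  moreover have "n ^ (d - 2) * n ^ 2 = n ^ d"
    using assms by (metis le_add_diff_inverse2 power_add)
  ultimately show ?thesis by simp
qed

end

theory Submission
  imports
    Defs
    "Jordan_Normal_Form.Jordan_Normal_Form_Existence"
    "Jordan_Normal_Form.Matrix_Kernel"
begin

text \<open>
  Write \<open>H\<close> for the Hessian of \<open>f\<close>.  All four conditions are compared with the center.

  The gradients that are linear images \<open>X\<^sup>T \<nabla>f\<close> of \<open>\<nabla>f\<close> are exactly those with \<open>H X\<close> symmetric, by a
  homogeneous Poincare lemma, and since the part of degree \<open>d - 1\<close> of the Jacobian ideal is the span
  of the partial derivatives, reconstruction fails precisely when some such \<open>X\<close> is not scalar.

  Comparing coefficients in the symmetry of \<open>H X\<close> gives the symmetry of all \<open>A\<^bsup>(i\<^sub>3\<dots>i\<^sub>d)\<^esup> X\<close>, so that \<open>ker B\<close>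
  is the center, and rank-nullity applies.

  A nonscalar \<open>X\<close> in the center is put into Jordan form by a change of variables.  The symmetry of
  \<open>H X\<close> then kills the mixed second derivatives between variables belonging to different eigenvalues,
  which yields a direct sum.  If there is only one eigenvalue, some power \<open>N\<close> of the nilpotent part of
  \<open>X\<close> satisfies \<open>N \<noteq> 0\<close> and \<open>N\<^sup>2 = 0\<close>; the symmetry of \<open>H N\<close> is the LDS shape.  Conversely, a
  projection, respectively such an \<open>N\<close>, lies in the center of a direct sum, respectively an LDS form.
\<close>

section \<open>Differential calculus of polynomials\<close>

text \<open>A center element X gives a form g with gradient X^T grad f, but the Jacobian ideals of f
  and g are only sure to agree if X is invertible. Since the center contains the scalars and an
  algebraically closed field is infinite, X can be shifted by a scalar off its spectrum, which does
  not affect whether it is scalar. Nondegeneracy, as independence of the partial derivatives, then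
  reads off the matrix from g = c f.

  With one eigenvalue, symmetry of H N passes to all powers of N, because factors can be moved
  across H one at a time. If N^K is the last nonzero power, then K >= 1 forces N^(2K) = 0, so the
  basis vectors not killed by N^K and their images under N^K are disjoint families. They are the two
  groups of l variables in the LDS shape, and l is the rank of N^K.

  The bound on the characteristic keeps invertible the exponents up to d, the factor in Euler's
  identity and the multinomial coefficients. This is what lets derivatives detect variables and
  determine a form.\<close>

lemma lookup_single_mult_add:
  fixes p :: "'a::comm_semiring_1 mpoly"
  shows "Poly_Mapping.lookup (Poly_Mapping.single t c * p) (t + m) = c * Poly_Mapping.lookup p m"
proof -
  have "Poly_Mapping.lookup (Poly_Mapping.single t c * p) (t + m) =
        (\<Sum>l. (c when t = l) * (\<Sum>q. Poly_Mapping.lookup p q when t + m = l + q))"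
    by (simp add: lookup_mult lookup_single)
  also have "\<dots> = (\<Sum>l. (c * (\<Sum>q. Poly_Mapping.lookup p q when t + m = l + q)) when t = l)"
    by (simp add: when_mult)
  also have "\<dots> = c * (\<Sum>q. Poly_Mapping.lookup p q when t + m = t + q)"
    by simp
  finally show ?thesis by simp
qed

lemma lookup_single_mult_eq_0:
  fixes p :: "'a::comm_semiring_1 mpoly"
  assumes "\<And>q. k \<noteq> t + q"
  shows "Poly_Mapping.lookup (Poly_Mapping.single t c * p) k = 0"
proof -
  have "Poly_Mapping.lookup (Poly_Mapping.single t c * p) k =
        (\<Sum>l. (c when t = l) * (\<Sum>q. Poly_Mapping.lookup p q when k = l + q))"
    by (simp add: lookup_mult lookup_single)
  also have "\<dots> = (\<Sum>l. (c * (\<Sum>q. Poly_Mapping.lookup p q when k = l + q)) when t = l)"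
    by (simp add: when_mult)
  also have "\<dots> = c * (\<Sum>q. Poly_Mapping.lookup p q when k = t + q)"
    by simp
  finally show ?thesis using assms by simp
qed

lemma lookup_Const_mult [simp]:
  fixes p :: "'a::comm_semiring_1 mpoly"
  shows "Poly_Mapping.lookup (Const c * p) m = c * Poly_Mapping.lookup p m"
  using lookup_single_mult_add[of 0 c p m] by (simp add: Const_def)

lemma Const_0 [simp]: "Const 0 = 0"
  by (simp add: Const_def)

lemma Const_1 [simp]: "Const 1 = 1"
  by (simp add: Const_def)

lemma Const_add: "Const (a + b :: 'a::comm_semiring_1) = Const a + Const b"
  by (simp add: Const_def single_add)

lemma Const_mult: "Const (a * b :: 'a::comm_semiring_1) = Const a * Const b"
  by (simp add: Const_def mult_single)

lemma Const_mult_left: "Const a * (Const b * p) = Const (a * b :: 'a::comm_semiring_1) * p"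
  by (simp add: Const_mult mult.assoc)

lemma Const_sum: "Const (sum h A :: 'a::comm_semiring_1) = (\<Sum>x\<in>A. Const (h x))"
  by (induction A rule: infinite_finite_induct) (simp_all add: Const_add)

lemma semiring_hom_Const: "semiring_hom (Const :: 'a::comm_semiring_1 \<Rightarrow> 'a mpoly)"
  by unfold_locales (simp_all add: Const_add Const_mult)

text \<open>Subtraction of exponents truncates at 0, so undoing it requires that x_i really divides
  the monomial.\<close>

lemma exponent_diff_add:
  assumes "Poly_Mapping.lookup m i \<noteq> 0"
  shows "m - Poly_Mapping.single i 1 + Poly_Mapping.single i (1::nat) = m"
  using assms
  by (auto simp: poly_mapping_eq_iff fun_eq_iff lookup_add lookup_minus lookup_single when_def)

lemma lookup_Var_mult:
  fixes p :: "'a::comm_semiring_1 mpoly"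
  shows "Poly_Mapping.lookup (Var i * p) m =
    (if Poly_Mapping.lookup m i = 0 then 0 else Poly_Mapping.lookup p (m - Poly_Mapping.single i 1))"
proof (cases "Poly_Mapping.lookup m i = 0")
  case True
  then have "m \<noteq> Poly_Mapping.single i 1 + q" for q
    by (metis Suc_eq_plus1_left Zero_not_Suc lookup_add lookup_single_eq)
  with True show ?thesis by (simp add: Var_def lookup_single_mult_eq_0)
next
  case False
  then have "m = Poly_Mapping.single i 1 + (m - Poly_Mapping.single i 1)"
    using exponent_diff_add[of m i] by (simp add: add.commute)
  then show ?thesis
    using False lookup_single_mult_add[of "Poly_Mapping.single i 1" 1 p "m - Poly_Mapping.single i 1"]
    by (simp add: Var_def)
qed

text \<open>Only one monomial of \<open>p\<close> matters for a given coefficient: truncated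
  subtraction may also send a monomial without x_i to \<open>m\<close>, but that one carries the
  factor 0. With this formula the rules of calculus become coefficientwise computations.\<close>

lemma lookup_partial_deriv:
  fixes p :: "'a::comm_semiring_1 mpoly"
  shows "Poly_Mapping.lookup (partial_deriv i p) m =
    of_nat (Suc (Poly_Mapping.lookup m i)) * Poly_Mapping.lookup p (m + Poly_Mapping.single i 1)"
proof -
  let ?e = "Poly_Mapping.single i (1::nat)"
  have "Poly_Mapping.lookup (partial_deriv i p) m = (\<Sum>k\<in>Poly_Mapping.keys p.
      if k - ?e = m then of_nat (Poly_Mapping.lookup k i) * Poly_Mapping.lookup p k else 0)"
    by (simp add: partial_deriv_def lookup_sum lookup_single when_def)
  also have "\<dots> = (\<Sum>k\<in>Poly_Mapping.keys p. if k = m + ?e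
      then of_nat (Suc (Poly_Mapping.lookup m i)) * Poly_Mapping.lookup p (m + ?e) else 0)"
  proof (rule sum.cong[OF refl])
    fix k
    show "(if k - ?e = m then of_nat (Poly_Mapping.lookup k i) * Poly_Mapping.lookup p k else 0) =
      (if k = m + ?e
       then of_nat (Suc (Poly_Mapping.lookup m i)) * Poly_Mapping.lookup p (m + ?e) else 0)"
    proof (cases "Poly_Mapping.lookup k i = 0")
      case True
      then have "k \<noteq> m + ?e" by (auto simp: lookup_add)
      with True show ?thesis by simp
    next
      case False
      have "k - ?e = m \<longleftrightarrow> k = m + ?e"
        using exponent_diff_add[OF False] by auto
      then show ?thesis by (auto simp: lookup_add)
    qed
  qed
  also have "\<dots> = of_nat (Suc (Poly_Mapping.lookup m i)) * Poly_Mapping.lookup p (m + ?e)"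
    by (simp add: sum.delta in_keys_iff)
  finally show ?thesis .
qed

lemma partial_deriv_0 [simp]: "partial_deriv i 0 = 0"
  by (rule poly_mapping_eqI) (simp add: lookup_partial_deriv)

lemma partial_deriv_Const [simp]: "partial_deriv i (Const c) = 0"
proof (rule poly_mapping_eqI)
  fix m :: "nat \<Rightarrow>\<^sub>0 nat"
  have "m + Poly_Mapping.single i 1 \<noteq> 0"
    by (metis add_is_0 lookup_add lookup_single_eq lookup_zero one_neq_zero)
  then show "Poly_Mapping.lookup (partial_deriv i (Const c)) m = Poly_Mapping.lookup 0 m"
    by (simp add: lookup_partial_deriv Const_def lookup_single)
qed

lemma partial_deriv_add:
  "partial_deriv i (p + q) = partial_deriv i p + partial_deriv i q"
  by (rule poly_mapping_eqI) (simp add: lookup_partial_deriv lookup_add distrib_left)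

lemma partial_deriv_diff:
  fixes p q :: "'a::comm_ring_1 mpoly"
  shows "partial_deriv i (p - q) = partial_deriv i p - partial_deriv i q"
  by (rule poly_mapping_eqI) (simp add: lookup_partial_deriv lookup_minus right_diff_distrib)

lemma partial_deriv_Const_mult:
  "partial_deriv i (Const c * p) = Const c * partial_deriv i p"
  by (rule poly_mapping_eqI) (simp add: lookup_partial_deriv mult.left_commute)

lemma partial_deriv_sum:
  "partial_deriv i (sum h A) = (\<Sum>x\<in>A. partial_deriv i (h x))"
  by (induction A rule: infinite_finite_induct) (simp_all add: partial_deriv_add)

lemma partial_deriv_commute:
  "partial_deriv i (partial_deriv j p) = partial_deriv j (partial_deriv i p)"
  by (rule poly_mapping_eqI)
    (cases "i = j", simp_all add: lookup_partial_deriv lookup_add lookup_single when_def ac_simps)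

text \<open>The Leibniz rule with a variable as one factor. This covers linear forms too, and
  polynomials are built up one variable at a time.\<close>

lemma partial_deriv_Var_mult:
  fixes p :: "'a::comm_semiring_1 mpoly"
  shows "partial_deriv j (Var i * p) = (if i = j then p else 0) + Var i * partial_deriv j p"
proof (rule poly_mapping_eqI)
  fix m
  let ?e = "\<lambda>i. Poly_Mapping.single i (1::nat)"
  show "Poly_Mapping.lookup (partial_deriv j (Var i * p)) m =
    Poly_Mapping.lookup ((if i = j then p else 0) + Var i * partial_deriv j p) m"
  proof (cases "i = j")
    case True
    then show ?thesis
      by (cases "Poly_Mapping.lookup m i = 0")
        (simp_all add: lookup_partial_deriv lookup_Var_mult lookup_add exponent_diff_add lookup_minus
          distrib_right flip: One_nat_def)
  next
    case False
    then have "m + ?e j - ?e i = m - ?e i + ?e j" if "Poly_Mapping.lookup m i \<noteq> 0"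
      using that
      by (auto simp: poly_mapping_eq_iff fun_eq_iff lookup_add lookup_minus lookup_single when_def)
    then show ?thesis using False
      by (cases "Poly_Mapping.lookup m i = 0")
        (simp_all add: lookup_partial_deriv lookup_Var_mult lookup_add lookup_minus lookup_single)
  qed
qed

section \<open>Total degree of a monomial\<close>

lemma mdeg_eq_sum:
  assumes "finite A" "Poly_Mapping.keys m \<subseteq> A"
  shows "mdeg m = (\<Sum>i\<in>A. Poly_Mapping.lookup m i)"
  unfolding mdeg_def using assms by (intro sum.mono_neutral_left) (auto simp: in_keys_iff)

lemma mdeg_add: "mdeg (m + m') = mdeg m + mdeg m'"
  unfolding mdeg_eq_sum[of "Poly_Mapping.keys m \<union> Poly_Mapping.keys m'" m, simplified]
    mdeg_eq_sum[of "Poly_Mapping.keys m \<union> Poly_Mapping.keys m'" m', simplified]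
    mdeg_eq_sum[of "Poly_Mapping.keys m \<union> Poly_Mapping.keys m'" "m + m'", simplified keys_exponent_add, simplified]
  by (simp add: lookup_add sum.distrib)

lemma mdeg_single [simp]: "mdeg (Poly_Mapping.single i k) = k"
  by (simp add: mdeg_def)

lemma mdeg_0 [simp]: "mdeg 0 = 0"
  by (simp add: mdeg_def)

lemma mdeg_eq_0_iff [simp]: "mdeg m = 0 \<longleftrightarrow> m = 0"
  by (auto simp: mdeg_def poly_mapping_eq_iff fun_eq_iff in_keys_iff)

lemma lookup_le_mdeg: "Poly_Mapping.lookup m i \<le> mdeg m"
proof (cases "i \<in> Poly_Mapping.keys m")
  case True
  then show ?thesis unfolding mdeg_def by (intro member_le_sum) auto
qed (simp add: in_keys_iff)

subsection \<open>Forms\<close>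

lemma forms_iff:
  "p \<in> forms S d \<longleftrightarrow>
    (\<forall>m. Poly_Mapping.lookup p m \<noteq> 0 \<longrightarrow> Poly_Mapping.keys m \<subseteq> S \<and> mdeg m = d)"
  by (auto simp: forms_def in_keys_iff)

lemma forms_eqI:
  assumes "p \<in> forms S e" "q \<in> forms S e"
    and "\<And>m. mdeg m = e \<Longrightarrow> Poly_Mapping.lookup p m = Poly_Mapping.lookup q m"
  shows "p = q"
proof (rule poly_mapping_eqI)
  fix m
  show "Poly_Mapping.lookup p m = Poly_Mapping.lookup q m"
  proof (cases "mdeg m = e")
    case False
    then have "Poly_Mapping.lookup p m = 0" "Poly_Mapping.lookup q m = 0"
      using assms(1,2) unfolding forms_iff by blast+
    then show ?thesis by simp
  qed (rule assms(3))
qed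

lemma forms_mono: "p \<in> forms S d \<Longrightarrow> S \<subseteq> T \<Longrightarrow> p \<in> forms T d"
  by (auto simp: forms_def)

lemma zero_in_forms [simp]: "0 \<in> forms S d"
  by (simp add: forms_def)

lemma forms_add: "p \<in> forms S d \<Longrightarrow> q \<in> forms S d \<Longrightarrow> p + q \<in> forms S d"
  unfolding forms_iff lookup_add by (metis add.left_neutral)

lemma forms_diff: "p \<in> forms S d \<Longrightarrow> q \<in> forms S d \<Longrightarrow> p - q \<in> forms S d"
  for p q :: "'a::comm_ring_1 mpoly"
  unfolding forms_iff lookup_minus by (metis diff_zero)

lemma forms_Const_mult: "p \<in> forms S d \<Longrightarrow> Const c * p \<in> forms S d"
  for p :: "'a::comm_semiring_1 mpoly"
  unfolding forms_iff by (metis lookup_Const_mult mult_zero_right)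

lemma forms_sum: "(\<And>x. x \<in> A \<Longrightarrow> h x \<in> forms S d) \<Longrightarrow> sum h A \<in> forms S d"
  by (induction A rule: infinite_finite_induct) (simp_all add: forms_add)

lemma forms_mult:
  fixes p q :: "'a::comm_semiring_1 mpoly"
  assumes "p \<in> forms S a" "q \<in> forms S b"
  shows "p * q \<in> forms S (a + b)"
proof -
  have "Poly_Mapping.keys m \<subseteq> S \<and> mdeg m = a + b" if "m \<in> Poly_Mapping.keys (p * q)" for m
  proof -
    obtain u v where "m = u + v" "u \<in> Poly_Mapping.keys p" "v \<in> Poly_Mapping.keys q"
      using keys_mult[of p q] \<open>m \<in> Poly_Mapping.keys (p * q)\<close> by blast
    then show ?thesis using assms by (simp add: forms_def mdeg_add keys_exponent_add)
  qed
  then show ?thesis by (simp add: forms_def)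
qed

lemma Const_in_forms: "Const c \<in> forms S 0"
  by (auto simp: forms_iff Const_def lookup_single when_def)

lemma Var_in_forms: "i \<in> S \<Longrightarrow> Var i \<in> forms S 1"
  by (auto simp: forms_iff Var_def lookup_single when_def split: if_splits)

lemma forms_Var_mult:
  "i \<in> S \<Longrightarrow> p \<in> forms S d \<Longrightarrow> Var i * p \<in> forms S (Suc d)"
  for p :: "'a::comm_semiring_1 mpoly"
  using forms_mult[OF Var_in_forms, of i S p d] by simp

lemma forms_power:
  fixes p :: "'a::comm_semiring_1 mpoly"
  assumes "p \<in> forms S a"
  shows "p ^ k \<in> forms S (k * a)"
proof (induction k)
  case 0
  have "(Const 1 :: 'a mpoly) \<in> forms S 0" by (rule Const_in_forms)
  then show ?case by simp
next
  case (Suc k)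
  then show ?case using forms_mult[OF assms Suc] by simp
qed

lemma forms_prod:
  fixes h :: "'b \<Rightarrow> 'a::comm_semiring_1 mpoly"
  assumes "finite A" "\<And>x. x \<in> A \<Longrightarrow> h x \<in> forms S (e x)"
  shows "prod h A \<in> forms S (sum e A)"
  using assms
proof (induction A rule: finite_induct)
  case empty
  have "(Const 1 :: 'a mpoly) \<in> forms S 0" by (rule Const_in_forms)
  then show ?case by simp
next
  case (insert x A)
  then show ?case by (simp add: forms_mult)
qed

lemma forms_partial_deriv:
  fixes p :: "'a::comm_semiring_1 mpoly"
  assumes "p \<in> forms S d"
  shows "partial_deriv i p \<in> forms S (d - 1)"
  unfolding forms_iff
proof (intro allI impI)
  fix m assume "Poly_Mapping.lookup (partial_deriv i p) m \<noteq> 0"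
  then have "Poly_Mapping.lookup p (m + Poly_Mapping.single i 1) \<noteq> 0"
    by (auto simp: lookup_partial_deriv)
  then show "Poly_Mapping.keys m \<subseteq> S \<and> mdeg m = d - 1"
    using assms unfolding forms_iff by (fastforce simp: keys_exponent_add mdeg_add)
qed

text \<open>The operator x_i d/dx_i multiplies a coefficient by the exponent of x_i, and the
  exponents of every monomial of \<open>p\<close> add up to \<open>d\<close>.\<close>

lemma euler:
  fixes p :: "'a::comm_semiring_1 mpoly"
  assumes S: "finite S" and p: "p \<in> forms S d"
  shows "(\<Sum>i\<in>S. Var i * partial_deriv i p) = Const (of_nat d) * p"
proof (rule poly_mapping_eqI)
  fix m
  have "Poly_Mapping.lookup (\<Sum>i\<in>S. Var i * partial_deriv i p) m =
      (\<Sum>i\<in>S. of_nat (Poly_Mapping.lookup m i) * Poly_Mapping.lookup p m)"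
    unfolding lookup_sum lookup_Var_mult lookup_partial_deriv
    by (rule sum.cong) (auto simp: exponent_diff_add lookup_minus simp flip: One_nat_def)
  also have "\<dots> = of_nat (\<Sum>i\<in>S. Poly_Mapping.lookup m i) * Poly_Mapping.lookup p m"
    by (simp add: sum_distrib_right)
  also have "\<dots> = of_nat d * Poly_Mapping.lookup p m"
  proof (cases "Poly_Mapping.lookup p m = 0")
    case False
    then show ?thesis using p mdeg_eq_sum[OF S, of m] by (simp add: forms_iff)
  qed simp
  finally show "Poly_Mapping.lookup (\<Sum>i\<in>S. Var i * partial_deriv i p) m =
    Poly_Mapping.lookup (Const (of_nat d) * p) m" by simp
qed

lemma of_nat_nonzero_of_char:
  assumes "CHAR('a::semiring_1) = 0 \<or> CHAR('a) > d" "0 < k" "k \<le> d"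
  shows "of_nat k \<noteq> (0::'a)"
  using assms by (auto simp: of_nat_eq_0_iff_char_dvd dest: dvd_imp_le)

text \<open>Differentiation multiplies a coefficient by an exponent between 1 and \<open>d\<close>,
  which is nonzero under the characteristic assumption. So a variable that occurs cannot hide behind
  a vanishing derivative, as it does in a p-th power in characteristic p.\<close>

lemma forms_remove_vars:
  fixes p :: "'a::{comm_semiring_1, semiring_no_zero_divisors} mpoly"
  assumes char: "CHAR('a) = 0 \<or> CHAR('a) > d" and p: "p \<in> forms S d"
    and T: "\<And>i. i \<in> T \<Longrightarrow> partial_deriv i p = 0"
  shows "p \<in> forms (S - T) d"
  unfolding forms_iff
proof (intro allI impI)
  fix m assume m: "Poly_Mapping.lookup p m \<noteq> 0"
  then have S: "Poly_Mapping.keys m \<subseteq> S" "mdeg m = d" using p by (auto simp: forms_iff)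
  have "i \<notin> Poly_Mapping.keys m" if "i \<in> T" for i
  proof
    assume "i \<in> Poly_Mapping.keys m"
    then have i: "Poly_Mapping.lookup m i \<noteq> 0" by (simp add: in_keys_iff)
    have "of_nat (Poly_Mapping.lookup m i) * Poly_Mapping.lookup p m =
        Poly_Mapping.lookup (partial_deriv i p) (m - Poly_Mapping.single i 1)"
      using i by (simp add: lookup_partial_deriv exponent_diff_add lookup_minus flip: One_nat_def)
    also have "\<dots> = 0" using T[OF \<open>i \<in> T\<close>] by simp
    finally have "of_nat (Poly_Mapping.lookup m i) = (0::'a)" using m by simp
    moreover have "Poly_Mapping.lookup m i \<le> d" using lookup_le_mdeg[of m i] S by simp
    ultimately show False using of_nat_nonzero_of_char[OF char] i by blast
  qed
  then show "Poly_Mapping.keys m \<subseteq> S - T \<and> mdeg m = d" using S by auto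
qed

lemma forms_empty: "p \<in> forms {} d \<Longrightarrow> d > 0 \<Longrightarrow> p = 0"
  by (rule poly_mapping_eqI) (auto simp: forms_iff)

text \<open>All variables drop out of the difference, and a form of positive degree in no variables
  is 0.\<close>

lemma forms_eqI_partial_deriv:
  fixes p q :: "'a::idom mpoly"
  assumes "CHAR('a) = 0 \<or> CHAR('a) > d" "d > 0" "p \<in> forms S d" "q \<in> forms S d"
    and "\<And>i. i \<in> S \<Longrightarrow> partial_deriv i p = partial_deriv i q"
  shows "p = q"
proof -
  have "p - q \<in> forms (S - S) d"
    using assms by (intro forms_remove_vars forms_diff) (auto simp: partial_deriv_diff)
  then show ?thesis using forms_empty[of "p - q" d] assms(2) by simp
qed

text \<open>The homogeneous Poincare lemma: by Euler's identity, \<open>\<Sum> x\<^sub>i q\<^sub>i / (e + 1)\<close> is a potential.\<close>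

lemma potential_exists:
  fixes q :: "nat \<Rightarrow> 'a::field mpoly"
  assumes S: "finite S" and q: "\<And>i. i \<in> S \<Longrightarrow> q i \<in> forms S e"
    and closed: "\<And>i j. i \<in> S \<Longrightarrow> j \<in> S \<Longrightarrow> partial_deriv j (q i) = partial_deriv i (q j)"
    and e: "of_nat (Suc e) \<noteq> (0::'a)"
  shows "\<exists>h\<in>forms S (Suc e). \<forall>j\<in>S. partial_deriv j h = q j"
proof (intro bexI ballI)
  let ?h = "Const (inverse (of_nat (Suc e))) * (\<Sum>i\<in>S. Var i * q i)"
  show "?h \<in> forms S (Suc e)"
    by (intro forms_Const_mult forms_sum forms_Var_mult q)
  fix j assume j: "j \<in> S"
  have "partial_deriv j (\<Sum>i\<in>S. Var i * q i)
      = (\<Sum>i\<in>S. (if i = j then q i else 0)) + (\<Sum>i\<in>S. Var i * partial_deriv j (q i))"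
    by (simp add: partial_deriv_sum partial_deriv_Var_mult sum.distrib)
  \<comment> \<open>Closedness puts \<open>q j\<close> in place of \<open>q i\<close>, so that
    Euler's identity yields \<open>e\<close> copies of \<open>q j\<close>. The product rule supplies
    one more, whence the divisor \<open>Suc e\<close>.\<close>
  also have "(\<Sum>i\<in>S. Var i * partial_deriv j (q i)) = (\<Sum>i\<in>S. Var i * partial_deriv i (q j))"
    using closed j by (intro sum.cong) auto
  also have "\<dots> = Const (of_nat e) * q j" using euler[OF S q[OF j]] .
  also have "(\<Sum>i\<in>S. (if i = j then q i else 0)) = q j" using S j by simp
  also have "q j + Const (of_nat e) * q j = Const (of_nat (Suc e)) * q j"
    by (simp add: Const_add distrib_right)
  finally show "partial_deriv j ?h = q j"
    using e by (simp only: partial_deriv_Const_mult Const_mult_left) simp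
qed

section \<open>Linear substitutions\<close>

text \<open>Homogeneity is dropped because induction over polynomials passes through arbitrary sums.
  For \<open>{..<n}\<close> this is the carrier of \<open>mpoly_ring n\<close>.\<close>

definition mpolys :: "nat set \<Rightarrow> 'a::zero mpoly set" where
  "mpolys S = {p. \<forall>m\<in>Poly_Mapping.keys p. Poly_Mapping.keys m \<subseteq> S}"

lemma forms_in_mpolys: "p \<in> forms S d \<Longrightarrow> p \<in> mpolys S"
  by (auto simp: forms_def mpolys_def)

lemma mpolys_partial_deriv:
  fixes p :: "'a::comm_semiring_1 mpoly"
  assumes "p \<in> mpolys S"
  shows "partial_deriv i p \<in> mpolys S"
proof -
  have "Poly_Mapping.keys m \<subseteq> S" if "m \<in> Poly_Mapping.keys (partial_deriv i p)" for m
  proof -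
    have "m + Poly_Mapping.single i 1 \<in> Poly_Mapping.keys p"
      using that by (auto simp: in_keys_iff lookup_partial_deriv)
    then have "Poly_Mapping.keys (m + Poly_Mapping.single i 1) \<subseteq> S"
      using assms by (simp add: mpolys_def)
    then show ?thesis by (simp add: keys_exponent_add)
  qed
  then show ?thesis by (simp add: mpolys_def)
qed

lemma sum_singles:
  fixes p :: "'a::comm_monoid_add mpoly"
  shows "p = (\<Sum>m\<in>Poly_Mapping.keys p. Poly_Mapping.single m (Poly_Mapping.lookup p m))"
  by (rule poly_mapping_eqI) (simp add: lookup_sum lookup_single when_def in_keys_iff)

lemma single_exponent_decomp:
  assumes "i \<in> Poly_Mapping.keys m"
  shows "Poly_Mapping.single m c =
    Var i * Poly_Mapping.single (m - Poly_Mapping.single i 1) (c::'a::comm_semiring_1)"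
  using assms exponent_diff_add[of m i]
  by (simp add: Var_def mult_single in_keys_iff add.commute flip: One_nat_def)

text \<open>Identities between additive maps, such as the chain rule or the composition of
  substitutions, reduce to constants and to one multiplication by a variable. Single monomials are
  reached by induction on their degree.\<close>

lemma mpoly_induct [consumes 1, case_names Const add Var_mult]:
  fixes p :: "'a::comm_semiring_1 mpoly"
  assumes p: "p \<in> mpolys S"
    and Const: "\<And>c. P (Const c)"
    and add: "\<And>p q. P p \<Longrightarrow> P q \<Longrightarrow> P (p + q)"
    and Var_mult: "\<And>i p. i \<in> S \<Longrightarrow> P p \<Longrightarrow> P (Var i * p)"
  shows "P p"
proof -
  have single: "P (Poly_Mapping.single m c)" if "Poly_Mapping.keys m \<subseteq> S" for m c
    using that
  proof (induction "mdeg m" arbitrary: m)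
    case 0
    then show ?case using Const[of c] by (simp add: Const_def)
  next
    case (Suc k)
    then have "m \<noteq> 0" by auto
    then obtain i where i: "i \<in> Poly_Mapping.keys m" by (metis all_not_in_conv keys_eq_empty)
    let ?m = "m - Poly_Mapping.single i 1"
    have m: "m = ?m + Poly_Mapping.single i 1"
      using i by (simp add: exponent_diff_add in_keys_iff flip: One_nat_def)
    have "Suc k = Suc (mdeg ?m)" using Suc.hyps(2) by (subst (asm) m) (simp add: mdeg_add)
    moreover have "Poly_Mapping.keys ?m \<subseteq> S"
      using Suc.prems by (subst (asm) m) (simp add: keys_exponent_add)
    ultimately have "P (Poly_Mapping.single ?m c)" using Suc.hyps(1) by simp
    then show ?case using Var_mult i Suc.prems single_exponent_decomp[OF i, of c] by auto
  qed
  have "P (\<Sum>m\<in>A. Poly_Mapping.single m (Poly_Mapping.lookup p m))"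
    if "finite A" "A \<subseteq> Poly_Mapping.keys p" for A
    using that
  proof (induction A rule: finite_induct)
    case empty
    then show ?case using Const[of 0] by simp
  next
    case (insert m A)
    then show ?case using p by (auto simp: mpolys_def intro!: add single)
  qed
  then show ?thesis using sum_singles[of p] by (metis finite_keys order_refl)
qed

section \<open>Substitution of polynomials for variables\<close>

lemma subst_mpoly_superset:
  assumes "finite A" "Poly_Mapping.keys p \<subseteq> A"
  shows "subst_mpoly \<sigma> p = (\<Sum>m\<in>A. Const (Poly_Mapping.lookup p m) *
    (\<Prod>i\<in>Poly_Mapping.keys m. \<sigma> i ^ Poly_Mapping.lookup m i))"
  unfolding subst_mpoly_def using assms
  by (intro sum.mono_neutral_left) (auto simp: in_keys_iff)

lemma subst_mpoly_0 [simp]: "subst_mpoly \<sigma> 0 = 0"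
  by (simp add: subst_mpoly_def)

lemma subst_mpoly_add: "subst_mpoly \<sigma> (p + q) = subst_mpoly \<sigma> p + subst_mpoly \<sigma> q"
proof -
  let ?A = "Poly_Mapping.keys p \<union> Poly_Mapping.keys q"
  have "Poly_Mapping.keys (p + q) \<subseteq> ?A" by (rule Poly_Mapping.keys_add)
  then show ?thesis
    by (simp add: subst_mpoly_superset[of ?A] lookup_add Const_add distrib_right sum.distrib)
qed

lemma subst_mpoly_sum: "subst_mpoly \<sigma> (sum h A) = (\<Sum>x\<in>A. subst_mpoly \<sigma> (h x))"
  by (induction A rule: infinite_finite_induct) (simp_all add: subst_mpoly_add)

lemma subst_mpoly_Const_mult: "subst_mpoly \<sigma> (Const c * p) = Const c * subst_mpoly \<sigma> p"
proof -
  have "Poly_Mapping.keys (Const c * p) \<subseteq> Poly_Mapping.keys p"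
    by (auto simp: in_keys_iff)
  then have "subst_mpoly \<sigma> (Const c * p) = (\<Sum>m\<in>Poly_Mapping.keys p.
      Const (Poly_Mapping.lookup (Const c * p) m) *
      (\<Prod>i\<in>Poly_Mapping.keys m. \<sigma> i ^ Poly_Mapping.lookup m i))"
    by (intro subst_mpoly_superset) auto
  then show ?thesis
    by (simp add: subst_mpoly_def Const_mult sum_distrib_left mult.assoc)
qed

lemma subst_mpoly_single:
  "subst_mpoly \<sigma> (Poly_Mapping.single m c) =
    Const c * (\<Prod>i\<in>Poly_Mapping.keys m. \<sigma> i ^ Poly_Mapping.lookup m i)"
  by (subst subst_mpoly_superset[of "{m}"]) auto

lemma subst_mpoly_Const [simp]: "subst_mpoly \<sigma> (Const c) = Const c"
  using subst_mpoly_single[of \<sigma> 0 c] by (simp add: Const_def)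

lemma subst_mpoly_Var_mult: "subst_mpoly \<sigma> (Var i * p) = \<sigma> i * subst_mpoly \<sigma> p"
proof -
  have mono: "subst_mpoly \<sigma> (Var i * Poly_Mapping.single m c) =
      \<sigma> i * subst_mpoly \<sigma> (Poly_Mapping.single m c)" for m c
  proof -
    let ?e = "Poly_Mapping.single i (1::nat)"
    \<comment> \<open>Both monomials are expanded over the support of their product, where an
      exponent 0 contributes a factor 1.\<close>
    let ?A = "insert i (Poly_Mapping.keys m)"
    have keys: "Poly_Mapping.keys (?e + m) = ?A" by (simp add: keys_exponent_add)
    have "(\<Prod>j\<in>?A. \<sigma> j ^ Poly_Mapping.lookup (?e + m) j) =
        (\<Prod>j\<in>?A. \<sigma> j ^ Poly_Mapping.lookup ?e j) * (\<Prod>j\<in>?A. \<sigma> j ^ Poly_Mapping.lookup m j)"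
      by (simp only: lookup_add power_add prod.distrib)
    also have "(\<Prod>j\<in>?A. \<sigma> j ^ Poly_Mapping.lookup ?e j) = (\<Prod>j\<in>?A. if j = i then \<sigma> i else 1)"
      by (rule prod.cong) (auto simp: lookup_single when_def)
    also have "\<dots> = \<sigma> i" by (simp add: prod.delta)
    also have "(\<Prod>j\<in>?A. \<sigma> j ^ Poly_Mapping.lookup m j) =
        (\<Prod>j\<in>Poly_Mapping.keys m. \<sigma> j ^ Poly_Mapping.lookup m j)"
      by (rule prod.mono_neutral_right) (auto simp: in_keys_iff)
    finally show ?thesis
      unfolding subst_mpoly_single Var_def mult_single keys
      by (simp add: subst_mpoly_single keys mult_ac)
  qed
  have "Var i * p = (\<Sum>m\<in>Poly_Mapping.keys p. Var i * Poly_Mapping.single m (Poly_Mapping.lookup p m))"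
    by (subst sum_singles) (simp add: sum_distrib_left)
  then have "subst_mpoly \<sigma> (Var i * p) = \<sigma> i *
      (\<Sum>m\<in>Poly_Mapping.keys p. subst_mpoly \<sigma> (Poly_Mapping.single m (Poly_Mapping.lookup p m)))"
    by (simp add: subst_mpoly_sum mono sum_distrib_left)
  then show ?thesis by (simp add: sum_singles[of p, symmetric] flip: subst_mpoly_sum)
qed

section \<open>Linear changes of variables\<close>

lemma lin_change_add: "lin_change n A (p + q) = lin_change n A p + lin_change n A q"
  by (simp add: lin_change_def subst_mpoly_add)

lemma lin_change_0 [simp]: "lin_change n A 0 = 0"
  by (simp add: lin_change_def)

lemma lin_change_sum: "lin_change n A (sum h I) = (\<Sum>x\<in>I. lin_change n A (h x))"
  by (simp add: lin_change_def subst_mpoly_sum)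

lemma lin_change_Const [simp]: "lin_change n A (Const c) = Const c"
  by (simp add: lin_change_def)

lemma lin_change_Const_mult: "lin_change n A (Const c * p) = Const c * lin_change n A p"
  by (simp add: lin_change_def subst_mpoly_Const_mult)

lemma lin_change_Var_mult:
  "lin_change n A (Var i * p) = (\<Sum>j<n. Const (A $$ (i, j)) * Var j) * lin_change n A p"
  by (simp add: lin_change_def subst_mpoly_Var_mult)

lemma lin_change_forms:
  assumes "p \<in> forms {..<n} d"
  shows "lin_change n A p \<in> forms {..<n} d"
  unfolding lin_change_def subst_mpoly_def
proof (rule forms_sum)
  fix m assume m: "m \<in> Poly_Mapping.keys p"
  have "(\<Sum>j<n. Const (A $$ (i, j)) * Var j) \<in> forms {..<n} 1" for i
    by (intro forms_sum forms_Const_mult Var_in_forms) auto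
  from forms_power[OF this]
  have "(\<Prod>i\<in>Poly_Mapping.keys m. (\<Sum>j<n. Const (A $$ (i, j)) * Var j) ^ Poly_Mapping.lookup m i)
      \<in> forms {..<n} (\<Sum>i\<in>Poly_Mapping.keys m. Poly_Mapping.lookup m i)"
    by (intro forms_prod) simp_all
  moreover have "(\<Sum>i\<in>Poly_Mapping.keys m. Poly_Mapping.lookup m i) = d"
    using assms m by (auto simp: forms_def mdeg_def)
  ultimately show "Const (Poly_Mapping.lookup p m) * (\<Prod>i\<in>Poly_Mapping.keys m.
      (\<Sum>j<n. Const (A $$ (i, j)) * Var j) ^ Poly_Mapping.lookup m i) \<in> forms {..<n} d"
    by (simp add: forms_Const_mult)
qed

text \<open>Chain rule. The linear form \<open>?L\<close> that replaces x_i has j-th derivative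
  \<open>A $$ (i, j)\<close>; this matches the summand k = i on the right, where the product rule
  differentiates x_i itself.\<close>

lemma partial_deriv_lin_change:
  fixes p :: "'a::comm_semiring_1 mpoly"
  assumes "p \<in> mpolys {..<n}" "j < n"
  shows "partial_deriv j (lin_change n A p) =
    (\<Sum>k<n. Const (A $$ (k, j)) * lin_change n A (partial_deriv k p))"
  using assms(1)
proof (induction p rule: mpoly_induct)
  case (Var_mult i p)
  let ?L = "\<Sum>k<n. Const (A $$ (i, k)) * Var k"
  have L: "partial_deriv j (?L * q) = Const (A $$ (i, j)) * q + ?L * partial_deriv j q" for q
  proof -
    have "partial_deriv j (?L * q) = (\<Sum>k<n. Const (A $$ (i, k)) * partial_deriv j (Var k * q))"
      by (simp add: sum_distrib_right mult.assoc partial_deriv_sum partial_deriv_Const_mult)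
    also have "\<dots> = (\<Sum>k<n. (if k = j then Const (A $$ (i, k)) * q else 0)) + ?L * partial_deriv j q"
      by (simp add: partial_deriv_Var_mult distrib_left sum.distrib sum_distrib_right mult.assoc
          if_distrib[of "\<lambda>x. _ * x"] cong: if_cong)
    finally show ?thesis using \<open>j < n\<close> by simp
  qed
  have "(\<Sum>k<n. Const (A $$ (k, j)) * lin_change n A (partial_deriv k (Var i * p))) =
      (\<Sum>k<n. if k = i then Const (A $$ (i, j)) * lin_change n A p else 0) +
      ?L * (\<Sum>k<n. Const (A $$ (k, j)) * lin_change n A (partial_deriv k p))"
    unfolding sum_distrib_left sum.distrib[symmetric]
    by (rule sum.cong[OF refl])
      (simp add: partial_deriv_Var_mult lin_change_add lin_change_Var_mult distrib_left mult.left_commute)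
  also have "\<dots> = Const (A $$ (i, j)) * lin_change n A p + ?L * partial_deriv j (lin_change n A p)"
    using Var_mult by simp
  finally show ?case by (simp add: lin_change_Var_mult L)
qed (simp_all add: lin_change_add partial_deriv_add distrib_left sum.distrib)

text \<open>Putting x = B y into f(A x) gives f(A B y), which fixes the order of the
  product.\<close>

lemma lin_change_lin_change:
  fixes p :: "'a::comm_ring_1 mpoly"
  assumes A: "A \<in> carrier_mat n n" and B: "B \<in> carrier_mat n n" and p: "p \<in> mpolys {..<n}"
  shows "lin_change n B (lin_change n A p) = lin_change n (A * B) p"
  using p
proof (induction p rule: mpoly_induct)
  case (Var_mult i p)
  have "lin_change n B ((\<Sum>j<n. Const (A $$ (i, j)) * Var j) * lin_change n A p) =
      (\<Sum>j<n. Const (A $$ (i, j)) * (\<Sum>k<n. Const (B $$ (j, k)) * Var k)) * lin_change n (A * B) p"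
    by (simp add: sum_distrib_right lin_change_sum lin_change_Const_mult mult.assoc
        lin_change_Var_mult Var_mult)
  also have "(\<Sum>j<n. Const (A $$ (i, j)) * (\<Sum>k<n. Const (B $$ (j, k)) * Var k)) =
      (\<Sum>k<n. Const (\<Sum>j<n. A $$ (i, j) * B $$ (j, k)) * Var k)"
    unfolding sum_distrib_left Const_sum sum_distrib_right
    by (subst sum.swap) (simp add: Const_mult mult.assoc)
  also have "\<dots> = (\<Sum>k<n. Const ((A * B) $$ (i, k)) * Var k)"
    using A B Var_mult(1) by (intro sum.cong) (auto simp: scalar_prod_def atLeast0LessThan)
  finally show ?case by (simp add: lin_change_Var_mult)
qed (simp_all add: lin_change_add)

lemma lin_change_one:
  fixes p :: "'a::comm_ring_1 mpoly"
  assumes "p \<in> mpolys {..<n}"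
  shows "lin_change n (1\<^sub>m n) p = p"
  using assms
proof (induction p rule: mpoly_induct)
  case (Var_mult i p)
  then have "(\<Sum>j<n. Const (1\<^sub>m n $$ (i, j) :: 'a) * Var j) = (\<Sum>j<n. if j = i then Var j else 0)"
    by (intro sum.cong) auto
  also have "\<dots> = Var i" using Var_mult by simp
  finally show ?case using Var_mult by (simp add: lin_change_Var_mult)
qed (simp_all add: lin_change_add)

section \<open>The center\<close>

lemma hessian_carrier [simp]: "hessian n f \<in> carrier_mat n n"
  by (simp add: hessian_def)

lemma hessian_mult_index:
  assumes "X \<in> carrier_mat n n" "i < n" "j < n"
  shows "(hessian n f * map_mat Const X) $$ (i, j) =
    (\<Sum>k<n. Const (X $$ (k, j)) * partial_deriv i (partial_deriv k f))"
  using assms by (simp add: hessian_def scalar_prod_def atLeast0LessThan mult.commute)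

lemma symmetric_mat_iff:
  assumes "M \<in> carrier_mat n n"
  shows "transpose_mat M = M \<longleftrightarrow> (\<forall>i<n. \<forall>j<n. M $$ (i, j) = M $$ (j, i))"
proof
  assume "transpose_mat M = M"
  then show "\<forall>i<n. \<forall>j<n. M $$ (i, j) = M $$ (j, i)"
    using assms by (metis carrier_matD index_transpose_mat(1))
next
  assume "\<forall>i<n. \<forall>j<n. M $$ (i, j) = M $$ (j, i)"
  then show "transpose_mat M = M" using assms by (intro eq_matI) auto
qed

text \<open>Entry (i, j) of H X is the i-th derivative of the j-th component of X^T grad f.
  Membership in the center is therefore closedness of this polynomial vector field, the hypothesis
  of \<open>potential_exists\<close>.\<close>

lemma center_iff:
  "X \<in> center n f \<longleftrightarrow> X \<in> carrier_mat n n \<and>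
    (\<forall>i<n. \<forall>j<n. (\<Sum>k<n. Const (X $$ (k, j)) * partial_deriv i (partial_deriv k f)) =
                 (\<Sum>k<n. Const (X $$ (k, i)) * partial_deriv j (partial_deriv k f)))"
proof (cases "X \<in> carrier_mat n n")
  case True
  then have "hessian n f * map_mat Const X \<in> carrier_mat n n"
    by (intro mult_carrier_mat) auto
  then have "X \<in> center n f \<longleftrightarrow> (\<forall>i<n. \<forall>j<n.
      (hessian n f * map_mat Const X) $$ (i, j) = (hessian n f * map_mat Const X) $$ (j, i))"
    using True symmetric_mat_iff by (auto simp: center_def)
  then show ?thesis using True by (simp add: hessian_mult_index)
qed (simp add: center_def)

lemma hessian_lin_change:
  fixes f :: "'a::comm_ring_1 mpoly"
  assumes f: "f \<in> forms {..<n} d" and A: "A \<in> carrier_mat n n"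
  shows "hessian n (lin_change n A f) =
    transpose_mat (map_mat Const A) * map_mat (lin_change n A) (hessian n f) * map_mat Const A"
proof (rule eq_matI)
  fix i j
  assume "i < dim_row (transpose_mat (map_mat Const A) * map_mat (lin_change n A) (hessian n f)
      * map_mat Const A)"
    and "j < dim_col (transpose_mat (map_mat Const A) * map_mat (lin_change n A) (hessian n f)
      * map_mat Const A)"
  then have ij: "i < n" "j < n" using A by auto
  have "partial_deriv i (partial_deriv j (lin_change n A f)) =
      (\<Sum>k<n. Const (A $$ (k, j)) * (\<Sum>l<n. Const (A $$ (l, i)) *
        lin_change n A (partial_deriv l (partial_deriv k f))))"
    using forms_in_mpolys[OF f] ij
    by (simp add: partial_deriv_lin_change mpolys_partial_deriv
        partial_deriv_sum partial_deriv_Const_mult)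
  then show "hessian n (lin_change n A f) $$ (i, j) =
      (transpose_mat (map_mat Const A) * map_mat (lin_change n A) (hessian n f)
        * map_mat Const A) $$ (i, j)"
    using A ij by (simp add: hessian_def scalar_prod_def atLeast0LessThan mult.commute)
qed (use A in \<open>auto simp: hessian_def\<close>)

lemma map_mat_Const_mult:
  fixes X Y :: "'a::comm_ring_1 mat"
  assumes "X \<in> carrier_mat n n" "Y \<in> carrier_mat n n"
  shows "map_mat Const (X * Y) = map_mat Const X * map_mat Const Y"
  by (rule semiring_hom.mat_hom_mult[OF semiring_hom_Const assms])

text \<open>The Hessian changes by congruence and \<open>X\<close> by conjugation. The factor
  \<open>A * A'\<close> in the middle cancels, and the new product is A^T (H X)(A x) A, which is
  congruent to a symmetric matrix.\<close>

lemma center_lin_change: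
  fixes f :: "'a::comm_ring_1 mpoly"
  assumes f: "f \<in> forms {..<n} d" and A: "A \<in> carrier_mat n n" and A': "A' \<in> carrier_mat n n"
    and inv: "A * A' = 1\<^sub>m n" and X: "X \<in> center n f"
  shows "A' * X * A \<in> center n (lin_change n A f)"
proof -
  let ?C = "map_mat Const :: 'a mat \<Rightarrow> 'a mpoly mat"
  let ?L = "map_mat (lin_change n A) :: 'a mpoly mat \<Rightarrow> 'a mpoly mat"
  let ?H = "hessian n f"
  have assoc: "U * V * (W * Z) = U * (V * W) * Z"
    if "U \<in> carrier_mat n n" "V \<in> carrier_mat n n" "W \<in> carrier_mat n n" "Z \<in> carrier_mat n n"
    for U V W Z :: "'a mpoly mat"
  proof -
    have "U * V * (W * Z) = U * V * W * Z"
      using that by (intro assoc_mult_mat[of _ n n _ n _ n, symmetric]) auto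
    also have "U * V * W = U * (V * W)"
      using that by (intro assoc_mult_mat[of _ n n _ n _ n])
    finally show ?thesis .
  qed
  have Xc: "X \<in> carrier_mat n n" using X by (simp add: center_def)
  have carr: "?C A \<in> carrier_mat n n" "?C X \<in> carrier_mat n n" "?L ?H \<in> carrier_mat n n"
    "A' * X * A \<in> carrier_mat n n" "transpose_mat (?C A) \<in> carrier_mat n n"
    using A A' Xc by (auto simp: hessian_def)
  have LHX: "?L ?H * ?C X = ?L (?H * ?C X)"
    using Xc by (intro eq_matI) (auto simp: hessian_def scalar_prod_def lin_change_sum
        mult.commute[of _ "Const _"] lin_change_Const_mult)
  have "A * (A' * X * A) = A * (A' * (X * A))"
    using A A' Xc by (simp add: assoc_mult_mat[of A' n n X n A n])
  also have "\<dots> = (A * A') * (X * A)"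
    using A A' Xc by (simp add: assoc_mult_mat[of A n n A' n "X * A" n])
  finally have AX: "A * (A' * X * A) = X * A" using A Xc by (simp add: inv)
  have "hessian n (lin_change n A f) * ?C (A' * X * A) =
      transpose_mat (?C A) * ?L ?H * (?C A * ?C (A' * X * A))"
    unfolding hessian_lin_change[OF f A] using carr
    by (intro assoc_mult_mat[of _ n n _ n _ n]) auto
  also have "?C A * ?C (A' * X * A) = ?C X * ?C A"
    using AX A Xc carr by (simp flip: map_mat_Const_mult)
  also have "transpose_mat (?C A) * ?L ?H * (?C X * ?C A) =
      transpose_mat (?C A) * (?L ?H * ?C X) * ?C A"
    by (rule assoc) (use carr in auto)
  finally have eq: "hessian n (lin_change n A f) * ?C (A' * X * A) =
      transpose_mat (?C A) * ?L (?H * ?C X) * ?C A" by (simp add: LHX)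
  have "transpose_mat (?L (?H * ?C X)) = ?L (transpose_mat (?H * ?C X))"
    by (intro eq_matI) auto
  also have "\<dots> = ?L (?H * ?C X)" using X by (simp add: center_def)
  finally have sym: "transpose_mat (?L (?H * ?C X)) = ?L (?H * ?C X)" .
  have L: "?L (?H * ?C X) \<in> carrier_mat n n"
    unfolding LHX[symmetric] using carr by (intro mult_carrier_mat)
  have "transpose_mat (transpose_mat (?C A) * ?L (?H * ?C X) * ?C A) =
      transpose_mat (?C A) * (?L (?H * ?C X) * ?C A)"
    using carr L by (simp add: transpose_mult[of _ n n _ n] sym)
  also have "\<dots> = transpose_mat (?C A) * ?L (?H * ?C X) * ?C A"
    using carr L by (intro assoc_mult_mat[of _ n n _ n _ n, symmetric])
  finally show ?thesis using carr(4) by (simp add: center_def eq)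
qed

section \<open>Triangular and Jordan form over an algebraically closed field\<close>

lemma invertible_matI:
  fixes A :: "'a::field mat"
  assumes "A \<in> carrier_mat n n" "B \<in> carrier_mat n n" "A * B = 1\<^sub>m n"
  shows "invertible_mat A"
  using assms mat_mult_left_right_inverse[OF assms]
  by (auto simp: invertible_mat_def inverts_mat_def)

lemma invertible_matE:
  assumes "invertible_mat A" "A \<in> carrier_mat n n"
  obtains B where "B \<in> carrier_mat n n" "A * B = 1\<^sub>m n" "B * A = 1\<^sub>m n"
proof -
  from assms obtain B where "A * B = 1\<^sub>m n" "B * A = 1\<^sub>m (dim_row B)"
    by (auto simp: invertible_mat_def inverts_mat_def)
  moreover from this have "B \<in> carrier_mat n n"
    using assms(2) by (metis carrier_matD(2) carrier_matI index_mult_mat(3) index_one_mat(3))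
  ultimately show thesis using that by auto
qed

text \<open>\<open>?P\<close> is the identity with column \<open>j\<close> replaced by
  \<open>v\<close>, and \<open>?Q\<close> is the elimination step with pivot \<open>v $ j\<close>
  that undoes it.\<close>

lemma invertible_mat_with_col:
  fixes v :: "'a::field vec"
  assumes v: "v \<in> carrier_vec n" and j: "j < n" "v $ j \<noteq> 0"
  shows "\<exists>P Q. P \<in> carrier_mat n n \<and> Q \<in> carrier_mat n n \<and> P * Q = 1\<^sub>m n \<and> Q * P = 1\<^sub>m n \<and> col P j = v"
proof (intro exI conjI)
  let ?P = "mat n n (\<lambda>(i, k). if k = j then v $ i else if i = k then 1 else 0)"
  let ?Q = "mat n n (\<lambda>(i, k). if k = j then (if i = j then 1 / v $ j else - v $ i / v $ j)
                               else if i = k then 1 else 0)"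
  show P: "?P \<in> carrier_mat n n" and Q: "?Q \<in> carrier_mat n n" by auto
  show QP: "?Q * ?P = 1\<^sub>m n"
  proof (rule eq_matI)
    fix i k assume "i < dim_row (1\<^sub>m n :: 'a mat)" "k < dim_col (1\<^sub>m n :: 'a mat)"
    then have ik: "i < n" "k < n" by auto
    have "(?Q * ?P) $$ (i, k) = (\<Sum>l\<in>{0..<n}. ?Q $$ (i, l) * ?P $$ (l, k))"
      using ik by (simp add: scalar_prod_def)
    also have "\<dots> = ?Q $$ (i, j) * ?P $$ (j, k) + (\<Sum>l\<in>{0..<n} - {j}. ?Q $$ (i, l) * ?P $$ (l, k))"
      using j by (subst sum.remove[of _ j]) auto
    also have "(\<Sum>l\<in>{0..<n} - {j}. ?Q $$ (i, l) * ?P $$ (l, k)) =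
        (\<Sum>l\<in>{0..<n} - {j}. if l = i then ?P $$ (i, k) else 0)"
      using ik by (intro sum.cong) auto
    also have "\<dots> = (if i = j then 0 else ?P $$ (i, k))"
      using ik by (simp add: sum.delta)
    finally show "(?Q * ?P) $$ (i, k) = 1\<^sub>m n $$ (i, k)"
      using ik j by auto
  qed auto
  show "?P * ?Q = 1\<^sub>m n" by (rule mat_mult_left_right_inverse[OF Q P QP])
  show "col ?P j = v" using v j by (intro eq_vecI) auto
qed

lemma mat_mult_unit_vec:
  fixes A :: "'a::comm_ring_1 mat"
  assumes "A \<in> carrier_mat m n" "j < n"
  shows "A *\<^sub>v unit_vec n j = col A j"
  using assms by (intro eq_vecI) auto

text \<open>The nonzero entry of \<open>v\<close> may sit at any index, so a column swap brings
  \<open>v\<close> to position 0, where the block decomposition below wants the eigenvector.\<close>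

lemma invertible_mat_with_col_0:
  fixes v :: "'a::field vec"
  assumes v: "v \<in> carrier_vec n" "v \<noteq> 0\<^sub>v n" and n: "n > 0"
  shows "\<exists>P Q. P \<in> carrier_mat n n \<and> Q \<in> carrier_mat n n \<and> P * Q = 1\<^sub>m n \<and> Q * P = 1\<^sub>m n \<and> col P 0 = v"
proof -
  obtain j where j: "j < n" "v $ j \<noteq> 0" using v by (metis carrier_vecD eq_vecI index_zero_vec)
  obtain P Q where P: "P \<in> carrier_mat n n" and Q: "Q \<in> carrier_mat n n" and PQ: "P * Q = 1\<^sub>m n"
    and col: "col P j = v"
    using invertible_mat_with_col[OF v(1) j] by blast
  let ?S = "swaprows_mat n 0 j :: 'a mat"
  have S: "?S \<in> carrier_mat n n" "?S * ?S = 1\<^sub>m n" using swaprows_mat_inv[OF n j(1)] by auto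
  have inv: "(P * ?S) * (?S * Q) = 1\<^sub>m n"
  proof -
    have "(P * ?S) * (?S * Q) = P * (?S * (?S * Q))"
      using P Q S by (intro assoc_mult_mat[of _ n n _ n _ n]) auto
    also have "?S * (?S * Q) = (?S * ?S) * Q"
      using Q S by (intro assoc_mult_mat[of _ n n _ n _ n, symmetric]) auto
    finally show ?thesis using S(2) Q PQ by simp
  qed
  have "col (P * ?S) 0 = P *\<^sub>v col ?S 0" using P n by (intro col_mult2[of _ n n _ n]) auto
  also have "col ?S 0 = unit_vec n j" using n j by (intro eq_vecI) (auto simp: unit_vec_def)
  also have "P *\<^sub>v unit_vec n j = v" using mat_mult_unit_vec[OF P] col j by simp
  finally have "col (P * ?S) 0 = v" .
  moreover have "P * ?S \<in> carrier_mat n n" "?S * Q \<in> carrier_mat n n" using P Q S by auto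
  ultimately show ?thesis using inv mat_mult_left_right_inverse[OF _ _ inv] by blast
qed

lemma alg_closed_eigenvector_exists:
  fixes A :: "'a::alg_closed_field mat"
  assumes A: "A \<in> carrier_mat n n" and n: "n > 0"
  shows "\<exists>e v. eigenvector A v e"
proof -
  have "degree (char_poly A) > 0" using degree_monic_char_poly[OF A] n by simp
  then obtain e where "poly (char_poly A) e = 0" using alg_closed_imp_poly_has_root by blast
  then show ?thesis using eigenvalue_root_char_poly[OF A] by (auto simp: eigenvalue_def)
qed

text \<open>An eigenvector as first basis vector makes the first column a multiple of the first unit
  vector. Induction triangularises the lower right block, and this change of basis otherwise affects
  only the first row, turning \<open>A2\<close> into \<open>B2\<close>.\<close>

lemma similar_upper_triangular:
  fixes A :: "'a::alg_closed_field mat"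
  assumes "A \<in> carrier_mat n n"
  shows "\<exists>B. B \<in> carrier_mat n n \<and> upper_triangular B \<and> similar_mat A B"
  using assms
proof (induction n arbitrary: A)
  case 0
  then show ?case by (intro exI[of _ A]) (auto intro: similar_mat_refl)
next
  case (Suc n A)
  obtain e v where "eigenvector A v e" using alg_closed_eigenvector_exists[OF Suc.prems] by auto
  then have v: "v \<in> carrier_vec (Suc n)" "v \<noteq> 0\<^sub>v (Suc n)" and Av: "A *\<^sub>v v = e \<cdot>\<^sub>v v"
    using Suc.prems by (auto simp: eigenvector_def)
  obtain P Q where P: "P \<in> carrier_mat (Suc n) (Suc n)" and Q: "Q \<in> carrier_mat (Suc n) (Suc n)"
    and PQ: "P * Q = 1\<^sub>m (Suc n)" "Q * P = 1\<^sub>m (Suc n)" and col: "col P 0 = v"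
    using invertible_mat_with_col_0[OF v] by blast
  define A' where "A' = Q * A * P"
  have A': "A' \<in> carrier_mat (Suc n) (Suc n)" using P Q Suc.prems by (auto simp: A'_def)
  have "similar_mat A' A"
    unfolding similar_mat_def
    using similar_mat_witI[OF PQ(2,1) A'_def A' Suc.prems Q P] by blast
  then have sim: "similar_mat A A'" by (rule similar_mat_sym)
  have "col A' 0 = (Q * A) *\<^sub>v v"
    unfolding A'_def col[symmetric] using P Q Suc.prems
    by (intro col_mult2[of _ "Suc n" "Suc n" _ "Suc n"]) auto
  also have "\<dots> = Q *\<^sub>v (A *\<^sub>v v)"
    by (rule assoc_mult_mat_vec[OF Q Suc.prems v(1)])
  also have "\<dots> = Q *\<^sub>v (e \<cdot>\<^sub>v v)" by (simp only: Av)
  also have "\<dots> = e \<cdot>\<^sub>v (Q *\<^sub>v col P 0)" using Q v by (simp add: mult_mat_vec[of _ "Suc n" "Suc n"] col)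
  also have "Q *\<^sub>v col P 0 = col (1\<^sub>m (Suc n)) 0"
    using P Q PQ(2) by (simp flip: col_mult2[of _ "Suc n" "Suc n" _ "Suc n"])
  finally have col0: "col A' 0 = e \<cdot>\<^sub>v unit_vec (Suc n) 0" by simp
  obtain A1 A2 A0 A3 where split: "split_block A' 1 1 = (A1, A2, A0, A3)"
    by (cases "split_block A' 1 1") auto
  have "dim_row A' = 1 + n" "dim_col A' = 1 + n" using A' by auto
  from split_block[OF split this]
  have A1: "A1 \<in> carrier_mat 1 1" and A2: "A2 \<in> carrier_mat 1 n" and A0: "A0 \<in> carrier_mat n 1"
    and A3: "A3 \<in> carrier_mat n n" and block: "A' = four_block_mat A1 A2 A0 A3" by auto
  have "A' $$ (Suc i, 0) = 0" if "i < n" for i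
  proof -
    have "A' $$ (Suc i, 0) = col A' 0 $ Suc i" using A' that by simp
    then show ?thesis unfolding col0 using that by simp
  qed
  then have "A0 = 0\<^sub>m n 1"
    using split A' by (intro eq_matI) (auto simp: split_block_def Let_def)
  then have block: "A' = four_block_mat A1 A2 (0\<^sub>m n 1) A3" using block by simp
  obtain B3 where B3: "B3 \<in> carrier_mat n n" "upper_triangular B3" "similar_mat A3 B3"
    using Suc.IH[OF A3] by blast
  obtain B2 where B2: "B2 \<in> carrier_mat 1 n"
    and sim': "similar_mat A' (four_block_mat A1 B2 (0\<^sub>m n 1) B3)"
    using similar_mat_four_block_0_ex[OF similar_mat_refl[OF A1] B3(3) A2 A1 A3] block by auto
  show ?case
  proof (intro exI conjI)
    show "similar_mat A (four_block_mat A1 B2 (0\<^sub>m n 1) B3)" by (rule similar_mat_trans[OF sim sim'])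
    show "four_block_mat A1 B2 (0\<^sub>m n 1) B3 \<in> carrier_mat (Suc n) (Suc n)"
      using four_block_carrier_mat[OF A1 B3(1)] by simp
    show "upper_triangular (four_block_mat A1 B2 (0\<^sub>m n 1) B3)"
      using A1 by (intro upper_triangular_four_block[OF A1 B3(1) _ B3(2)]) auto
  qed
qed

lemma jordan_nf_exists_alg_closed:
  fixes A :: "'a::alg_closed_field mat"
  assumes "A \<in> carrier_mat n n"
  shows "\<exists>n_as. jordan_nf A n_as"
proof -
  obtain B where B: "B \<in> carrier_mat n n" "upper_triangular B" "similar_mat A B"
    using similar_upper_triangular[OF assms] by blast
  show ?thesis using triangular_to_jnf_vector[OF B(1,2)] similar_mat_trans[OF B(3)]
    unfolding jordan_nf_def by blast
qed

text \<open>A 1 above the diagonal occurs only inside a block, where the eigenvalue is constant; at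
  the border of two blocks the entry is 0. The induction splits off the first block.\<close>

lemma jordan_matrix_index:
  fixes n_as :: "(nat \<times> 'a::{zero_neq_one, monoid_add}) list"
  assumes "i < sum_list (map fst n_as)" "j < sum_list (map fst n_as)"
  shows "j \<noteq> i \<Longrightarrow> j \<noteq> Suc i \<Longrightarrow> jordan_matrix n_as $$ (i, j) = 0"
    and "j = Suc i \<Longrightarrow> jordan_matrix n_as $$ (i, j) = 0 \<or>
      jordan_matrix n_as $$ (i, j) = 1 \<and> jordan_matrix n_as $$ (i, i) = jordan_matrix n_as $$ (j, j)"
proof -
  have "(j \<noteq> i \<longrightarrow> j \<noteq> Suc i \<longrightarrow> jordan_matrix n_as $$ (i, j) = 0) \<and>
    (j = Suc i \<longrightarrow> jordan_matrix n_as $$ (i, j) = 0 \<or>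
      jordan_matrix n_as $$ (i, j) = 1 \<and> jordan_matrix n_as $$ (i, i) = jordan_matrix n_as $$ (j, j))"
    using assms
  proof (induction n_as arbitrary: i j)
    case (Cons x n_as)
    obtain m a where x: "x = (m, a)" by force
    show ?case
      using Cons.prems Cons.IH[of "i - m" "j - m"]
      unfolding x jordan_matrix_Cons
      by (auto simp: index_mat_four_block Suc_diff_le)
  qed simp
  then show "j \<noteq> i \<Longrightarrow> j \<noteq> Suc i \<Longrightarrow> jordan_matrix n_as $$ (i, j) = 0"
    and "j = Suc i \<Longrightarrow> jordan_matrix n_as $$ (i, j) = 0 \<or>
      jordan_matrix n_as $$ (i, j) = 1 \<and> jordan_matrix n_as $$ (i, i) = jordan_matrix n_as $$ (j, j)"
    by auto
qed

text \<open>The list of blocks is traded for conditions on entries, since the later arguments only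
  ask which basis vector is linked to its predecessor.\<close>

lemma similar_jordan_shape:
  fixes X :: "'a::alg_closed_field mat"
  assumes X: "X \<in> carrier_mat n n"
  obtains P Q J where "P \<in> carrier_mat n n" "Q \<in> carrier_mat n n" "J \<in> carrier_mat n n"
    "P * Q = 1\<^sub>m n" "Q * P = 1\<^sub>m n" "J = Q * X * P" "X = P * J * Q"
    "\<And>i j. i < n \<Longrightarrow> j < n \<Longrightarrow> j \<noteq> i \<Longrightarrow> j \<noteq> Suc i \<Longrightarrow> J $$ (i, j) = 0"
    "\<And>i. Suc i < n \<Longrightarrow> J $$ (i, Suc i) = 0 \<or> J $$ (i, Suc i) = 1 \<and> J $$ (i, i) = J $$ (Suc i, Suc i)"
proof -
  obtain n_as where nf: "jordan_nf X n_as" using jordan_nf_exists_alg_closed[OF X] by blast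
  let ?J = "jordan_matrix n_as"
  obtain P Q where wit: "similar_mat_wit X ?J P Q"
    using nf by (auto simp: jordan_nf_def similar_mat_def)
  note w = similar_mat_witD2[OF X wit]
  have J: "?J \<in> carrier_mat n n" by (rule w)
  have J_eq: "?J = Q * X * P" by (rule similar_mat_witD2(3)[OF J similar_mat_wit_sym[OF wit]])
  from J have n: "n = sum_list (map fst n_as)" by (metis carrier_matD(1) jordan_matrix_dim(1))
  show thesis
  proof (rule that[of P Q ?J])
    fix i j
    show "?J $$ (i, j) = 0" if "i < n" "j < n" "j \<noteq> i" "j \<noteq> Suc i"
      using jordan_matrix_index(1)[of i n_as j] that n by simp
    show "?J $$ (i, Suc i) = 0 \<or> ?J $$ (i, Suc i) = 1 \<and> ?J $$ (i, i) = ?J $$ (Suc i, Suc i)"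
      if "Suc i < n"
      using jordan_matrix_index(2)[of i n_as "Suc i"] that n by simp
  qed (fact w J_eq)+
qed

section \<open>Direct sums and limits of direct sums from the center\<close>

lemma Const_mult_eq_0_iff: "Const c * p = 0 \<longleftrightarrow> c = 0 \<or> p = 0"
  for p :: "'a::field mpoly"
  by (auto simp: poly_mapping_eq_iff fun_eq_iff)

lemma partial_deriv_forms_eq_0:
  fixes p :: "'a::comm_semiring_1 mpoly"
  assumes "p \<in> forms S d" "i \<notin> S"
  shows "partial_deriv i p = 0"
proof (rule poly_mapping_eqI)
  fix m :: "nat \<Rightarrow>\<^sub>0 nat"
  have "i \<in> Poly_Mapping.keys (m + Poly_Mapping.single i 1)" by (simp add: keys_exponent_add)
  then have "Poly_Mapping.lookup p (m + Poly_Mapping.single i 1) = 0"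
    using assms unfolding forms_iff by blast
  then show "Poly_Mapping.lookup (partial_deriv i p) m = Poly_Mapping.lookup 0 m"
    by (simp add: lookup_partial_deriv)
qed

lemma scalar_in_center: "c \<cdot>\<^sub>m 1\<^sub>m n \<in> center n f"
proof -
  have *: "(\<Sum>k<n. Const ((c \<cdot>\<^sub>m 1\<^sub>m n) $$ (k, j)) * q k) = Const c * q j" if "j < n" for q j
  proof -
    have "(\<Sum>k<n. Const ((c \<cdot>\<^sub>m 1\<^sub>m n) $$ (k, j)) * q k) =
        (\<Sum>k<n. if k = j then Const c * q j else 0)"
      using that by (intro sum.cong) auto
    then show ?thesis using that by simp
  qed
  then show ?thesis by (simp add: center_iff partial_deriv_commute)
qed

lemma central_iff: "central n f \<longleftrightarrow> (\<forall>X\<in>center n f. \<exists>c. X = c \<cdot>\<^sub>m 1\<^sub>m n)"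
  using scalar_in_center by (auto simp: central_def)

text \<open>When the mixed second derivatives vanish, the derivatives along each of the two groups
  of variables involve only that group. Each group of derivatives is closed and has a potential in
  its own variables, and the sum of the two potentials has the gradient of \<open>g\<close>.\<close>

lemma direct_sum_of_hessian:
  fixes g :: "'a::field mpoly"
  assumes char: "CHAR('a) = 0 \<or> CHAR('a) > d" and d: "d > 0" and g: "g \<in> forms {..<n} d"
    and a: "0 < a" "a < n"
    and zero: "\<And>i j. i < a \<Longrightarrow> a \<le> j \<Longrightarrow> j < n \<Longrightarrow> partial_deriv i (partial_deriv j g) = 0"
  shows "\<exists>g1\<in>forms {0..<a} d. \<exists>g2\<in>forms {a..<n} d. g = g1 + g2"
proof -
  have e: "of_nat (Suc (d - 1)) \<noteq> (0::'a)" using of_nat_nonzero_of_char[OF char, of d] d by simp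
  have char': "CHAR('a) = 0 \<or> CHAR('a) > d - 1" using char by auto
  have potential: "\<exists>h\<in>forms S d. \<forall>j\<in>S. partial_deriv j h = partial_deriv j g"
    if S: "S \<subseteq> {..<n}" and mixed: "\<And>i j. i \<in> S \<Longrightarrow> j \<in> {..<n} - S \<Longrightarrow> partial_deriv j (partial_deriv i g) = 0" for S
  proof -
    have "partial_deriv i g \<in> forms ({..<n} - ({..<n} - S)) (d - 1)" if "i \<in> S" for i
      using that mixed
      by (intro forms_remove_vars[OF char'] forms_partial_deriv[OF g]) auto
    moreover have "{..<n} - ({..<n} - S) = S" using S by auto
    ultimately show ?thesis
      using potential_exists[of S "\<lambda>i. partial_deriv i g" "d - 1"] e d
        finite_subset[OF S] by (auto simp: partial_deriv_commute)
  qed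
  have "\<exists>h\<in>forms {0..<a} d. \<forall>j\<in>{0..<a}. partial_deriv j h = partial_deriv j g"
    by (rule potential) (use a zero partial_deriv_commute[of _ _ g] in fastforce)+
  then obtain g1 where g1: "g1 \<in> forms {0..<a} d" "\<And>j. j < a \<Longrightarrow> partial_deriv j g1 = partial_deriv j g"
    by auto
  have "\<exists>h\<in>forms {a..<n} d. \<forall>j\<in>{a..<n}. partial_deriv j h = partial_deriv j g"
    by (rule potential) (use a zero in auto)
  then obtain g2 where g2: "g2 \<in> forms {a..<n} d"
    "\<And>j. a \<le> j \<Longrightarrow> j < n \<Longrightarrow> partial_deriv j g2 = partial_deriv j g"
    by auto
  have "g = g1 + g2"
  proof (rule forms_eqI_partial_deriv[OF char d g])
    show "g1 + g2 \<in> forms {..<n} d"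
      using a by (intro forms_add forms_mono[OF g1(1)] forms_mono[OF g2(1)]) auto
    fix i assume "i \<in> {..<n}"
    then show "partial_deriv i g = partial_deriv i (g1 + g2)"
      using g1(2)[of i] g2(2)[of i] partial_deriv_forms_eq_0[OF g1(1), of i]
        partial_deriv_forms_eq_0[OF g2(1), of i]
      by (cases "i < a") (auto simp: partial_deriv_add)
  qed
  then show ?thesis using g1 g2 by blast
qed

text \<open>By \<open>zero\<close> the first \<open>l\<close> derivatives of \<open>g\<close>
  involve only the second group of \<open>l\<close> variables, and by \<open>shift\<close> they form
  a closed field there, with potential \<open>h\<close>. Subtracting the sum built from
  \<open>h\<close> removes the first \<open>l\<close> variables from \<open>g\<close>.\<close>

lemma LDS_of_hessian:
  fixes g :: "'a::field mpoly"
  assumes char: "CHAR('a) = 0 \<or> CHAR('a) > d" and d: "d > 0" and g: "g \<in> forms {..<n} d"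
    and l: "2 * l \<le> n"
    and zero: "\<And>i j. i < l \<Longrightarrow> j < n \<Longrightarrow> j \<notin> {l..<2 * l} \<Longrightarrow> partial_deriv i (partial_deriv j g) = 0"
    and shift: "\<And>i j. i < l \<Longrightarrow> j < l \<Longrightarrow>
      partial_deriv (l + i) (partial_deriv j g) = partial_deriv (l + j) (partial_deriv i g)"
  shows "\<exists>h\<in>forms {l..<2 * l} d. \<exists>g'\<in>forms {l..<n} d.
    g = (\<Sum>i<l. Var i * partial_deriv (l + i) h) + g'"
proof -
  let ?S = "{l..<2 * l}"
  have e: "of_nat (Suc (d - 1)) \<noteq> (0::'a)" using of_nat_nonzero_of_char[OF char, of d] d by simp
  have char': "CHAR('a) = 0 \<or> CHAR('a) > d - 1" using char by auto
  have q: "partial_deriv i g \<in> forms ?S (d - 1)" if "i < l" for i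
  proof -
    have "partial_deriv i g \<in> forms ({..<n} - ({..<n} - ?S)) (d - 1)"
    proof (rule forms_remove_vars[OF char' forms_partial_deriv[OF g]])
      fix j assume "j \<in> {..<n} - ?S"
      then have "partial_deriv i (partial_deriv j g) = 0" using zero[OF that] by blast
      then show "partial_deriv j (partial_deriv i g) = 0" by (subst partial_deriv_commute)
    qed
    moreover have "{..<n} - ({..<n} - ?S) = ?S" using l by auto
    ultimately show ?thesis by simp
  qed
  have "\<exists>h\<in>forms ?S (Suc (d - 1)). \<forall>j\<in>?S. partial_deriv j h = partial_deriv (j - l) g"
  proof (rule potential_exists[OF _ _ _ e])
    fix i j assume "i \<in> ?S" "j \<in> ?S"
    then show "partial_deriv j (partial_deriv (i - l) g) = partial_deriv i (partial_deriv (j - l) g)"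
      using shift[of "j - l" "i - l"] by auto
  qed (use q in auto)
  then obtain h where h: "h \<in> forms ?S d"
    "\<And>i. i < l \<Longrightarrow> partial_deriv (l + i) h = partial_deriv i g"
    using d by force
  define g' where "g' = g - (\<Sum>i<l. Var i * partial_deriv (l + i) h)"
  have "(\<Sum>i<l. Var i * partial_deriv (l + i) h) \<in> forms {..<n} d"
  proof (rule forms_sum)
    fix i assume "i \<in> {..<l}"
    then have i: "i \<in> {..<n}" using l by auto
    have "partial_deriv (l + i) h \<in> forms {..<n} (d - 1)"
      using l by (intro forms_mono[OF forms_partial_deriv[OF h(1)]]) auto
    from forms_Var_mult[OF i this] show "Var i * partial_deriv (l + i) h \<in> forms {..<n} d"
      using d by simp
  qed
  then have g'n: "g' \<in> forms {..<n} d" unfolding g'_def by (intro forms_diff g)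
  have "partial_deriv j g' = 0" if "j < l" for j
  proof -
    \<comment> \<open>The second term of the product rule is a second derivative of \<open>g\<close>
      along two of the first \<open>l\<close> variables, which \<open>zero\<close> makes
      vanish.\<close>
    have "partial_deriv j (Var i * partial_deriv (l + i) h) = (if i = j then partial_deriv j g else 0)"
      if "i < l" for i
    proof -
      have "partial_deriv j (partial_deriv i g) = 0" using zero[of j i] that \<open>j < l\<close> l by simp
      then show ?thesis using that by (simp add: partial_deriv_Var_mult h(2))
    qed
    then have "(\<Sum>i<l. partial_deriv j (Var i * partial_deriv (l + i) h)) =
        (\<Sum>i<l. if i = j then partial_deriv j g else 0)"
      by (intro sum.cong) auto
    then show ?thesis
      unfolding g'_def partial_deriv_diff partial_deriv_sum using that by simp
  qed
  then have "g' \<in> forms ({..<n} - {..<l}) d"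
    by (intro forms_remove_vars[OF char g'n]) auto
  moreover have "{..<n} - {..<l} = {l..<n}" by auto
  moreover have "g = (\<Sum>i<l. Var i * partial_deriv (l + i) h) + g'" by (simp add: g'_def)
  ultimately show ?thesis using h(1) by auto
qed

text \<open>
  From here on \<open>H\<close> stands for the Hessian in a Jordan basis of an element of the center.  Entrywise,
  symmetry of \<open>H J\<close> relates \<open>H a b\<close> to the neighbouring entries \<open>H (a - 1) b\<close> and \<open>H a (b - 1)\<close>.
\<close>

locale jordan_symmetric =
  fixes n :: nat and J :: "'a::field mat" and H :: "nat \<Rightarrow> nat \<Rightarrow> 'a mpoly"
  assumes J_0: "\<And>i j. i < n \<Longrightarrow> j < n \<Longrightarrow> j \<noteq> i \<Longrightarrow> j \<noteq> Suc i \<Longrightarrow> J $$ (i, j) = 0"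
    and J_Suc: "\<And>i. Suc i < n \<Longrightarrow>
      J $$ (i, Suc i) = 0 \<or> J $$ (i, Suc i) = 1 \<and> J $$ (i, i) = J $$ (Suc i, Suc i)"
    and H_sym: "\<And>a b. a < n \<Longrightarrow> b < n \<Longrightarrow> H a b = H b a"
    and HJ_sym: "\<And>a b. a < n \<Longrightarrow> b < n \<Longrightarrow>
      (\<Sum>k<n. Const (J $$ (k, b)) * H a k) = (\<Sum>k<n. Const (J $$ (k, a)) * H b k)"
begin

text \<open>The nilpotent part of \<open>J\<close> sends basis vector \<open>b\<close> to basis
  vector \<open>b - 1\<close>. The guard \<open>0 < b\<close> matters: for \<open>b = 0\<close> the
  entry would be the diagonal one, \<open>J $$ (0, 0)\<close>.\<close>

definition linked :: "nat \<Rightarrow> bool" where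
  "linked b \<longleftrightarrow> 0 < b \<and> J $$ (b - 1, b) = 1"

lemma linked_pos: "linked b \<Longrightarrow> 0 < b"
  by (simp add: linked_def)

lemma not_linked: "0 < b \<Longrightarrow> b < n \<Longrightarrow> \<not> linked b \<Longrightarrow> J $$ (b - 1, b) = 0"
  using J_Suc[of "b - 1"] by (auto simp: linked_def)

lemma linked_diag: "b < n \<Longrightarrow> linked b \<Longrightarrow> J $$ (b - 1, b - 1) = J $$ (b, b)"
  using J_Suc[of "b - 1"] by (auto simp: linked_def)

lemma HJ_entry:
  assumes "a < n" "b < n"
  shows "(\<Sum>k<n. Const (J $$ (k, b)) * H a k) =
    Const (J $$ (b, b)) * H a b + (if linked b then H a (b - 1) else 0)"
proof -
  have "(\<Sum>k<n. Const (J $$ (k, b)) * H a k) = Const (J $$ (b, b)) * H a b +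
      (\<Sum>k\<in>{..<n} - {b}. Const (J $$ (k, b)) * H a k)"
    using assms by (simp add: sum.remove[of _ b])
  also have "(\<Sum>k\<in>{..<n} - {b}. Const (J $$ (k, b)) * H a k) =
      (\<Sum>k\<in>{..<n} - {b}. if k = b - 1 then (if linked b then H a (b - 1) else 0) else 0)"
  proof (rule sum.cong[OF refl])
    fix k assume k: "k \<in> {..<n} - {b}"
    show "Const (J $$ (k, b)) * H a k =
      (if k = b - 1 then (if linked b then H a (b - 1) else 0) else 0)"
    proof (cases "k = b - 1")
      case True
      then have "0 < b" using k by auto
      then show ?thesis using True not_linked[of b] assms by (auto simp: linked_def)
    next
      case False
      then show ?thesis using J_0[of k b] k assms by auto
    qed
  qed
  also have "\<dots> = (if linked b then H a (b - 1) else 0)"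
    using assms by (auto simp: linked_def)
  finally show ?thesis .
qed

text \<open>Symmetry expresses the difference of the eigenvalues times \<open>H a b\<close> through
  \<open>H (a - 1) b\<close> and \<open>H a (b - 1)\<close>, which occur only across links. They
  belong to the same two eigenvalues and have a smaller index sum, so they vanish by
  induction.\<close>

lemma H_eq_0:
  assumes "a < n" "b < n" "J $$ (a, a) \<noteq> J $$ (b, b)"
  shows "H a b = 0"
  using assms
proof (induction "a + b" arbitrary: a b rule: less_induct)
  case less
  have "H b (a - 1) = 0" if "linked a"
  proof -
    have "a - 1 + b < a + b" "a - 1 < n" using that less.prems by (auto simp: linked_def)
    moreover have "J $$ (a - 1, a - 1) \<noteq> J $$ (b, b)"
      using less.prems linked_diag[OF less.prems(1) that] by simp
    ultimately have "H (a - 1) b = 0" using less.hyps less.prems(2) by blast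
    then show ?thesis using H_sym[OF less.prems(2) \<open>a - 1 < n\<close>] by simp
  qed
  moreover have "H a (b - 1) = 0" if "linked b"
  proof -
    have "a + (b - 1) < a + b" "b - 1 < n" using that less.prems by (auto simp: linked_def)
    moreover have "J $$ (a, a) \<noteq> J $$ (b - 1, b - 1)"
      using less.prems linked_diag[OF less.prems(2) that] by simp
    ultimately show ?thesis using less.hyps less.prems(1) by blast
  qed
  ultimately have eq: "Const (J $$ (b, b)) * H a b = Const (J $$ (a, a)) * H a b"
    using HJ_sym[OF less.prems(1,2)]
    unfolding HJ_entry[OF less.prems(1,2)] HJ_entry[OF less.prems(2,1)] H_sym[OF less.prems(2,1)]
    by (simp split: if_splits)
  have "Const (J $$ (b, b) - J $$ (a, a)) * H a b + Const (J $$ (a, a)) * H a b =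
      Const (J $$ (b, b)) * H a b"
    by (simp only: diff_add_cancel flip: distrib_right Const_add)
  then have "Const (J $$ (b, b) - J $$ (a, a)) * H a b = 0"
    unfolding eq by (simp only: add_cancel_left_left)
  then show ?case using less.prems unfolding Const_mult_eq_0_iff by simp
qed

text \<open>\<open>chain k b\<close>: the \<open>k\<close>-th power of the nilpotent part of \<open>J\<close> maps \<open>e\<^sub>b\<close> to \<open>e\<^bsub>b-k\<^esub>\<close>, not to 0.\<close>

definition chain :: "nat \<Rightarrow> nat \<Rightarrow> bool" where
  "chain k b \<longleftrightarrow> k \<le> b \<and> (\<forall>i<k. linked (b - i))"

lemma chain_Suc: "chain (Suc k) b \<longleftrightarrow> chain k b \<and> linked (b - k)"
proof -
  have "Suc k \<le> b \<longleftrightarrow> k \<le> b \<and> 0 < b - k" by arith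
  then show ?thesis
    using linked_pos[of "b - k"] unfolding chain_def less_Suc_eq by blast
qed

text \<open>Splits a chain at its first link, where \<open>chain_Suc\<close> splits it at its last.
  \<open>H_chain\<close> needs both: the factor taken from the end of the chain of \<open>b\<close>
  becomes the beginning of the chain of \<open>a\<close>.\<close>

lemma chain_Suc_shift: "chain (Suc k) b \<longleftrightarrow> linked b \<and> chain k (b - 1)"
proof -
  have "(\<forall>i<Suc k. linked (b - i)) \<longleftrightarrow> linked b \<and> (\<forall>i<k. linked (b - 1 - i))"
    by (simp add: All_less_Suc2)
  moreover have "Suc k \<le> b \<longleftrightarrow> 0 < b \<and> k \<le> b - 1" by arith
  ultimately show ?thesis using linked_pos[of b] unfolding chain_def by blast
qed

lemma chain_add: "chain k b \<Longrightarrow> chain k' (b - k) \<Longrightarrow> chain (k + k') b"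
proof (induction k')
  case (Suc k')
  then show ?case by (simp add: chain_Suc diff_diff_add)
qed simp

text \<open>This is the symmetry of H N^k for the nilpotent part N; the conditionals account for N^k
  killing a basis vector. With a single eigenvalue the scalar part of \<open>J\<close> cancels,
  which gives k = 1, and the induction moves one factor N at a time across H.\<close>

lemma H_chain:
  assumes single: "\<And>i j. i < n \<Longrightarrow> j < n \<Longrightarrow> J $$ (i, i) = J $$ (j, j)"
    and "a < n" "b < n"
  shows "(if chain k b then H a (b - k) else 0) = (if chain k a then H (a - k) b else 0)"
  using assms(2,3)
proof (induction k arbitrary: a)
  case 0
  then show ?case by (simp add: chain_def)
next
  case (Suc k)
  have shift: "(if linked c then H a (c - 1) else 0) = (if linked a then H (a - 1) c else 0)"
    if "c < n" for c
  proof -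
    have "Const (J $$ (c, c)) * H a c + (if linked c then H a (c - 1) else 0) =
        Const (J $$ (a, a)) * H c a + (if linked a then H c (a - 1) else 0)"
      using HJ_sym[OF Suc.prems(1) that]
      unfolding HJ_entry[OF Suc.prems(1) that] HJ_entry[OF that Suc.prems(1)] .
    then have "(if linked c then H a (c - 1) else 0) = (if linked a then H c (a - 1) else 0)"
      unfolding single[OF Suc.prems(1) that] H_sym[OF that Suc.prems(1)] by (rule add_left_imp_eq)
    also have "H c (a - 1) = H (a - 1) c" using Suc.prems that by (intro H_sym) auto
    finally show ?thesis .
  qed
  have "(if chain (Suc k) b then H a (b - Suc k) else 0) =
      (if chain k b then (if linked (b - k) then H a (b - k - 1) else 0) else 0)"
    by (auto simp: chain_Suc)
  also have "\<dots> = (if linked a then (if chain k b then H (a - 1) (b - k) else 0) else 0)"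
  proof -
    have bk: "b - k < n" using Suc.prems by simp
    show ?thesis unfolding shift[OF bk] by simp
  qed
  also have "\<dots> = (if linked a then (if chain k (a - 1) then H (a - 1 - k) b else 0) else 0)"
  proof -
    have a1: "a - 1 < n" using Suc.prems by simp
    show ?thesis unfolding Suc.IH[OF a1 Suc.prems(2)] ..
  qed
  also have "\<dots> = (if chain (Suc k) a then H (a - Suc k) b else 0)"
    by (auto simp: chain_Suc_shift)
  finally show ?case .
qed

text \<open>\<open>K\<close> is the last exponent with N^K nonzero; it exists because a chain ending
  at an index below \<open>n\<close> has length at most \<open>n\<close>. As \<open>K\<close> is at
  least 1, \<open>K + K\<close> exceeds it.\<close>

lemma maximal_chain_exists:
  assumes "chain 1 b" "b < n"
  obtains K where "K \<ge> 1" "\<exists>b<n. chain K b" "\<And>b. b < n \<Longrightarrow> \<not> chain (K + K) b"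
proof -
  define K where "K = Max {k. \<exists>b<n. chain k b}"
  have "{k. \<exists>b<n. chain k b} \<subseteq> {..n}" unfolding chain_def by fastforce
  then have fin: "finite {k. \<exists>b<n. chain k b}" by (rule finite_subset) simp
  have one: "1 \<in> {k. \<exists>b<n. chain k b}" using assms by blast
  show thesis
  proof (rule that[of K])
    show "1 \<le> K" unfolding K_def by (rule Max_ge[OF fin one])
    then show "\<not> chain (K + K) c" if "c < n" for c
      using Max_ge[OF fin, of "K + K"] that unfolding K_def[symmetric] by fastforce
    show "\<exists>b<n. chain K b" using Max_in[OF fin] one unfolding K_def by blast
  qed
qed

end

text \<open>Selected Jordan basis vectors are to become the first \<open>m\<close> new variables.
  The complements of the prescribed domain and image have the same size, so any bijection between
  them completes the permutation. The bound on \<open>m\<close> later supplies 2 l <= n.\<close>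

lemma extend_to_permutation:
  fixes m n :: nat
  assumes inj: "inj_on \<rho> {..<m}" and sub: "\<rho> ` {..<m} \<subseteq> {..<n}"
  shows "m \<le> n \<and> (\<exists>\<pi>. bij_betw \<pi> {..<n} {..<n} \<and> (\<forall>i<m. \<pi> i = \<rho> i))"
proof -
  have m: "m \<le> n" using card_inj_on_le[OF inj sub] by simp
  have "card ({..<n} - \<rho> ` {..<m}) = card {m..<n}"
    using card_image[OF inj] sub by (simp add: card_Diff_subset)
  then obtain w where w: "bij_betw w {m..<n} ({..<n} - \<rho> ` {..<m})"
    by (metis bij_betw_iff_card finite_Diff finite_atLeastLessThan finite_lessThan)
  let ?\<pi> = "\<lambda>i. if i < m then \<rho> i else w i"
  have "bij_betw ?\<pi> {..<m} (\<rho> ` {..<m})"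
    using inj_on_imp_bij_betw[OF inj] by (rule bij_betw_cong[THEN iffD1, rotated]) simp
  moreover have "bij_betw ?\<pi> {m..<n} ({..<n} - \<rho> ` {..<m})"
    using w by (rule bij_betw_cong[THEN iffD1, rotated]) simp
  ultimately have "bij_betw ?\<pi> ({..<m} \<union> {m..<n}) (\<rho> ` {..<m} \<union> ({..<n} - \<rho> ` {..<m}))"
    by (rule bij_betw_combine) auto
  moreover have "{..<m} \<union> {m..<n} = {..<n}" using m by auto
  moreover have "\<rho> ` {..<m} \<union> ({..<n} - \<rho> ` {..<m}) = {..<n}" using sub by auto
  ultimately show ?thesis using m by (intro conjI exI[of _ ?\<pi>]) auto
qed

text \<open>Permuting the columns of \<open>P\<close> and the rows of \<open>Q\<close> is the change
  to the reordered Jordan basis.\<close>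

lemma permuted_similarity:
  fixes P Q X :: "'a::field mat"
  assumes P: "P \<in> carrier_mat n n" and Q: "Q \<in> carrier_mat n n" and X: "X \<in> carrier_mat n n"
    and QP: "Q * P = 1\<^sub>m n" and \<pi>: "bij_betw \<pi> {..<n} {..<n}"
  defines "A \<equiv> mat n n (\<lambda>(i, j). P $$ (i, \<pi> j))" and "A' \<equiv> mat n n (\<lambda>(i, j). Q $$ (\<pi> i, j))"
  shows "A' * A = 1\<^sub>m n" "A' * X * A = mat n n (\<lambda>(i, j). (Q * X * P) $$ (\<pi> i, \<pi> j))"
proof -
  have \<pi>n: "\<pi> i < n" if "i < n" for i using \<pi> that by (auto simp: bij_betw_def)
  have \<pi>inj: "\<pi> i = \<pi> j \<longleftrightarrow> i = j" if "i < n" "j < n" for i j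
    using \<pi> that by (auto simp: bij_betw_def inj_on_def)
  have *: "A' * A = mat n n (\<lambda>(i, j). (Q * P) $$ (\<pi> i, \<pi> j))"
    using P Q \<pi>n by (intro eq_matI) (auto simp: A_def A'_def scalar_prod_def)
  show "A' * A = 1\<^sub>m n" unfolding * QP using \<pi>n \<pi>inj by (intro eq_matI) auto
  show "A' * X * A = mat n n (\<lambda>(i, j). (Q * X * P) $$ (\<pi> i, \<pi> j))"
  proof -
    have 1: "A' * X = mat n n (\<lambda>(i, j). (Q * X) $$ (\<pi> i, j))"
      using Q X \<pi>n by (intro eq_matI) (auto simp: A'_def scalar_prod_def)
    have QX: "Q * X \<in> carrier_mat n n" using Q X by simp
    define Y where "Y = Q * X"
    show ?thesis
      unfolding 1 using P QX \<pi>n unfolding Y_def[symmetric]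
      by (intro eq_matI) (auto simp: A_def scalar_prod_def)
  qed
qed

lemma not_central_imp_direct_sum_or_LDS:
  fixes f :: "'a::alg_closed_field mpoly"
  assumes char: "CHAR('a) = 0 \<or> CHAR('a) > d" and d: "d > 0" and f: "f \<in> forms {..<n} d"
    and nc: "\<not> central n f"
  shows "direct_sum_form n d f \<or> LDS_form n d f"
proof -
  obtain X where X: "X \<in> center n f" and nonscalar: "\<And>c. X \<noteq> c \<cdot>\<^sub>m 1\<^sub>m n"
    using nc by (auto simp: central_iff)
  have Xc: "X \<in> carrier_mat n n" using X by (simp add: center_def)
  obtain P Q J where PQJ: "P \<in> carrier_mat n n" "Q \<in> carrier_mat n n" "J \<in> carrier_mat n n"
    "P * Q = 1\<^sub>m n" "Q * P = 1\<^sub>m n" "J = Q * X * P" "X = P * J * Q"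
    and J_0: "\<And>i j. i < n \<Longrightarrow> j < n \<Longrightarrow> j \<noteq> i \<Longrightarrow> j \<noteq> Suc i \<Longrightarrow> J $$ (i, j) = 0"
    and J_Suc: "\<And>i. Suc i < n \<Longrightarrow>
      J $$ (i, Suc i) = 0 \<or> J $$ (i, Suc i) = 1 \<and> J $$ (i, i) = J $$ (Suc i, Suc i)"
    by (rule similar_jordan_shape[OF Xc]) (rule that)
  \<comment> \<open>The variables of the new form are ordered by \<open>\<pi>\<close>, whereas the
    Hessian handed to the locale stays indexed by the Jordan basis. The inverse of
    \<open>\<pi>\<close> translates, so one matrix \<open>J\<close> serves every ordering.\<close>
  have "\<exists>A. A \<in> carrier_mat n n \<and> invertible_mat A \<and>
    jordan_symmetric n J (\<lambda>a b. partial_deriv (the_inv_into {..<n} \<pi> a)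
      (partial_deriv (the_inv_into {..<n} \<pi> b) (lin_change n A f)))"
    if \<pi>: "bij_betw \<pi> {..<n} {..<n}" for \<pi>
  proof -
    define A where "A = mat n n (\<lambda>(i, j). P $$ (i, \<pi> j))"
    define A' where "A' = mat n n (\<lambda>(i, j). Q $$ (\<pi> i, j))"
    let ?g = "lin_change n A f"
    let ?\<pi>' = "the_inv_into {..<n} \<pi>"
    have Ac: "A \<in> carrier_mat n n" "A' \<in> carrier_mat n n" by (auto simp: A_def A'_def)
    note perm = permuted_similarity[OF PQJ(1,2) Xc PQJ(5) \<pi>, folded A_def A'_def PQJ(6)]
    have AA': "A * A' = 1\<^sub>m n" by (rule mat_mult_left_right_inverse[OF Ac(2,1) perm(1)])
    have center: "A' * X * A \<in> center n ?g" by (rule center_lin_change[OF f Ac AA' X])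
    have \<pi>': "?\<pi>' a < n" "\<pi> (?\<pi>' a) = a" if "a < n" for a
      using \<pi> that the_inv_into_into[of \<pi> "{..<n}" a "{..<n}"] f_the_inv_into_f[of \<pi> "{..<n}" a]
      by (auto simp: bij_betw_def)
    have \<pi>'': "?\<pi>' (\<pi> i) = i" if "i < n" for i
      using \<pi> that by (auto simp: bij_betw_def the_inv_into_f_f)
    have "jordan_symmetric n J (\<lambda>a b. partial_deriv (?\<pi>' a) (partial_deriv (?\<pi>' b) ?g))"
    proof (rule jordan_symmetric.intro[OF J_0 J_Suc partial_deriv_commute])
      fix a b assume ab: "a < n" "b < n"
      have *: "(\<Sum>k<n. Const (J $$ (k, b)) * partial_deriv (?\<pi>' a) (partial_deriv (?\<pi>' k) ?g)) =
          (\<Sum>k<n. Const ((A' * X * A) $$ (k, ?\<pi>' b)) * partial_deriv (?\<pi>' a) (partial_deriv k ?g))"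
        if "b < n" for a b
        unfolding sum.reindex_bij_betw[OF \<pi>, symmetric, of "\<lambda>k. Const (J $$ (k, b)) *
          partial_deriv (?\<pi>' a) (partial_deriv (?\<pi>' k) ?g)"] perm(2)
        using \<pi>' \<pi>'' that by (intro sum.cong) auto
      show "(\<Sum>k<n. Const (J $$ (k, b)) * partial_deriv (?\<pi>' a) (partial_deriv (?\<pi>' k) ?g)) =
        (\<Sum>k<n. Const (J $$ (k, a)) * partial_deriv (?\<pi>' b) (partial_deriv (?\<pi>' k) ?g))"
        unfolding *[OF ab(1)] *[OF ab(2)] using center \<pi>'(1)[OF ab(1)] \<pi>'(1)[OF ab(2)]
        unfolding center_iff by blast
    qed
    then show ?thesis using Ac invertible_matI[OF Ac AA'] by blast
  qed
  note jordan_basis = this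
  have inv_eq: "the_inv_into {..<n} \<pi> (\<pi> i) = i" if "bij_betw \<pi> {..<n} {..<n}" "i < n" for \<pi> i
    using that by (auto simp: bij_betw_def the_inv_into_f_f)
  show ?thesis
  proof (cases "\<exists>i<n. \<exists>j<n. J $$ (i, i) \<noteq> J $$ (j, j)")
    case True
    then obtain i0 j0 where ij0: "i0 < n" "j0 < n" "J $$ (i0, i0) \<noteq> J $$ (j0, j0)" by blast
    \<comment> \<open>The Jordan indices belonging to one eigenvalue; \<open>\<pi>\<close> lists
      them first.\<close>
    define I where "I = {i. i < n \<and> J $$ (i, i) = J $$ (i0, i0)}"
    have fin: "finite I" by (simp add: I_def)
    obtain u where u: "bij_betw u {..<card I} I" using ex_bij_betw_nat_finite[OF fin]
      by (auto simp: atLeast0LessThan)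
    obtain \<pi> where \<pi>: "bij_betw \<pi> {..<n} {..<n}" and \<pi>u: "\<And>i. i < card I \<Longrightarrow> \<pi> i = u i"
      using extend_to_permutation[of u "card I" n] u by (auto simp: bij_betw_def I_def)
    obtain A where A: "A \<in> carrier_mat n n" "invertible_mat A"
      and js: "jordan_symmetric n J (\<lambda>a b. partial_deriv (the_inv_into {..<n} \<pi> a)
      (partial_deriv (the_inv_into {..<n} \<pi> b) (lin_change n A f)))"
      using jordan_basis[OF \<pi>] by blast
    let ?g = "lin_change n A f"
    have img: "\<pi> ` {..<card I} = I" using u \<pi>u by (auto simp: bij_betw_def)
    have "card I > 0" using ij0(1) fin by (auto simp: card_gt_0_iff I_def)
    moreover have "card I < card {..<n}"
    proof (rule psubset_card_mono)
      have "j0 \<in> {..<n} - I" using ij0 by (simp add: I_def)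
      moreover have "I \<subseteq> {..<n}" by (auto simp: I_def)
      ultimately show "I \<subset> {..<n}" by blast
    qed simp
    moreover have "partial_deriv i (partial_deriv j ?g) = 0"
      if "i < card I" "card I \<le> j" "j < n" for i j
    proof -
      have lt: "i < n" using that by simp
      have \<pi>n: "\<pi> i < n" "\<pi> j < n" using \<pi> lt that(3) by (auto simp: bij_betw_def)
      have "\<pi> i \<in> I" using img that(1) by blast
      moreover have "\<pi> j \<notin> I"
      proof
        assume "\<pi> j \<in> I"
        then obtain k where "k < card I" "\<pi> k = \<pi> j" using img by force
        moreover have "k < n" using \<open>k < card I\<close> that by simp
        ultimately have "k = j" using \<pi> that(3) by (auto simp: bij_betw_def inj_on_def)
        then show False using \<open>k < card I\<close> that(2) by simp
      qed
      ultimately have "J $$ (\<pi> i, \<pi> i) \<noteq> J $$ (\<pi> j, \<pi> j)" using \<pi>n by (auto simp: I_def)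
      from jordan_symmetric.H_eq_0[OF js \<pi>n this] show ?thesis
        using inv_eq[OF \<pi>] lt that(3) by simp
    qed
    ultimately obtain g1 g2 where g12: "g1 \<in> forms {0..<card I} d" "g2 \<in> forms {card I..<n} d"
      and g: "?g = g1 + g2" and cI: "0 < card I" "card I < n"
      using direct_sum_of_hessian[OF char d lin_change_forms[OF f], of "card I" A] by auto
    have "direct_sum_form n d f"
      unfolding direct_sum_form_def
    proof (intro exI conjI)
      let ?a = "\<lambda>i. if i = 0 then 0 else if i = 1 then card I else n"
      let ?fs = "\<lambda>i. if i = 0 then g1 else g2"
      show "A \<in> carrier_mat n n" "invertible_mat A" by (fact A)+
      show "\<forall>i<2. ?a i < ?a (Suc i)" "\<forall>i<2. ?fs i \<in> forms {?a i..<?a (Suc i)} d"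
        using cI g12 by (simp_all add: numeral_2_eq_2 All_less_Suc)
      show "lin_change n A f = (\<Sum>i<2::nat. ?fs i)"
        unfolding g by (simp add: numeral_2_eq_2)
    qed simp_all
    then show ?thesis ..
  next
    case False
    then have single: "\<And>i j. i < n \<Longrightarrow> j < n \<Longrightarrow> J $$ (i, i) = J $$ (j, j)" by blast
    \<comment> \<open>Links and chains are read off from \<open>J\<close> alone, so the instance for
      the trivial ordering can define them before the final ordering is known.\<close>
    have js_id: "\<exists>H. jordan_symmetric n J H" using jordan_basis[of id] by auto
    then obtain H0 where H0: "jordan_symmetric n J H0" by blast
    interpret js: jordan_symmetric n J H0 by (rule H0)
    \<comment> \<open>One eigenvalue and no link would make \<open>J\<close>, hence
      \<open>X\<close>, scalar.\<close>
    have "\<exists>b<n. js.linked b"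
    proof (rule ccontr)
      assume "\<not> (\<exists>b<n. js.linked b)"
      then have off: "J $$ (i, Suc i) = 0" if "Suc i < n" for i
        using js.not_linked[of "Suc i"] that by auto
      have "J = J $$ (0, 0) \<cdot>\<^sub>m 1\<^sub>m n"
      proof (rule eq_matI)
        fix i j assume "i < dim_row (J $$ (0, 0) \<cdot>\<^sub>m 1\<^sub>m n)" "j < dim_col (J $$ (0, 0) \<cdot>\<^sub>m 1\<^sub>m n)"
        then have ij: "i < n" "j < n" by auto
        then show "J $$ (i, j) = (J $$ (0, 0) \<cdot>\<^sub>m 1\<^sub>m n) $$ (i, j)"
          using single[of i 0] J_0[of i j] off[of i] by auto
      qed (use PQJ(3) in auto)
      then have "X = P * (J $$ (0, 0) \<cdot>\<^sub>m 1\<^sub>m n) * Q" using PQJ(7) by simp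
      also have "\<dots> = J $$ (0, 0) \<cdot>\<^sub>m (P * Q)"
        using PQJ(1,2) by (simp add: mult_smult_distrib[of _ n n _ n] mult_smult_assoc_mat[of _ n n _ n])
      finally show False using PQJ(4) nonscalar by simp
    qed
    then obtain b0 where b0: "b0 < n" "js.linked b0" by blast
    then have "js.chain 1 b0" using js.linked_pos[OF b0(2)] by (simp add: js.chain_def)
    then obtain K where K: "K \<ge> 1" "\<exists>b<n. js.chain K b" "\<And>b. b < n \<Longrightarrow> \<not> js.chain (K + K) b"
      using js.maximal_chain_exists[OF _ b0(1)] by metis
    \<comment> \<open>The indices of the basis vectors that N^K does not kill. Their images are
      distinct basis vectors, so \<open>l\<close> is the rank of N^K.\<close>
    define T where "T = {b. b < n \<and> js.chain K b}"
    define l where "l = card T"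
    have fin: "finite T" by (simp add: T_def)
    have l: "1 \<le> l" using K(2) fin by (auto simp: l_def T_def Suc_le_eq card_gt_0_iff)
    have T_less: "K \<le> b" "b < n" if "b \<in> T" for b using that by (simp_all add: T_def js.chain_def)
    \<comment> \<open>The image of such a basis vector is killed by N^K, because N^(2K) = 0.\<close>
    have T_disj: "b - K \<notin> T" if "b \<in> T" for b
      using that K(3)[of b] js.chain_add[of K b K] by (simp add: T_def) blast
    obtain u where u: "bij_betw u {..<l} T" using ex_bij_betw_nat_finite[OF fin]
      by (auto simp: atLeast0LessThan l_def)
    have uT: "u i \<in> T" if "i < l" for i using u that by (auto simp: bij_betw_def)
    have u_inj: "u i = u j \<longleftrightarrow> i = j" if "i < l" "j < l" for i j
      using u that by (auto simp: bij_betw_def inj_on_def)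
    \<comment> \<open>First the \<open>l\<close> images under N^K, then their preimages in the same
      order: in the new variables N^K sends basis vector l + i to basis vector i.\<close>
    define \<rho> where "\<rho> i = (if i < l then u i - K else u (i - l))" for i
    have "inj_on \<rho> {..<2 * l}"
    proof (rule inj_onI)
      fix i j assume ij: "i \<in> {..<2 * l}" "j \<in> {..<2 * l}" and eq: "\<rho> i = \<rho> j"
      consider "i < l" "j < l" | "i < l" "\<not> j < l" | "\<not> i < l" "j < l" | "\<not> i < l" "\<not> j < l" by blast
      then show "i = j"
      proof cases
        case 1
        then have "u i = u j" using eq T_less(1)[OF uT[of i]] T_less(1)[OF uT[of j]]
          by (simp add: \<rho>_def)
        then show ?thesis using 1 u_inj by simp
      next
        case 2
        then have "j - l < l" using ij by auto
        then show ?thesis using 2 eq T_disj[OF uT[of i]] uT[of "j - l"] by (simp add: \<rho>_def)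
      next
        case 3
        then have "i - l < l" using ij by auto
        then show ?thesis using 3 eq T_disj[OF uT[of j]] uT[of "i - l"] by (simp add: \<rho>_def)
      next
        case 4
        then have "i - l < l" "j - l < l" using ij by auto
        then have "i - l = j - l" using 4 eq u_inj by (simp add: \<rho>_def)
        then show ?thesis using 4 by linarith
      qed
    qed
    moreover have "\<rho> i < n" if "i < 2 * l" for i
      using T_less(2)[OF uT[of i]] T_less(2)[OF uT[of "i - l"]] that by (auto simp: \<rho>_def)
    ultimately obtain \<pi> where ln: "2 * l \<le> n" and \<pi>: "bij_betw \<pi> {..<n} {..<n}"
      and \<pi>\<rho>: "\<And>i. i < 2 * l \<Longrightarrow> \<pi> i = \<rho> i"
      using extend_to_permutation[of \<rho> "2 * l" n] by auto
    obtain A where A: "A \<in> carrier_mat n n" "invertible_mat A"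
      and js': "jordan_symmetric n J (\<lambda>a b. partial_deriv (the_inv_into {..<n} \<pi> a)
      (partial_deriv (the_inv_into {..<n} \<pi> b) (lin_change n A f)))"
      using jordan_basis[OF \<pi>] by blast
    let ?g = "lin_change n A f"
    have \<pi>n: "\<pi> i < n" if "i < n" for i using \<pi> that by (auto simp: bij_betw_def)
    have \<pi>T: "\<pi> i \<in> T \<longleftrightarrow> i \<in> {l..<2 * l}" if i: "i < n" for i
    proof
      assume "i \<in> {l..<2 * l}"
      then show "\<pi> i \<in> T" using \<pi>\<rho>[of i] uT[of "i - l"] by (auto simp: \<rho>_def)
    next
      assume "\<pi> i \<in> T"
      then obtain k where k: "k < l" "\<pi> i = u k" using u by (auto simp: bij_betw_def)
      then have "\<pi> i = \<pi> (l + k)" using \<pi>\<rho>[of "l + k"] by (simp add: \<rho>_def)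
      moreover have "l + k < n" using k ln by simp
      ultimately have "i = l + k" using \<pi> i by (auto simp: bij_betw_def inj_on_def)
      then show "i \<in> {l..<2 * l}" using k by auto
    qed
    have chain_iff: "js.chain K b \<longleftrightarrow> b \<in> T" if "b < n" for b using that by (simp add: T_def)
    \<comment> \<open>Symmetry of H N^K in the new variables. The case distinction contains both
      hypotheses of \<open>LDS_of_hessian\<close>: its zero branch gives the vanishing, its other
      branch the symmetric shift.\<close>
    have rel: "partial_deriv j (partial_deriv i ?g) =
        (if j \<in> {l..<2 * l} then partial_deriv (j - l) (partial_deriv (l + i) ?g) else 0)"
      if i: "i < l" and j: "j < n" for i j
    proof -
      have li: "l + i < n" "i < n" using i ln by auto
      have b: "\<pi> (l + i) \<in> T" using \<pi>T[OF li(1)] i by simp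
      have bK: "\<pi> (l + i) - K = \<pi> i" if "i < l" for i using \<pi>\<rho>[of "l + i"] \<pi>\<rho>[of i] that
        by (simp add: \<rho>_def)
      have aK: "\<pi> j - K = \<pi> (j - l)" if "j \<in> {l..<2 * l}" using bK[of "j - l"] that by auto
      have "partial_deriv j (partial_deriv i ?g) =
          (if js.chain K (\<pi> (l + i)) then partial_deriv (the_inv_into {..<n} \<pi> (\<pi> j))
            (partial_deriv (the_inv_into {..<n} \<pi> (\<pi> (l + i) - K)) ?g) else 0)"
        using b chain_iff[of "\<pi> (l + i)"] \<pi>n[OF li(1)] bK[OF i] inv_eq[OF \<pi> li(2)] inv_eq[OF \<pi> j]
        by simp
      also have "\<dots> = (if js.chain K (\<pi> j) then partial_deriv (the_inv_into {..<n} \<pi> (\<pi> j - K))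
            (partial_deriv (the_inv_into {..<n} \<pi> (\<pi> (l + i))) ?g) else 0)"
        by (rule jordan_symmetric.H_chain[OF js' single \<pi>n[OF j] \<pi>n[OF li(1)]])
      also have "\<dots> =
        (if j \<in> {l..<2 * l} then partial_deriv (j - l) (partial_deriv (l + i) ?g) else 0)"
        using chain_iff[OF \<pi>n[OF j]] \<pi>T[OF j] aK inv_eq[OF \<pi> li(1)] inv_eq[OF \<pi>, of "j - l"] j by auto
      finally show ?thesis .
    qed
    have "\<exists>h\<in>forms {l..<2 * l} d. \<exists>g'\<in>forms {l..<n} d.
      ?g = (\<Sum>i<l. Var i * partial_deriv (l + i) h) + g'"
    proof (rule LDS_of_hessian[OF char d lin_change_forms[OF f] ln])
      fix i j assume "i < l" "j < n" "j \<notin> {l..<2 * l}"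
      then show "partial_deriv i (partial_deriv j ?g) = 0"
        using rel[of i j] partial_deriv_commute[of i j ?g] by (simp only: if_False)
    next
      fix i j assume ij: "i < l" "j < l"
      then show "partial_deriv (l + i) (partial_deriv j ?g) = partial_deriv (l + j) (partial_deriv i ?g)"
        using rel[of j "l + i"] ln partial_deriv_commute[of i "l + j" ?g] by simp
    qed
    then have "LDS_form n d f" unfolding LDS_form_def using A l ln by blast
    then show ?thesis ..
  qed
qed

section \<open>Nonscalar center elements of direct sums and LDS forms\<close>

lemma scalar_conjugate:
  fixes A B X :: "'a::comm_ring_1 mat"
  assumes A: "A \<in> carrier_mat n n" and B: "B \<in> carrier_mat n n" and X: "X \<in> carrier_mat n n"
    and BA: "B * A = 1\<^sub>m n" and eq: "A * X * B = c \<cdot>\<^sub>m 1\<^sub>m n"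
  shows "X = c \<cdot>\<^sub>m 1\<^sub>m n"
proof -
  have "B * (A * X * B) * A = (B * A) * X * (B * A)"
    using A B X by (simp add: assoc_mult_mat[of _ n n _ n _ n])
  then have "X = B * (A * X * B) * A" using X by (simp add: BA)
  also have "\<dots> = c \<cdot>\<^sub>m (B * A)"
    unfolding eq using A B
    by (simp add: mult_smult_distrib[of _ n n _ n] mult_smult_assoc_mat[of _ n n _ n])
  finally show ?thesis by (simp add: BA)
qed

text \<open>The inverse change of variables carries the witness back to \<open>f\<close>, and
  conjugation does not make a nonscalar matrix scalar. Witnesses can thus be exhibited in normal
  form.\<close>

lemma not_central_lin_change:
  fixes f :: "'a::field mpoly"
  assumes f: "f \<in> forms {..<n} d" and A: "A \<in> carrier_mat n n" "invertible_mat A"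
    and X: "X \<in> center n (lin_change n A f)" and nonscalar: "\<And>c. X \<noteq> c \<cdot>\<^sub>m 1\<^sub>m n"
  shows "\<not> central n f"
proof
  assume central: "central n f"
  obtain B where B: "B \<in> carrier_mat n n" "A * B = 1\<^sub>m n" "B * A = 1\<^sub>m n"
    using invertible_matE[OF A(2,1)] .
  have Xc: "X \<in> carrier_mat n n" using X by (simp add: center_def)
  have "A * X * B \<in> center n (lin_change n B (lin_change n A f))"
    by (rule center_lin_change[OF lin_change_forms[OF f] B(1) A(1) B(3) X])
  also have "lin_change n B (lin_change n A f) = f"
    using lin_change_lin_change[OF A(1) B(1) forms_in_mpolys[OF f]]
      lin_change_one[OF forms_in_mpolys[OF f]] by (simp add: B)
  finally obtain c where "A * X * B = c \<cdot>\<^sub>m 1\<^sub>m n" using central by (auto simp: central_iff)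
  then show False using scalar_conjugate[OF A(1) B(1) Xc B(3)] nonscalar by blast
qed

lemma direct_sum_imp_not_central:
  fixes f :: "'a::field mpoly"
  assumes f: "f \<in> forms {..<n} d" and ds: "direct_sum_form n d f"
  shows "\<not> central n f"
proof -
  obtain A t a fs where A: "A \<in> carrier_mat n n" "invertible_mat A" and t: "2 \<le> t"
    and a: "a 0 = 0" "a t = n" "\<And>i. i < t \<Longrightarrow> a i < a (Suc i)"
    and fs: "\<And>i. i < t \<Longrightarrow> fs i \<in> forms {a i..<a (Suc i)} d"
    and g: "lin_change n A f = (\<Sum>i<t. fs i)"
    using ds unfolding direct_sum_form_def by blast
  let ?g = "lin_change n A f"
  have mono: "a i \<le> a j" if "i \<le> j" "j \<le> t" for i j
    using that
  proof (induction j rule: dec_induct)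
    case (step k)
    then show ?case using a(3)[of k] by simp
  qed simp
  have a1: "0 < a 1" using a(1) a(3)[of 0] t by simp
  have a2: "a 1 < n" using a(3)[of 1] mono[of 2 t] t a(2) by (simp add: numeral_2_eq_2)
  have zero: "partial_deriv i (partial_deriv j ?g) = 0" if "i < a 1" "a 1 \<le> j" for i j
  proof -
    have "partial_deriv i (partial_deriv j (fs k)) = 0" if k: "k < t" for k
    proof (cases "k = 0")
      case True
      then have "partial_deriv j (fs k) = 0"
        using partial_deriv_forms_eq_0[OF fs[OF k], of j] \<open>a 1 \<le> j\<close> by simp
      then show ?thesis by simp
    next
      case False
      then have "i \<notin> {a k..<a (Suc k)}" using mono[of 1 k] k \<open>i < a 1\<close> by auto
      then have "partial_deriv i (fs k) = 0" using partial_deriv_forms_eq_0[OF fs[OF k]] by simp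
      then show ?thesis by (simp add: partial_deriv_commute[of i j])
    qed
    then show ?thesis by (simp add: g partial_deriv_sum)
  qed
  \<comment> \<open>The projection onto the first block of variables, all other blocks being lumped
    together. It keeps the first \<open>a 1\<close> columns of the Hessian, whose entries in the
    rows from \<open>a 1\<close> on vanish by \<open>zero\<close>.\<close>
  let ?X = "mat n n (\<lambda>(i, j). if i = j \<and> i < a 1 then 1 else 0) :: 'a mat"
  have entry: "(\<Sum>k<n. Const (?X $$ (k, j)) * q k) = (if j < a 1 then q j else 0)"
    if "j < n" for j q
  proof -
    have "(\<Sum>k<n. Const (?X $$ (k, j)) * q k) =
        (\<Sum>k<n. if k = j then (if j < a 1 then q j else 0) else 0)"
      using that by (intro sum.cong) auto
    then show ?thesis using that by simp
  qed
  have "?X \<in> center n ?g"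
    unfolding center_iff
  proof (intro conjI allI impI)
    fix i j assume ij: "i < n" "j < n"
    show "(\<Sum>k<n. Const (?X $$ (k, j)) * partial_deriv i (partial_deriv k ?g)) =
        (\<Sum>k<n. Const (?X $$ (k, i)) * partial_deriv j (partial_deriv k ?g))"
      unfolding entry[OF ij(1)] entry[OF ij(2)]
      using zero[of i j] zero[of j i] partial_deriv_commute[of i j ?g] by auto
  qed simp
  moreover have "?X \<noteq> c \<cdot>\<^sub>m 1\<^sub>m n" for c
  proof
    assume eq: "?X = c \<cdot>\<^sub>m 1\<^sub>m n"
    have "?X $$ (0, 0) = c" "?X $$ (a 1, a 1) = c" unfolding eq using a1 a2 by simp_all
    then show False using a1 a2 by simp
  qed
  ultimately show ?thesis by (rule not_central_lin_change[OF f A])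
qed

lemma LDS_imp_not_central:
  fixes f :: "'a::field mpoly"
  assumes f: "f \<in> forms {..<n} d" and LDS: "LDS_form n d f"
  shows "\<not> central n f"
proof -
  obtain A l h g' where A: "A \<in> carrier_mat n n" "invertible_mat A" and l: "1 \<le> l" "2 * l \<le> n"
    and h: "h \<in> forms {l..<2 * l} d" and g': "g' \<in> forms {l..<n} d"
    and g: "lin_change n A f = (\<Sum>i<l. Var i * partial_deriv (l + i) h) + g'"
    using LDS unfolding LDS_form_def by blast
  let ?g = "lin_change n A f"
  have first: "partial_deriv m ?g = partial_deriv (l + m) h" if m: "m < l" for m
  proof -
    have "partial_deriv m g' = 0" using partial_deriv_forms_eq_0[OF g'] m by simp
    moreover have "partial_deriv m (partial_deriv (l + i) h) = 0" for i
      using partial_deriv_forms_eq_0[OF forms_partial_deriv[OF h]] m by simp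
    ultimately have "partial_deriv m ?g = (\<Sum>i<l. if i = m then partial_deriv (l + m) h else 0)"
      unfolding g by (simp add: partial_deriv_add partial_deriv_sum partial_deriv_Var_mult cong: if_cong)
    then show ?thesis using m by simp
  qed
  \<comment> \<open>This matrix maps basis vector l + i to basis vector i for i < l and kills the
    others. By \<open>first\<close>, the Hessian of \<open>?g\<close> times \<open>?X\<close> is the
    Hessian of \<open>h\<close>.\<close>
  let ?X = "mat n n (\<lambda>(k, j). if l \<le> j \<and> j < 2 * l \<and> k = j - l then 1 else 0) :: 'a mat"
  have entry: "(\<Sum>k<n. Const (?X $$ (k, j)) * q k) = (if l \<le> j \<and> j < 2 * l then q (j - l) else 0)"
    if "j < n" for j q
  proof -
    have "(\<Sum>k<n. Const (?X $$ (k, j)) * q k) =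
        (\<Sum>k<n. if k = j - l then (if l \<le> j \<and> j < 2 * l then q (j - l) else 0) else 0)"
      using that by (intro sum.cong) auto
    moreover have "j - l < n" using that by simp
    ultimately show ?thesis by simp
  qed
  have "?X \<in> center n ?g"
    unfolding center_iff
  proof (intro conjI allI impI)
    fix i j assume ij: "i < n" "j < n"
    have *: "(if l \<le> j \<and> j < 2 * l then partial_deriv i (partial_deriv (j - l) ?g) else 0) =
      (if l \<le> j \<and> j < 2 * l \<and> l \<le> i \<and> i < 2 * l then partial_deriv i (partial_deriv j h) else 0)"
      for i j
    proof (cases "l \<le> i \<and> i < 2 * l")
      case False
      then have "i \<notin> {l..<2 * l}" by simp
      then have "partial_deriv i (partial_deriv j h) = 0"
        by (rule partial_deriv_forms_eq_0[OF forms_partial_deriv[OF h]])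
      then show ?thesis using first[of "j - l"] False by auto
    qed (use first[of "j - l"] in auto)
    show "(\<Sum>k<n. Const (?X $$ (k, j)) * partial_deriv i (partial_deriv k ?g)) =
        (\<Sum>k<n. Const (?X $$ (k, i)) * partial_deriv j (partial_deriv k ?g))"
      unfolding entry[OF ij(1)] entry[OF ij(2)] * by (auto simp: partial_deriv_commute[of i j h])
  qed simp
  moreover have "?X \<noteq> c \<cdot>\<^sub>m 1\<^sub>m n" for c
  proof
    assume eq: "?X = c \<cdot>\<^sub>m 1\<^sub>m n"
    have "?X $$ (0, l) = 0" unfolding eq using l by simp
    then show False using l by simp
  qed
  ultimately show ?thesis by (rule not_central_lin_change[OF f A])
qed

section \<open>Reconstruction\<close>

text \<open>A linear relation between the partial derivatives is a direction along which
  \<open>f\<close> does not change. With \<open>c\<close> as column \<open>j\<close> of a change of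
  variables, the j-th new variable disappears, against nondegeneracy.\<close>

lemma nondegenerate_independent:
  fixes f :: "'a::field mpoly"
  assumes char: "CHAR('a) = 0 \<or> CHAR('a) > d" and f: "f \<in> forms {..<n} d"
    and nd: "nondegenerate n d f" and eq: "(\<Sum>k<n. Const (c k) * partial_deriv k f) = 0"
    and j: "j < n"
  shows "c j = 0"
proof (rule ccontr)
  assume cj: "c j \<noteq> 0"
  obtain P Q where P: "P \<in> carrier_mat n n" "Q \<in> carrier_mat n n" "P * Q = 1\<^sub>m n"
    and col: "col P j = vec n c"
    using invertible_mat_with_col[of "vec n c" n j] j cj by auto
  have P_entry: "P $$ (k, j) = c k" if "k < n" for k
    using arg_cong[OF col, of "\<lambda>v. v $ k"] P(1) j that by simp
  have "partial_deriv j (lin_change n P f) =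
      lin_change n P (\<Sum>k<n. Const (c k) * partial_deriv k f)"
    using P_entry by (simp add: partial_deriv_lin_change[OF forms_in_mpolys[OF f] j]
        lin_change_sum lin_change_Const_mult)
  then have "partial_deriv j (lin_change n P f) = 0" by (simp add: eq)
  then have "lin_change n P f \<in> forms ({..<n} - {j}) d"
    by (intro forms_remove_vars[OF char lin_change_forms[OF f]]) auto
  then show False using nd invertible_matI[OF P] P(1) j unfolding nondegenerate_def by blast
qed

section \<open>The Jacobian ideal and its part of lowest degree\<close>

lemma mpoly_ring_simps [simp]:
  "carrier (mpoly_ring n) = mpolys {..<n}"
  "x \<otimes>\<^bsub>mpoly_ring n\<^esub> y = x * y"
  "x \<oplus>\<^bsub>mpoly_ring n\<^esub> y = x + y"
  "\<zero>\<^bsub>mpoly_ring n\<^esub> = 0" "\<one>\<^bsub>mpoly_ring n\<^esub> = 1"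
  by (simp_all add: mpoly_ring_def mpolys_def)

lemma Const_in_mpolys [simp]: "Const c \<in> mpolys S"
  using forms_in_mpolys[OF Const_in_forms] .

lemma mpolys_closed:
  fixes p q :: "'a::comm_ring_1 mpoly"
  assumes "p \<in> mpolys {..<n}" "q \<in> mpolys {..<n}"
  shows "p + q \<in> mpolys {..<n}" "p * q \<in> mpolys {..<n}" "- p \<in> mpolys {..<n}"
proof -
  interpret cring "mpoly_ring n :: 'a mpoly ring" by (rule cring_mpoly_ring)
  show "p + q \<in> mpolys {..<n}" "p * q \<in> mpolys {..<n}"
    using a_closed[of p q] m_closed[of p q] assms by simp_all
  show "- p \<in> mpolys {..<n}" using assms by (simp add: mpolys_def)
qed

text \<open>Additive inverses arise from multiplication by the constant -1, so closure under
  negation is contained in the last clause.\<close>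

lemma mpolys_ideal_iff:
  fixes I :: "'a::comm_ring_1 mpoly set"
  shows "ideal I (mpoly_ring n) \<longleftrightarrow> I \<subseteq> mpolys {..<n} \<and> 0 \<in> I \<and>
    (\<forall>p\<in>I. \<forall>q\<in>I. p + q \<in> I) \<and> (\<forall>p\<in>I. \<forall>r\<in>mpolys {..<n}. r * p \<in> I)"
proof
  assume I: "ideal I (mpoly_ring n)"
  interpret ideal I "mpoly_ring n" by (rule I)
  show "I \<subseteq> mpolys {..<n} \<and> 0 \<in> I \<and> (\<forall>p\<in>I. \<forall>q\<in>I. p + q \<in> I) \<and> (\<forall>p\<in>I. \<forall>r\<in>mpolys {..<n}. r * p \<in> I)"
    using a_subset I_l_closed additive_subgroup.zero_closed[OF is_additive_subgroup]
      additive_subgroup.a_closed[OF is_additive_subgroup] by simp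
next
  assume I: "I \<subseteq> mpolys {..<n} \<and> 0 \<in> I \<and>
    (\<forall>p\<in>I. \<forall>q\<in>I. p + q \<in> I) \<and> (\<forall>p\<in>I. \<forall>r\<in>mpolys {..<n}. r * p \<in> I)"
  interpret cring "mpoly_ring n :: 'a mpoly ring" by (rule cring_mpoly_ring)
  have inv: "\<ominus>\<^bsub>mpoly_ring n\<^esub> p = - p" if "p \<in> mpolys {..<n}" for p :: "'a mpoly"
    using that mpolys_closed(3)[OF that that] by (intro minus_equality) auto
  have neg: "- p \<in> I" if "p \<in> I" for p
  proof -
    have "Const (- 1) * p \<in> I" using I that by simp
    moreover have "Const (- 1) * p = - p" by (rule poly_mapping_eqI) simp
    ultimately show ?thesis by simp
  qed
  show "ideal I (mpoly_ring n)"
  proof (rule idealI)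
    show "ring (mpoly_ring n :: 'a mpoly ring)" by (rule ring_axioms)
    show "subgroup I (add_monoid (mpoly_ring n))"
      using I neg inv by (intro add.subgroupI) (auto simp: a_inv_def[symmetric])
  qed (use I in \<open>auto simp: mult.commute\<close>)
qed

lemma jacobian_generators:
  fixes f :: "'a::comm_ring_1 mpoly"
  assumes "f \<in> mpolys {..<n}"
  shows "ideal (jacobian_ideal n f) (mpoly_ring n)"
    and "i < n \<Longrightarrow> partial_deriv i f \<in> jacobian_ideal n f"
    and "ideal I (mpoly_ring n) \<Longrightarrow> (\<And>i. i < n \<Longrightarrow> partial_deriv i f \<in> I) \<Longrightarrow> jacobian_ideal n f \<subseteq> I"
proof -
  interpret cring "mpoly_ring n :: 'a mpoly ring" by (rule cring_mpoly_ring)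
  have gens: "(\<lambda>i. partial_deriv i f) ` {..<n} \<subseteq> carrier (mpoly_ring n)"
    using assms by (auto intro: mpolys_partial_deriv)
  show "ideal (jacobian_ideal n f) (mpoly_ring n)"
    unfolding jacobian_ideal_def by (rule genideal_ideal[OF gens])
  show "i < n \<Longrightarrow> partial_deriv i f \<in> jacobian_ideal n f"
    using genideal_self[OF gens] unfolding jacobian_ideal_def by blast
  show "ideal I (mpoly_ring n) \<Longrightarrow> (\<And>i. i < n \<Longrightarrow> partial_deriv i f \<in> I) \<Longrightarrow> jacobian_ideal n f \<subseteq> I"
    unfolding jacobian_ideal_def by (intro genideal_minimal) auto
qed

lemma ideal_sum_closed:
  fixes I :: "'a::comm_ring_1 mpoly set"
  assumes "ideal I (mpoly_ring n)" "\<And>k. k \<in> K \<Longrightarrow> p k \<in> I"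
  shows "(\<Sum>k\<in>K. Const (c k) * p k) \<in> I"
  using assms(2)
  by (induction K rule: infinite_finite_induct) (use assms(1) in \<open>auto simp: mpolys_ideal_iff\<close>)

text \<open>Applied with a matrix and with its inverse, this identifies two Jacobian ideals.\<close>

lemma jacobian_ideal_subset:
  fixes f g :: "'a::comm_ring_1 mpoly"
  assumes f: "f \<in> mpolys {..<n}" and g: "g \<in> mpolys {..<n}"
    and span: "\<And>i. i < n \<Longrightarrow> partial_deriv i g = (\<Sum>k<n. Const (M $$ (k, i)) * partial_deriv k f)"
  shows "jacobian_ideal n g \<subseteq> jacobian_ideal n f"
proof (rule jacobian_generators(3)[OF g jacobian_generators(1)[OF f]])
  fix i assume "i < n"
  then show "partial_deriv i g \<in> jacobian_ideal n f"
    unfolding span[OF \<open>i < n\<close>]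
    by (intro ideal_sum_closed[OF jacobian_generators(1)[OF f]] jacobian_generators(2)[OF f]) auto
qed

text \<open>A nonconstant term of \<open>r\<close> raises the degree, and \<open>p\<close> starts in
  degree \<open>e\<close>. Up to that degree only the constant term of \<open>r\<close>
  acts.\<close>

lemma lookup_mult_lowest_degree:
  fixes r p :: "'a::comm_ring_1 mpoly"
  assumes low: "\<And>m. mdeg m < e \<Longrightarrow> Poly_Mapping.lookup p m = 0" and m: "mdeg m \<le> e"
  shows "Poly_Mapping.lookup (r * p) m = Poly_Mapping.lookup r 0 * Poly_Mapping.lookup p m"
proof -
  have single: "Poly_Mapping.lookup (Poly_Mapping.single t c * p) m =
      (if t = 0 then c * Poly_Mapping.lookup p m else 0)" for t c
  proof (cases "t = 0")
    case True
    then show ?thesis using lookup_single_mult_add[of 0 c p m] by simp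
  next
    case False
    show ?thesis
    proof (cases "\<exists>q. m = t + q")
      case True
      then obtain q where q: "m = t + q" by blast
      have "mdeg t \<noteq> 0" using False by simp
      then have "mdeg q < e" using m unfolding q mdeg_add by linarith
      then show ?thesis using False low by (simp add: q lookup_single_mult_add)
    next
      case False
      then show ?thesis using \<open>t \<noteq> 0\<close> by (simp add: lookup_single_mult_eq_0)
    qed
  qed
  have "r * p = (\<Sum>t\<in>Poly_Mapping.keys r. Poly_Mapping.single t (Poly_Mapping.lookup r t) * p)"
    by (subst sum_singles[of r]) (simp add: sum_distrib_right)
  then have "Poly_Mapping.lookup (r * p) m =
      (\<Sum>t\<in>Poly_Mapping.keys r. if t = 0 then Poly_Mapping.lookup r 0 * Poly_Mapping.lookup p m else 0)"
    by (simp add: lookup_sum single cong: if_cong)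
  then show ?thesis by (simp add: in_keys_iff)
qed

text \<open>The elements whose part of degree at most \<open>d - 1\<close> lies in the span of the generators form an ideal.\<close>

lemma jacobian_ideal_lowest_part:
  fixes f :: "'a::comm_ring_1 mpoly"
  assumes f: "f \<in> forms {..<n} d" and p: "p \<in> jacobian_ideal n f"
  shows "\<exists>c. \<forall>m. mdeg m \<le> d - 1 \<longrightarrow> Poly_Mapping.lookup p m =
    Poly_Mapping.lookup (\<Sum>k<n. Const (c k) * partial_deriv k f) m"
proof -
  let ?L = "\<lambda>c. \<Sum>k<n. Const (c k) * partial_deriv k f"
  let ?I = "{p \<in> mpolys {..<n}. \<exists>c. \<forall>m. mdeg m \<le> d - 1 \<longrightarrow>
    Poly_Mapping.lookup p m = Poly_Mapping.lookup (?L c) m}"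
  have L: "?L c \<in> forms {..<n} (d - 1)" for c
    by (intro forms_sum forms_Const_mult forms_partial_deriv[OF f])
  have "ideal ?I (mpoly_ring n)"
    unfolding mpolys_ideal_iff
  proof (intro conjI ballI)
    show "0 \<in> ?I" by (auto simp: mpolys_def intro!: exI[of _ "\<lambda>_. 0"])
  next
    fix p q assume "p \<in> ?I" "q \<in> ?I"
    then obtain a b where pq: "p \<in> mpolys {..<n}" "q \<in> mpolys {..<n}"
      and a: "\<And>m. mdeg m \<le> d - 1 \<Longrightarrow> Poly_Mapping.lookup p m = Poly_Mapping.lookup (?L a) m"
      and b: "\<And>m. mdeg m \<le> d - 1 \<Longrightarrow> Poly_Mapping.lookup q m = Poly_Mapping.lookup (?L b) m"
      by blast
    have "?L (\<lambda>k. a k + b k) = ?L a + ?L b"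
      by (simp add: Const_add distrib_right sum.distrib)
    then show "p + q \<in> ?I"
      using mpolys_closed[OF pq] a b by (auto simp: lookup_add intro!: exI[of _ "\<lambda>k. a k + b k"])
  next
    fix p r :: "'a mpoly" assume "p \<in> ?I" and r: "r \<in> mpolys {..<n}"
    then obtain a where p: "p \<in> mpolys {..<n}"
      and a: "\<And>m. mdeg m \<le> d - 1 \<Longrightarrow> Poly_Mapping.lookup p m = Poly_Mapping.lookup (?L a) m"
      by blast
    have low: "Poly_Mapping.lookup p m = 0" if "mdeg m < d - 1" for m
      using a[of m] L[of a] that unfolding forms_iff by (metis less_imp_le less_irrefl)
    \<comment> \<open>By \<open>low\<close>, \<open>p\<close> has no terms below degree
      \<open>d - 1\<close>, so multiplication by \<open>r\<close> rescales its lowest part by the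
      constant term and stays in the span.\<close>
    have "?L (\<lambda>k. Poly_Mapping.lookup r 0 * a k) = Const (Poly_Mapping.lookup r 0) * ?L a"
      by (simp add: Const_mult sum_distrib_left mult.assoc)
    then show "r * p \<in> ?I"
      using mpolys_closed(2)[OF r p] a lookup_mult_lowest_degree[OF low]
      by (auto intro!: exI[of _ "\<lambda>k. Poly_Mapping.lookup r 0 * a k"])
  qed auto
  moreover have "partial_deriv i f \<in> ?I" if "i < n" for i
  proof -
    have "?L (\<lambda>k. if k = i then 1 else 0) = (\<Sum>k<n. if k = i then partial_deriv i f else 0)"
      by (rule sum.cong) auto
    also have "\<dots> = partial_deriv i f" using that by simp
    finally have "?L (\<lambda>k. if k = i then 1 else 0) = partial_deriv i f" .
    then show ?thesis using mpolys_partial_deriv[OF forms_in_mpolys[OF f]]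
      by (auto intro!: exI[of _ "\<lambda>k. if k = i then 1 else 0"])
  qed
  ultimately have "jacobian_ideal n f \<subseteq> ?I"
    by (rule jacobian_generators(3)[OF forms_in_mpolys[OF f]])
  then show ?thesis using p by blast
qed

text \<open>Over a finite field the product of all x - a, plus 1, has positive degree but takes the
  value 1 everywhere.\<close>

lemma infinite_UNIV_alg_closed: "infinite (UNIV :: 'a::alg_closed_field set)"
proof
  assume fin: "finite (UNIV :: 'a set)"
  let ?p = "(\<Prod>a\<in>UNIV. [:- a, 1:]) + 1 :: 'a poly"
  have deg: "degree (\<Prod>a\<in>(UNIV :: 'a set). [:- a, 1:]) = card (UNIV :: 'a set)"
    by (subst degree_prod_eq_sum_degree) auto
  have "card (UNIV :: 'a set) > 0" using fin by (simp add: card_gt_0_iff)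
  then have "degree ?p > 0" by (subst degree_add_eq_left) (simp_all add: deg)
  then obtain x where "poly ?p x = 0" using alg_closed_imp_poly_has_root by blast
  moreover have "poly (\<Prod>a\<in>UNIV. [:- a, 1:]) x = 0"
    unfolding poly_prod using fin by (intro prod_zero) auto
  ultimately show False by simp
qed

text \<open>The characteristic polynomial has finitely many roots in an infinite field; shifting by
  minus a non-root leaves an invertible matrix.\<close>

lemma invertible_shift_exists:
  fixes X :: "'a::alg_closed_field mat"
  assumes X: "X \<in> carrier_mat n n"
  shows "\<exists>c Z. Z \<in> carrier_mat n n \<and> (X + c \<cdot>\<^sub>m 1\<^sub>m n) * Z = 1\<^sub>m n"
proof -
  have "char_poly X \<noteq> 0" using degree_monic_char_poly[OF X] by auto
  then have "finite {e. poly (char_poly X) e = 0}" by (rule poly_roots_finite)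
  then obtain e where e: "poly (char_poly X) e \<noteq> 0"
    using infinite_UNIV_alg_closed ex_new_if_finite by (metis (mono_tags) mem_Collect_eq)
  then have "det (char_matrix X e) \<noteq> 0"
    using eigenvalue_root_char_poly[OF X] eigenvalue_det[OF X] by simp
  moreover have "char_matrix X e = X + (- e) \<cdot>\<^sub>m 1\<^sub>m n"
    using X by (simp add: char_matrix_def)
  ultimately have "X + (- e) \<cdot>\<^sub>m 1\<^sub>m n \<in> Units (ring_mat TYPE('a) n ())"
    using X by (intro det_non_zero_imp_unit) auto
  then show ?thesis unfolding Units_def ring_mat_def by auto
qed

section \<open>Passing between center elements and forms with the same Jacobian ideal\<close>

lemma center_add:
  fixes f :: "'a::comm_ring_1 mpoly"
  assumes "X \<in> center n f" "Y \<in> center n f"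
  shows "X + Y \<in> center n f"
proof -
  have carr: "X \<in> carrier_mat n n" "Y \<in> carrier_mat n n" using assms by (auto simp: center_def)
  then have "(\<Sum>k<n. Const ((X + Y) $$ (k, j)) * q k) =
      (\<Sum>k<n. Const (X $$ (k, j)) * q k) + (\<Sum>k<n. Const (Y $$ (k, j)) * q k)"
    if "j < n" for j and q :: "nat \<Rightarrow> 'a mpoly"
    using that by (simp add: Const_add distrib_right sum.distrib)
  then show ?thesis using assms carr by (simp add: center_iff)
qed

text \<open>By \<open>center_iff\<close> the field Y^T grad f is closed, so it is integrated by
  \<open>potential_exists\<close>.\<close>

lemma center_form_exists:
  fixes f :: "'a::field mpoly"
  assumes char: "CHAR('a) = 0 \<or> CHAR('a) > d" and d: "d > 0" and f: "f \<in> forms {..<n} d"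
    and Y: "Y \<in> center n f"
  shows "\<exists>g\<in>forms {..<n} d. \<forall>i<n.
    partial_deriv i g = (\<Sum>k<n. Const (Y $$ (k, i)) * partial_deriv k f)"
proof -
  have "\<exists>h\<in>forms {..<n} (Suc (d - 1)). \<forall>j\<in>{..<n}.
      partial_deriv j h = (\<Sum>k<n. Const (Y $$ (k, j)) * partial_deriv k f)"
  proof (rule potential_exists)
    fix i j assume "i \<in> {..<n}" "j \<in> {..<n}"
    then show "partial_deriv j (\<Sum>k<n. Const (Y $$ (k, i)) * partial_deriv k f) =
        partial_deriv i (\<Sum>k<n. Const (Y $$ (k, j)) * partial_deriv k f)"
      using Y by (simp add: center_iff partial_deriv_sum partial_deriv_Const_mult)
  next
    show "of_nat (Suc (d - 1)) \<noteq> (0::'a)" using of_nat_nonzero_of_char[OF char, of d] d by simp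
    show "(\<Sum>k<n. Const (Y $$ (k, i)) * partial_deriv k f) \<in> forms {..<n} (d - 1)" for i
      by (intro forms_sum forms_Const_mult forms_partial_deriv f)
  qed simp
  then show ?thesis using d by auto
qed

lemma reconstructible_imp_central:
  fixes f :: "'a::alg_closed_field mpoly"
  assumes char: "CHAR('a) = 0 \<or> CHAR('a) > d" and d: "d > 0" and f: "f \<in> forms {..<n} d"
    and nd: "nondegenerate n d f" and rec: "reconstructible n d f"
  shows "central n f"
  unfolding central_iff
proof
  fix X assume X: "X \<in> center n f"
  have Xc: "X \<in> carrier_mat n n" using X by (simp add: center_def)
  obtain e Z where Z: "Z \<in> carrier_mat n n" and inv: "(X + e \<cdot>\<^sub>m 1\<^sub>m n) * Z = 1\<^sub>m n"
    using invertible_shift_exists[OF Xc] by blast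
  \<comment> \<open>The shifted matrix stays in the center and is invertible, so the form built from
    it has partial derivatives with the same span as those of \<open>f\<close>.\<close>
  define Y where "Y = X + e \<cdot>\<^sub>m 1\<^sub>m n"
  have Y: "Y \<in> center n f" unfolding Y_def by (rule center_add[OF X scalar_in_center])
  have Yc: "Y \<in> carrier_mat n n" using Y by (simp add: center_def)
  have YZ: "Y * Z = 1\<^sub>m n" using inv by (simp add: Y_def)
  obtain g where g: "g \<in> forms {..<n} d"
    and dg: "\<And>i. i < n \<Longrightarrow> partial_deriv i g = (\<Sum>k<n. Const (Y $$ (k, i)) * partial_deriv k f)"
    using center_form_exists[OF char d f Y] by blast
  have df: "partial_deriv i f = (\<Sum>k<n. Const (Z $$ (k, i)) * partial_deriv k g)" if i: "i < n" for i
  proof -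
    have "(\<Sum>k<n. Const (Z $$ (k, i)) * partial_deriv k g) =
        (\<Sum>k<n. \<Sum>l<n. Const (Y $$ (l, k) * Z $$ (k, i)) * partial_deriv l f)"
      by (simp add: dg sum_distrib_left Const_mult mult_ac)
    also have "\<dots> = (\<Sum>l<n. Const ((Y * Z) $$ (l, i)) * partial_deriv l f)"
      using Yc Z i by (subst sum.swap)
        (simp add: scalar_prod_def atLeast0LessThan Const_sum sum_distrib_right)
    also have "\<dots> = (\<Sum>l<n. if l = i then partial_deriv i f else 0)"
      unfolding YZ using i by (intro sum.cong) auto
    finally show ?thesis using i by simp
  qed
  have "jacobian_ideal n g = jacobian_ideal n f"
    using jacobian_ideal_subset[OF forms_in_mpolys[OF f] forms_in_mpolys[OF g] dg]
      jacobian_ideal_subset[OF forms_in_mpolys[OF g] forms_in_mpolys[OF f] df] by blast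
  then obtain c where c: "g = Const c * f" using rec g unfolding reconstructible_def by blast
  \<comment> \<open>The gradient of \<open>g\<close> is now both Y^T grad f and c grad f, and
    independence of the partial derivatives compares the coefficients.\<close>
  have "Y = c \<cdot>\<^sub>m 1\<^sub>m n"
  proof (rule eq_matI)
    fix k i assume "k < dim_row (c \<cdot>\<^sub>m 1\<^sub>m n)" "i < dim_col (c \<cdot>\<^sub>m 1\<^sub>m n)"
    then have ki: "k < n" "i < n" by auto
    have split: "Const (Y $$ (l, i) - (if l = i then c else 0)) * p =
        Const (Y $$ (l, i)) * p - (if l = i then Const c * p else 0)" for l and p :: "'a mpoly"
      by (rule poly_mapping_eqI) (simp add: lookup_minus left_diff_distrib)
    have "(\<Sum>l<n. Const (Y $$ (l, i) - (if l = i then c else 0)) * partial_deriv l f) =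
        partial_deriv i g - Const c * partial_deriv i f"
      unfolding split using ki by (simp add: sum_subtractf dg)
    also have "\<dots> = 0" by (simp add: c partial_deriv_Const_mult)
    finally have "Y $$ (k, i) - (if k = i then c else 0) = 0"
      by (rule nondegenerate_independent[OF char f nd _ ki(1)])
    then show "Y $$ (k, i) = (c \<cdot>\<^sub>m 1\<^sub>m n) $$ (k, i)" using ki by auto
  qed (use Yc in auto)
  then have "X + e \<cdot>\<^sub>m 1\<^sub>m n = c \<cdot>\<^sub>m 1\<^sub>m n" by (simp add: Y_def)
  then have eq: "(X + e \<cdot>\<^sub>m 1\<^sub>m n) $$ (i, j) = (c \<cdot>\<^sub>m 1\<^sub>m n) $$ (i, j)" for i j by simp
  have "X = (c - e) \<cdot>\<^sub>m 1\<^sub>m n"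
  proof (rule eq_matI)
    fix i j assume "i < dim_row ((c - e) \<cdot>\<^sub>m 1\<^sub>m n)" "j < dim_col ((c - e) \<cdot>\<^sub>m 1\<^sub>m n)"
    then show "X $$ (i, j) = ((c - e) \<cdot>\<^sub>m 1\<^sub>m n) $$ (i, j)"
      using eq[of i j] Xc by (cases "i = j") (simp_all add: eq_diff_eq)
  qed (use Xc in auto)
  then show "\<exists>c. X = c \<cdot>\<^sub>m 1\<^sub>m n" by blast
qed

lemma central_imp_reconstructible:
  fixes f :: "'a::field mpoly"
  assumes char: "CHAR('a) = 0 \<or> CHAR('a) > d" and d: "d > 0" and n: "n > 0"
    and f: "f \<in> forms {..<n} d" and nd: "nondegenerate n d f" and central: "central n f"
  shows "reconstructible n d f"
  unfolding reconstructible_def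
proof (intro ballI impI)
  fix g assume g: "g \<in> forms {..<n} d" and J: "jacobian_ideal n g = jacobian_ideal n f"
  note fm = forms_in_mpolys[OF f] and gm = forms_in_mpolys[OF g]
  \<comment> \<open>Ideal membership gives agreement only up to degree \<open>d - 1\<close>, but
    both sides are forms of exactly this degree.\<close>
  have "\<forall>i\<in>{..<n}. \<exists>c. partial_deriv i g = (\<Sum>k<n. Const (c k) * partial_deriv k f)"
  proof
    fix i assume "i \<in> {..<n}"
    then have i: "i < n" by simp
    obtain c where c: "\<And>m. mdeg m \<le> d - 1 \<Longrightarrow> Poly_Mapping.lookup (partial_deriv i g) m =
        Poly_Mapping.lookup (\<Sum>k<n. Const (c k) * partial_deriv k f) m"
      using jacobian_ideal_lowest_part[OF f, of "partial_deriv i g"] jacobian_generators(2)[OF gm i] J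
      by auto
    have "partial_deriv i g \<in> forms {..<n} (d - 1)"
      "(\<Sum>k<n. Const (c k) * partial_deriv k f) \<in> forms {..<n} (d - 1)"
      by (intro forms_sum forms_Const_mult forms_partial_deriv f g)+
    then have "partial_deriv i g = (\<Sum>k<n. Const (c k) * partial_deriv k f)"
      by (rule forms_eqI) (simp add: c)
    then show "\<exists>c. partial_deriv i g = (\<Sum>k<n. Const (c k) * partial_deriv k f)" by blast
  qed
  from bchoice[OF this] obtain M where M: "\<And>i. i < n \<Longrightarrow>
      partial_deriv i g = (\<Sum>k<n. Const (M i k) * partial_deriv k f)" by auto
  let ?X = "mat n n (\<lambda>(k, i). M i k)"
  have M': "partial_deriv i g = (\<Sum>k<n. Const (?X $$ (k, i)) * partial_deriv k f)" if "i < n" for i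
    unfolding M[OF that] using that by (intro sum.cong) auto
  \<comment> \<open>The gradient of \<open>g\<close> is closed because second derivatives
    commute.\<close>
  have "?X \<in> center n f"
    unfolding center_iff
  proof (intro conjI allI impI)
    fix i j assume ij: "i < n" "j < n"
    have "(\<Sum>k<n. Const (?X $$ (k, j)) * partial_deriv i (partial_deriv k f)) =
        partial_deriv i (partial_deriv j g)"
      unfolding M'[OF ij(2)] by (simp only: partial_deriv_sum partial_deriv_Const_mult)
    also have "\<dots> = partial_deriv j (partial_deriv i g)" by (rule partial_deriv_commute)
    also have "\<dots> = (\<Sum>k<n. Const (?X $$ (k, i)) * partial_deriv j (partial_deriv k f))"
      unfolding M'[OF ij(1)] by (simp only: partial_deriv_sum partial_deriv_Const_mult)
    finally show "(\<Sum>k<n. Const (?X $$ (k, j)) * partial_deriv i (partial_deriv k f)) =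
        (\<Sum>k<n. Const (?X $$ (k, i)) * partial_deriv j (partial_deriv k f))" .
  qed simp
  then obtain c where X: "?X = c \<cdot>\<^sub>m 1\<^sub>m n" using central by (auto simp: central_iff)
  have "partial_deriv i g = Const c * partial_deriv i f" if i: "i < n" for i
  proof -
    have "partial_deriv i g = (\<Sum>k<n. if k = i then Const c * partial_deriv i f else 0)"
      unfolding M'[OF i] X using i by (intro sum.cong) auto
    then show ?thesis using i by simp
  qed
  then have g_eq: "g = Const c * f"
    by (intro forms_eqI_partial_deriv[OF char d g forms_Const_mult[OF f]])
      (auto simp: partial_deriv_Const_mult)
  \<comment> \<open>Otherwise the common Jacobian ideal would be zero, although it contains the
    partial derivative of \<open>f\<close> at index 0, nonzero by independence.\<close>
  have "c \<noteq> 0"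
  proof
    assume "c = 0"
    then have "g = 0" by (simp add: g_eq)
    have "ideal {0} (mpoly_ring n :: 'a mpoly ring)" by (auto simp: mpolys_ideal_iff mpolys_def)
    then have "jacobian_ideal n g \<subseteq> {0}"
      by (rule jacobian_generators(3)[OF gm]) (simp add: \<open>g = 0\<close>)
    then have "partial_deriv 0 f = 0" using jacobian_generators(2)[OF fm n] J by auto
    moreover have "(\<Sum>k<n. Const (if k = 0 then 1 else 0) * partial_deriv k f) =
        (\<Sum>k<n. if k = 0 then partial_deriv 0 f else 0)"
      by (intro sum.cong) auto
    ultimately have "(\<Sum>k<n. Const (if k = 0 then 1 else 0) * partial_deriv k f) = 0"
      using n by simp
    from nondegenerate_independent[OF char f nd this n] show False by simp
  qed
  then show "\<exists>c. c \<noteq> 0 \<and> g = Const c * f" using g_eq by blast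
qed

section \<open>The rank of \<open>B\<close>\<close>

text \<open>Rank-nullity for multiplication by \<open>A\<close>, whose image is the column space
  that defines the rank.\<close>

lemma rank_plus_kernel_dim:
  fixes A :: "'a::field mat"
  assumes A: "A \<in> carrier_mat nr nc"
  shows "vec_space.rank nr A + kernel.dim nc A = nc"
proof -
  interpret K: kernel nr nc A by unfold_locales (rule A)
  interpret W: vec_space "TYPE('a)" nr .
  interpret L: linear_map class_ring K.NC.V W.V "(*\<^sub>v) A"
  proof (unfold_locales)
    show "(*\<^sub>v) A \<in> module_hom class_ring K.NC.V W.V"
      using A by (auto simp: LinearCombinations.module_hom_def module_vec_def
          mult_add_distrib_mat_vec[OF A] mult_mat_vec[OF A])
  qed
  have "L.kerT = mat_kernel A"
    unfolding L.ker_def mat_kernel[OF A] by (simp add: module_vec_simps)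
  moreover have "L.imT = W.span (set (cols A))"
  proof -
    have "L.imT = (*\<^sub>v) A ` carrier_vec nc" unfolding L.im_def by (simp add: module_vec_simps)
    also have "\<dots> = W.col_space A" unfolding W.col_space_eq[OF A] using A by fastforce
    finally show ?thesis unfolding W.col_space_def .
  qed
  ultimately show ?thesis
    using L.rank_nullity_main(1)[OF K.NC.fin_dim] unfolding K.NC.dim_is_n W.rank_def by metis
qed

text \<open>A nonzero vector is linearly independent, hence a basis once the dimension is 1;
  conversely a nonzero vector that spans the kernel makes it a line.\<close>

lemma kernel_dim_eq_1_iff:
  fixes A :: "'a::field mat"
  assumes A: "A \<in> carrier_mat nr nc" and v: "v \<in> mat_kernel A" "v \<noteq> 0\<^sub>v nc"
  shows "kernel.dim nc A = 1 \<longleftrightarrow> (\<forall>w\<in>mat_kernel A. \<exists>c. w = c \<cdot>\<^sub>v v)"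
proof -
  interpret K: kernel nr nc A by unfold_locales (rule A)
  have span: "K.span {v} = {c \<cdot>\<^sub>v v | c. True}"
  proof -
    have "K.lincomb a {v} = a v \<cdot>\<^sub>v v" for a
      using v A by (simp add: K.Ker.lincomb_def mat_kernel_smult[OF A])
    then show ?thesis using K.Ker.finite_span[of "{v}"] v by auto
  qed
  show ?thesis
  proof
    assume dim: "K.dim = 1"
    have "K.lin_indpt {v}"
    proof (rule K.Ker.finite_lin_indpt2)
      fix a assume "K.lincomb a {v} = 0\<^sub>v nc"
      then have "a v \<cdot>\<^sub>v v = 0\<^sub>v nc"
        using v A by (simp add: K.Ker.lincomb_def mat_kernel_smult[OF A])
      then have "a v = 0" using v mat_kernelD(1)[OF A v(1)]
        by (metis carrier_vecD eq_vecI index_smult_vec(1) index_zero_vec mult_eq_0_iff)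
      then show "\<forall>w\<in>{v}. a w = 0" by simp
    qed (use v in auto)
    moreover obtain bs where "finite bs" "K.basis bs" using kernel_basis_exists[OF A] by blast
    then have "K.Ker.fin_dim" by (auto simp: K.Ker.fin_dim_def K.Ker.basis_def)
    ultimately have "K.basis {v}"
      using v dim by (intro K.Ker.dim_li_is_basis) auto
    then have "K.span {v} = mat_kernel A" by (simp add: K.Ker.basis_def)
    then show "\<forall>w\<in>mat_kernel A. \<exists>c. w = c \<cdot>\<^sub>v v" unfolding span by blast
  next
    assume "\<forall>w\<in>mat_kernel A. \<exists>c. w = c \<cdot>\<^sub>v v"
    then have "K.span {v} = mat_kernel A"
      unfolding span using mat_kernel_smult[OF A v(1)] by blast
    then show "K.dim = 1" using v by (intro K.Ker.dim1I) auto
  qed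
qed

section \<open>The kernel of the stacked Kronecker blocks\<close>

lemma mult_append_rows_eq_0_iff:
  fixes A B :: "'a::comm_ring_1 mat"
  assumes A: "A \<in> carrier_mat m nc" and B: "B \<in> carrier_mat k nc" and v: "v \<in> carrier_vec nc"
  shows "(A @\<^sub>r B) *\<^sub>v v = 0\<^sub>v (m + k) \<longleftrightarrow> A *\<^sub>v v = 0\<^sub>v m \<and> B *\<^sub>v v = 0\<^sub>v k"
proof -
  have "(A @\<^sub>r B) *\<^sub>v v = (A *\<^sub>v v) @\<^sub>v (B *\<^sub>v v)"
    by (rule mat_mult_append[OF A B v])
  moreover have "0\<^sub>v (m + k) = (0\<^sub>v m :: 'a vec) @\<^sub>v 0\<^sub>v k" by (intro eq_vecI) auto
  ultimately show ?thesis
    using append_vec_eq[of "A *\<^sub>v v" m "0\<^sub>v m" "B *\<^sub>v v" "0\<^sub>v k"] A v by simp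
qed

lemma stacked_rows_mult_eq_0_iff:
  fixes Ms :: "'a::comm_ring_1 mat list"
  assumes "\<And>M. M \<in> set Ms \<Longrightarrow> M \<in> carrier_mat m nc" "v \<in> carrier_vec nc"
  shows "foldr (@\<^sub>r) Ms (0\<^sub>m 0 nc) \<in> carrier_mat (length Ms * m) nc \<and>
    (foldr (@\<^sub>r) Ms (0\<^sub>m 0 nc) *\<^sub>v v = 0\<^sub>v (length Ms * m) \<longleftrightarrow> (\<forall>M\<in>set Ms. M *\<^sub>v v = 0\<^sub>v m))"
  using assms(1)
proof (induction Ms)
  case Nil
  show ?case by (auto intro: eq_vecI)
next
  case (Cons M Ms)
  then have M: "M \<in> carrier_mat m nc"
    and F: "foldr (@\<^sub>r) Ms (0\<^sub>m 0 nc) \<in> carrier_mat (length Ms * m) nc" by auto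
  show ?case
    using mult_append_rows_eq_0_iff[OF M F assms(2)] carrier_append_rows[OF M F] Cons by simp
qed

text \<open>Stacking columns puts entry (b, a) at position a n + b, so a sum over stacked
  coordinates splits into \<open>n\<close> runs of length \<open>n\<close>.\<close>

lemma sum_div_mod:
  fixes h :: "nat \<Rightarrow> nat \<Rightarrow> 'a::comm_monoid_add"
  shows "(\<Sum>c\<in>{0..<n * n}. h (c div n) (c mod n)) = (\<Sum>a<n. \<Sum>b<n. h a b)"
proof -
  have "(\<Sum>c<n * n. h (c div n) (c mod n)) =
      (\<Sum>a<n. \<Sum>c\<in>{a * n..<a * n + n}. h (c div n) (c mod n))"
    by (rule sum.nat_group[symmetric])
  also have "\<dots> = (\<Sum>a<n. \<Sum>b<n. h a b)"
  proof (rule sum.cong[OF refl])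
    fix a
    have "(\<Sum>c\<in>{a * n..<a * n + n}. h (c div n) (c mod n)) =
        (\<Sum>b\<in>{0..<n}. h ((b + a * n) div n) ((b + a * n) mod n))"
      using sum.shift_bounds_nat_ivl[of "\<lambda>c. h (c div n) (c mod n)" 0 "a * n" n]
      by (simp add: add.commute)
    also have "\<dots> = (\<Sum>b<n. h a b)" by (rule sum.cong) auto
    finally show "(\<Sum>c\<in>{a * n..<a * n + n}. h (c div n) (c mod n)) = (\<Sum>b<n. h a b)" .
  qed
  finally show ?thesis by (simp add: atLeast0LessThan)
qed

text \<open>With one factor equal to the identity this is left multiplication by \<open>S\<close> or
  right multiplication by the transpose of \<open>T\<close>, the two halves of
  \<open>B_block\<close>.\<close>

lemma kronecker_mult_vec_of_cols:
  fixes S T X :: "'a::comm_ring_1 mat"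
  assumes S: "S \<in> carrier_mat n n" and T: "T \<in> carrier_mat n n" and X: "X \<in> carrier_mat n n"
  shows "kronecker T S *\<^sub>v vec_of_cols X = vec_of_cols (S * X * transpose_mat T)"
proof (rule eq_vecI)
  fix r assume "r < dim_vec (vec_of_cols (S * X * transpose_mat T))"
  then have r: "r < n * n" using S T by (simp add: vec_of_cols_def)
  then have n: "n > 0" by (cases n) auto
  have ij: "r mod n < n" "r div n < n" using r n by (auto simp: less_mult_imp_div_less)
  have "(kronecker T S *\<^sub>v vec_of_cols X) $ r =
      (\<Sum>c\<in>{0..<n * n}. T $$ (r div n, c div n) * S $$ (r mod n, c mod n) * X $$ (c mod n, c div n))"
    using S T X r by (simp add: kronecker_def vec_of_cols_def scalar_prod_def)
  also have "\<dots> = (\<Sum>a<n. \<Sum>b<n. T $$ (r div n, a) * S $$ (r mod n, b) * X $$ (b, a))"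
    by (rule sum_div_mod)
  also have "\<dots> = vec_of_cols (S * X * transpose_mat T) $ r"
    using S T X r ij
    by (subst sum.swap)
      (simp add: vec_of_cols_def scalar_prod_def atLeast0LessThan sum_distrib_left mult_ac)
  finally show "(kronecker T S *\<^sub>v vec_of_cols X) $ r = vec_of_cols (S * X * transpose_mat T) $ r" .
qed (use S T in \<open>simp add: kronecker_def vec_of_cols_def\<close>)

lemma vec_of_cols_carrier: "X \<in> carrier_mat n n \<Longrightarrow> vec_of_cols X \<in> carrier_vec (n ^ 2)"
  by (auto simp: vec_of_cols_def power2_eq_square)

lemma vec_of_cols_index:
  "X \<in> carrier_mat n n \<Longrightarrow> i < n \<Longrightarrow> j < n \<Longrightarrow> vec_of_cols X $ (j * n + i) = X $$ (i, j)"
  using div_mod_unique[of i n j] by (simp add: vec_of_cols_def power2_eq_square)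

lemma vec_of_cols_eq_iff:
  assumes "X \<in> carrier_mat n n" "Y \<in> carrier_mat n n"
  shows "vec_of_cols X = vec_of_cols Y \<longleftrightarrow> X = Y"
proof
  assume eq: "vec_of_cols X = vec_of_cols Y"
  show "X = Y"
  proof (rule eq_matI)
    fix i j assume "i < dim_row Y" "j < dim_col Y"
    then show "X $$ (i, j) = Y $$ (i, j)"
      using vec_of_cols_index[OF assms(1), of i j] vec_of_cols_index[OF assms(2), of i j] eq assms
      by simp
  qed (use assms in auto)
qed simp

lemma vec_of_cols_surj:
  assumes "v \<in> carrier_vec (n ^ 2)"
  shows "\<exists>X\<in>carrier_mat n n. v = vec_of_cols X"
proof (intro bexI)
  let ?X = "mat n n (\<lambda>(i, j). v $ (j * n + i))"
  show "v = vec_of_cols ?X"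
  proof (rule eq_vecI)
    fix r assume "r < dim_vec (vec_of_cols ?X)"
    then have r: "r < n * n" by (simp add: vec_of_cols_def)
    then have "n > 0" by (cases n) auto
    then show "v $ r = vec_of_cols ?X $ r"
      using r by (simp add: vec_of_cols_def less_mult_imp_div_less)
  qed (use assms in \<open>simp add: vec_of_cols_def power2_eq_square\<close>)
qed simp

lemma slice_mat_carrier [simp]: "slice_mat n d f is \<in> carrier_mat n n"
  by (simp add: slice_mat_def)

lemma kronecker_carrier:
  "A \<in> carrier_mat n n \<Longrightarrow> B \<in> carrier_mat n n \<Longrightarrow> kronecker A B \<in> carrier_mat (n ^ 2) (n ^ 2)"
  by (simp add: kronecker_def power2_eq_square)

text \<open>The first half of the block yields the stacked S X. In the second,
  \<open>transpose_perm\<close> turns X into its transpose and the Kronecker factor multiplies by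
  S^T on the right, which yields the stacked (S X)^T.\<close>

lemma B_block_mult_eq_0_iff:
  fixes f :: "'a::comm_ring_1 mpoly" and d :: nat and "is" :: "nat list"
  assumes X: "X \<in> carrier_mat n n"
  defines "S \<equiv> slice_mat n d f is"
  shows "B_block n d f is \<in> carrier_mat (n ^ 2) (n ^ 2)"
    and "B_block n d f is *\<^sub>v vec_of_cols X = 0\<^sub>v (n ^ 2) \<longleftrightarrow> transpose_mat (S * X) = S * X"
proof -
  have S: "S \<in> carrier_mat n n" by (simp add: S_def)
  have P: "transpose_perm n \<in> carrier_mat (n ^ 2) (n ^ 2)" by (simp add: transpose_perm_def)
  have K: "kronecker (1\<^sub>m n) S \<in> carrier_mat (n ^ 2) (n ^ 2)" "kronecker S (1\<^sub>m n) \<in> carrier_mat (n ^ 2) (n ^ 2)"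
    using S by (auto intro: kronecker_carrier)
  note v = vec_of_cols_carrier[OF X]
  have KP: "kronecker S (1\<^sub>m n) * transpose_perm n \<in> carrier_mat (n ^ 2) (n ^ 2)"
    by (rule mult_carrier_mat[OF K(2) P])
  then show "B_block n d f is \<in> carrier_mat (n ^ 2) (n ^ 2)"
    unfolding B_block_def S_def[symmetric] using K by (intro minus_carrier_mat)
  have SX: "S * X \<in> carrier_mat n n" using S X by simp
  have "(kronecker S (1\<^sub>m n) * transpose_perm n) *\<^sub>v vec_of_cols X =
      kronecker S (1\<^sub>m n) *\<^sub>v vec_of_cols (transpose_mat X)"
    using assoc_mult_mat_vec[OF K(2) P v] transpose_perm[OF X] by simp
  also have "\<dots> = vec_of_cols (transpose_mat (S * X))"
    using kronecker_mult_vec_of_cols[of "1\<^sub>m n" n S "transpose_mat X"] S X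
    by (simp add: transpose_mult[OF S X])
  finally have 2: "(kronecker S (1\<^sub>m n) * transpose_perm n) *\<^sub>v vec_of_cols X =
      vec_of_cols (transpose_mat (S * X))" .
  have 1: "kronecker (1\<^sub>m n) S *\<^sub>v vec_of_cols X = vec_of_cols (S * X)"
    using kronecker_mult_vec_of_cols[OF S one_carrier_mat X] right_mult_one_mat[OF SX] by simp
  have "B_block n d f is *\<^sub>v vec_of_cols X = vec_of_cols (S * X) - vec_of_cols (transpose_mat (S * X))"
    unfolding B_block_def S_def[symmetric] minus_mult_distrib_mat_vec[OF K(1) KP v] 1 2 ..
  also have "\<dots> = 0\<^sub>v (n ^ 2) \<longleftrightarrow> vec_of_cols (S * X) = vec_of_cols (transpose_mat (S * X))"
  proof
    assume eq: "vec_of_cols (S * X) - vec_of_cols (transpose_mat (S * X)) = 0\<^sub>v (n ^ 2)"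
    show "vec_of_cols (S * X) = vec_of_cols (transpose_mat (S * X))"
    proof (rule eq_vecI)
      fix r assume "r < dim_vec (vec_of_cols (transpose_mat (S * X)))"
      then show "vec_of_cols (S * X) $ r = vec_of_cols (transpose_mat (S * X)) $ r"
        using arg_cong[OF eq, of "\<lambda>v. v $ r"] vec_of_cols_carrier[of "transpose_mat (S * X)" n] SX
        by simp
    qed (use S X in \<open>simp add: vec_of_cols_def\<close>)
  qed (use vec_of_cols_carrier[of "transpose_mat (S * X)" n] SX in simp)
  also have "\<dots> \<longleftrightarrow> S * X = transpose_mat (S * X)"
    using SX by (intro vec_of_cols_eq_iff) auto
  finally show "B_block n d f is *\<^sub>v vec_of_cols X = 0\<^sub>v (n ^ 2) \<longleftrightarrow> transpose_mat (S * X) = S * X"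
    by auto
qed

lemma set_product_lists_replicate: "set (product_lists (replicate k [0..<n])) = index_tuples n k"
proof (induction k)
  case 0
  show ?case by (auto simp: index_tuples_def)
next
  case (Suc k)
  show ?case
    using Suc by (auto simp: index_tuples_def length_Suc_conv)
qed

lemma B_mat_kernel:
  fixes f :: "'a::field mpoly"
  assumes d: "d \<ge> 2"
  shows "mat_kernel (B_mat n d f) = vec_of_cols ` {X \<in> carrier_mat n n.
    \<forall>is\<in>index_tuples n (d - 2). transpose_mat (slice_mat n d f is * X) = slice_mat n d f is * X}"
proof -
  let ?Ms = "map (B_block n d f) (product_lists (replicate (d - 2) [0..<n]))"
  have block: "B_block n d f is \<in> carrier_mat (n ^ 2) (n ^ 2)" for "is"
    by (rule B_block_mult_eq_0_iff(1)[OF zero_carrier_mat])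
  have iff: "B_mat n d f *\<^sub>v vec_of_cols X = 0\<^sub>v (n ^ d) \<longleftrightarrow>
      (\<forall>is\<in>index_tuples n (d - 2). transpose_mat (slice_mat n d f is * X) = slice_mat n d f is * X)"
    if X: "X \<in> carrier_mat n n" for X
  proof -
    have stacked: "B_mat n d f \<in> carrier_mat (length ?Ms * n ^ 2) (n ^ 2)"
      "B_mat n d f *\<^sub>v vec_of_cols X = 0\<^sub>v (length ?Ms * n ^ 2) \<longleftrightarrow>
        (\<forall>M\<in>set ?Ms. M *\<^sub>v vec_of_cols X = 0\<^sub>v (n ^ 2))"
      using stacked_rows_mult_eq_0_iff[of ?Ms "n ^ 2" "n ^ 2" "vec_of_cols X"] block
        vec_of_cols_carrier[OF X] unfolding B_mat_def by auto
    then have "length ?Ms * n ^ 2 = n ^ d"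
      using B_mat_carrier[OF d, of n f] by (metis carrier_matD(1))
    then show ?thesis
      using stacked(2) B_block_mult_eq_0_iff(2)[OF X]
      by (simp add: set_product_lists_replicate[symmetric])
  qed
  show ?thesis
  proof (intro equalityI subsetI)
    fix v assume "v \<in> mat_kernel (B_mat n d f)"
    then have v: "v \<in> carrier_vec (n ^ 2)" "B_mat n d f *\<^sub>v v = 0\<^sub>v (n ^ d)"
      using mat_kernelD[OF B_mat_carrier[OF d]] by blast+
    obtain X where "X \<in> carrier_mat n n" "v = vec_of_cols X" using vec_of_cols_surj[OF v(1)] by blast
    then show "v \<in> vec_of_cols ` {X \<in> carrier_mat n n. \<forall>is\<in>index_tuples n (d - 2).
        transpose_mat (slice_mat n d f is * X) = slice_mat n d f is * X}"
      using v(2) iff by blast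
  next
    fix v assume "v \<in> vec_of_cols ` {X \<in> carrier_mat n n. \<forall>is\<in>index_tuples n (d - 2).
        transpose_mat (slice_mat n d f is * X) = slice_mat n d f is * X}"
    then show "v \<in> mat_kernel (B_mat n d f)"
      using iff by (auto intro!: mat_kernelI[OF B_mat_carrier[OF d]] vec_of_cols_carrier)
  qed
qed

text \<open>Recursion for multinomial coefficients, cleared of denominators: multiplied by the
  factorials of the multiplicities of \<open>M\<close>, both sides become the factorial of
  \<open>Suc (size M)\<close>.\<close>

lemma card_permutations_add_mset:
  "card (permutations_of_multiset (add_mset i M)) * Suc (count M i) =
    Suc (size M) * card (permutations_of_multiset M)"
proof -
  let ?K = "\<lambda>M. \<Prod>x\<in>set_mset M. fact (count M x) :: nat"
  \<comment> \<open>The element \<open>i\<close> may be absent from \<open>M\<close>; extending the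
    product by \<open>fact 0 = 1\<close> lets both products range over the same set.\<close>
  have K: "?K M = (\<Prod>x\<in>insert i (set_mset M). fact (count M x))" for M
    by (rule prod.mono_neutral_left) (auto simp: not_in_iff)
  have "?K (add_mset i M) = (\<Prod>x\<in>insert i (set_mset M). fact (count (add_mset i M) x))" by simp
  also have "\<dots> = fact (Suc (count M i)) * (\<Prod>x\<in>insert i (set_mset M) - {i}. fact (count (add_mset i M) x))"
    by (subst prod.remove[of _ i]) auto
  also have "(\<Prod>x\<in>insert i (set_mset M) - {i}. fact (count (add_mset i M) x)) =
      (\<Prod>x\<in>insert i (set_mset M) - {i}. fact (count M x) :: nat)"
    by (rule prod.cong) auto
  also have "fact (Suc (count M i)) * (\<Prod>x\<in>insert i (set_mset M) - {i}. fact (count M x) :: nat) =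
      Suc (count M i) * ?K M"
    unfolding K by (subst (2) prod.remove[of _ i]) (auto simp: algebra_simps)
  finally have KK: "?K (add_mset i M) = Suc (count M i) * ?K M" .
  have "card (permutations_of_multiset (add_mset i M)) * Suc (count M i) * ?K M =
      fact (size (add_mset i M))"
    using card_permutations_of_multiset_aux[of "add_mset i M"] unfolding KK by (simp only: mult.assoc)
  also have "\<dots> = Suc (size M) * card (permutations_of_multiset M) * ?K M"
    by (simp only: mult.assoc card_permutations_of_multiset_aux size_add_mset fact_Suc of_nat_id)
  finally show ?thesis by simp
qed

lemma list_exponent_Cons: "list_exponent (i # ys) = list_exponent ys + Poly_Mapping.single i 1"
  by (simp add: list_exponent_def add.commute)

text \<open>The exponents brought down by the two derivatives combine with the multinomial
  coefficient of \<open>f\<close> by \<open>card_permutations_add_mset\<close>, once into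
  \<open>d\<close> and once into \<open>d - 1\<close>. The resulting factor depends on neither
  \<open>i\<close> nor \<open>j\<close>.\<close>

lemma lookup_hessian_sym_coeff:
  fixes f :: "'a::field mpoly"
  assumes a: "symmetric_coeffs n d f a" and d: "d \<ge> 2"
    and ij: "i < n" "j < n" and "is": "is \<in> index_tuples n (d - 2)"
  shows "Poly_Mapping.lookup (partial_deriv i (partial_deriv j f)) (list_exponent is) =
    of_nat (d * (d - 1) * card (permutations_of_multiset (mset is))) * a (i # j # is)"
proof -
  let ?N = "\<lambda>xs. card (permutations_of_multiset (mset xs))"
  have sym: "\<forall>xs\<in>index_tuples n d. \<forall>ys\<in>index_tuples n d. mset xs = mset ys \<longrightarrow> a xs = a ys"
    and f: "f = (\<Sum>xs\<in>index_tuples n d. Const (a xs) * prod_list (map Var xs))"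
    using a unfolding symmetric_coeffs_def by blast+
  have len: "length is = d - 2" using "is" by (simp add: index_tuples_def)
  have tup: "j # i # is \<in> index_tuples n d" "i # j # is \<in> index_tuples n d"
    using "is" ij d by (auto simp: index_tuples_def)
  have lk: "Poly_Mapping.lookup f (list_exponent (j # i # is)) = of_nat (?N (j # i # is)) * a (j # i # is)"
    by (subst f) (rule lookup_symmetric_sum[OF sym tup(1)])
  have "Poly_Mapping.lookup (partial_deriv i (partial_deriv j f)) (list_exponent is) =
      of_nat (Suc (count (mset is) i) * (Suc (count (mset (i # is)) j) * ?N (j # i # is))) * a (j # i # is)"
    unfolding lookup_partial_deriv list_exponent_Cons[symmetric] lk
    by (simp only: lookup_list_exponent of_nat_mult mult.assoc)
  also have "Suc (count (mset is) i) * (Suc (count (mset (i # is)) j) * ?N (j # i # is)) =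
      Suc (count (mset is) i) * (Suc (length (i # is)) * ?N (i # is))"
    using card_permutations_add_mset[of j "mset (i # is)"] by (simp add: mult.commute)
  also have "Suc (length (i # is)) = d" using len d by simp
  also have "Suc (count (mset is) i) * (d * ?N (i # is)) = d * (?N (i # is) * Suc (count (mset is) i))"
    by (simp only: mult_ac)
  also have "?N (i # is) * Suc (count (mset is) i) = (d - 1) * ?N is"
  proof -
    have "Suc (size (mset is)) = d - 1" using len d by simp
    with card_permutations_add_mset[of i "mset is"] show ?thesis
      by (simp only: mset.simps)
  qed
  also have "a (j # i # is) = a (i # j # is)"
    by (rule sym[rule_format, OF tup]) (simp add: add_mset_commute)
  finally show ?thesis by (simp add: mult.assoc)
qed

text \<open>Each coefficient of entry (i, j) of H X is an entry of a slice times \<open>X\<close>,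
  up to a nonzero factor common to (i, j) and (j, i). Hence symmetry can be tested slice by
  slice.\<close>

lemma center_iff_slices:
  fixes f :: "'a::field mpoly"
  assumes char: "CHAR('a) = 0 \<or> CHAR('a) > d" and d: "d \<ge> 2" and f: "f \<in> forms {..<n} d"
  shows "X \<in> center n f \<longleftrightarrow> X \<in> carrier_mat n n \<and> (\<forall>is\<in>index_tuples n (d - 2).
    transpose_mat (slice_mat n d f is * X) = slice_mat n d f is * X)"
proof (cases "X \<in> carrier_mat n n")
  case X: True
  let ?L = "\<lambda>i j. \<Sum>k<n. Const (X $$ (k, j)) * partial_deriv i (partial_deriv k f)"
  let ?S = "\<lambda>is. slice_mat n d f is * X"
  define a where "a = sym_coeff n d f"
  have a: "symmetric_coeffs n d f a"
    unfolding a_def sym_coeff_def using symmetric_coeffs_exist[OF char f] by (rule someI_ex)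
  let ?N = "\<lambda>is. of_nat (d * (d - 1) * card (permutations_of_multiset (mset is))) :: 'a"
  \<comment> \<open>Both \<open>d\<close> and \<open>d - 1\<close> lie between 1 and
    \<open>d\<close>, and the number of arrangements is nonzero by the characteristic bound in
    degree \<open>d - 2\<close>.\<close>
  have N: "?N is \<noteq> 0" if "is \<in> index_tuples n (d - 2)" for "is"
  proof -
    have "CHAR('a) = 0 \<or> CHAR('a) > d - 2" using char by auto
    from of_nat_card_permutations_nonzero[OF this that] show ?thesis
      using of_nat_nonzero_of_char[OF char, of d] of_nat_nonzero_of_char[OF char, of "d - 1"] d
      by (simp only: of_nat_mult mult_eq_0_iff) auto
  qed
  have lookup_L: "Poly_Mapping.lookup (?L i j) (list_exponent is) = ?N is * ?S is $$ (i, j)"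
    if "i < n" "j < n" "is \<in> index_tuples n (d - 2)" for i j "is"
  proof -
    have "Poly_Mapping.lookup (?L i j) (list_exponent is) =
        (\<Sum>k<n. X $$ (k, j) * (?N is * a (i # k # is)))"
      unfolding lookup_sum lookup_Const_mult
      using lookup_hessian_sym_coeff[OF a d that(1) _ that(3)] by (intro sum.cong) auto
    also have "\<dots> = ?N is * (\<Sum>k<n. a (i # k # is) * X $$ (k, j))"
      by (simp only: sum_distrib_left mult_ac)
    also have "(\<Sum>k<n. a (i # k # is) * X $$ (k, j)) = ?S is $$ (i, j)"
      using X that by (simp add: slice_mat_def a_def[symmetric] scalar_prod_def atLeast0LessThan)
    finally show ?thesis .
  qed
  have L_forms: "?L i j \<in> forms {..<n} (d - 2)" for i j
  proof (intro forms_sum forms_Const_mult)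
    fix k
    show "partial_deriv i (partial_deriv k f) \<in> forms {..<n} (d - 2)"
      using forms_partial_deriv[OF forms_partial_deriv[OF f]] by (simp add: numeral_2_eq_2)
  qed
  have L_eq: "?L i j = ?L j i \<longleftrightarrow> (\<forall>is\<in>index_tuples n (d - 2). ?S is $$ (i, j) = ?S is $$ (j, i))"
    if ij: "i < n" "j < n" for i j
  proof
    assume eq: "?L i j = ?L j i"
    show "\<forall>is\<in>index_tuples n (d - 2). ?S is $$ (i, j) = ?S is $$ (j, i)"
    proof
      fix "is" assume "is": "is \<in> index_tuples n (d - 2)"
      have "?N is * ?S is $$ (i, j) = ?N is * ?S is $$ (j, i)"
        unfolding lookup_L[OF ij "is", symmetric] lookup_L[OF ij(2,1) "is", symmetric] eq ..
      then show "?S is $$ (i, j) = ?S is $$ (j, i)" using N[OF "is"] by (metis mult_left_cancel)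
    qed
  next
    assume S: "\<forall>is\<in>index_tuples n (d - 2). ?S is $$ (i, j) = ?S is $$ (j, i)"
    show "?L i j = ?L j i"
    proof (rule poly_mapping_eqI)
      fix m
      show "Poly_Mapping.lookup (?L i j) m = Poly_Mapping.lookup (?L j i) m"
      proof (cases "\<exists>is\<in>index_tuples n (d - 2). m = list_exponent is")
        case True
        then obtain "is" where "is": "is \<in> index_tuples n (d - 2)" and m: "m = list_exponent is" by blast
        show ?thesis unfolding m lookup_L[OF ij "is"] lookup_L[OF ij(2,1) "is"] using S "is" by simp
      next
        case False
        \<comment> \<open>Monomials that are not listed by index tuples have coefficient 0 on both
          sides, as H X consists of forms of degree \<open>d - 2\<close>.\<close>
        then have "\<not> (Poly_Mapping.keys m \<subseteq> {..<n} \<and> mdeg m = d - 2)"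
          using exponent_as_list[of m n "d - 2"] by blast
        then have "Poly_Mapping.lookup (?L i j) m = 0" "Poly_Mapping.lookup (?L j i) m = 0"
          using L_forms[of i j] L_forms[of j i] unfolding forms_iff by blast+
        then show ?thesis by simp
      qed
    qed
  qed
  have S: "?S is \<in> carrier_mat n n" for "is" by (rule mult_carrier_mat[OF slice_mat_carrier X])
  show ?thesis
    unfolding center_iff symmetric_mat_iff[OF S] using X L_eq by blast
qed (simp add: center_iff)

text \<open>The identity matrix always lies in the center, so the kernel of B contains a nonzero
  vector, and centrality says that this vector spans it.\<close>

lemma central_iff_rank_B_mat:
  fixes f :: "'a::field mpoly"
  assumes char: "CHAR('a) = 0 \<or> CHAR('a) > d" and d: "d \<ge> 2" and n: "n > 0"
    and f: "f \<in> forms {..<n} d"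
  shows "central n f \<longleftrightarrow> vec_space.rank (n ^ d) (B_mat n d f) = n ^ 2 - 1"
proof -
  note B = B_mat_carrier[OF d, of n f]
  have ker: "mat_kernel (B_mat n d f) = vec_of_cols ` center n f"
    unfolding B_mat_kernel[OF d] using center_iff_slices[OF char d f] by blast
  let ?v = "vec_of_cols (1\<^sub>m n) :: 'a vec"
  have "1 \<cdot>\<^sub>m 1\<^sub>m n = (1\<^sub>m n :: 'a mat)" by (intro eq_matI) auto
  then have "1\<^sub>m n \<in> center n f" using scalar_in_center[of 1 n f] by simp
  then have v: "?v \<in> mat_kernel (B_mat n d f)" unfolding ker by (rule imageI)
  have "?v $ (0 * n + 0) = 1" using n by (subst vec_of_cols_index[of _ n]) auto
  then have v0: "?v \<noteq> 0\<^sub>v (n ^ 2)" using n by auto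
  have smult: "c \<cdot>\<^sub>v ?v = vec_of_cols (c \<cdot>\<^sub>m 1\<^sub>m n)" for c
    using n by (intro eq_vecI) (auto simp: vec_of_cols_def less_mult_imp_div_less)
  have "central n f \<longleftrightarrow> (\<forall>X\<in>center n f. \<exists>c. vec_of_cols X = c \<cdot>\<^sub>v ?v)"
  proof -
    have "vec_of_cols X = c \<cdot>\<^sub>v ?v \<longleftrightarrow> X = c \<cdot>\<^sub>m 1\<^sub>m n" if "X \<in> center n f" for X c
      unfolding smult using that by (intro vec_of_cols_eq_iff[of _ n]) (auto simp: center_def)
    then show ?thesis unfolding central_iff by blast
  qed
  also have "\<dots> \<longleftrightarrow> (\<forall>w\<in>mat_kernel (B_mat n d f). \<exists>c. w = c \<cdot>\<^sub>v ?v)"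
    unfolding ker by simp
  also have "\<dots> \<longleftrightarrow> kernel.dim (n ^ 2) (B_mat n d f) = 1"
    by (rule kernel_dim_eq_1_iff[OF B v v0, symmetric])
  also have "\<dots> \<longleftrightarrow> vec_space.rank (n ^ d) (B_mat n d f) = n ^ 2 - 1"
  proof -
    \<comment> \<open>Positivity of \<open>m\<close> guards the truncated subtraction: for
      \<open>m = 0\<close> the right side would hold with \<open>r = k = 0\<close>.\<close>
    have "k = 1 \<longleftrightarrow> r = m - 1" if "r + k = m" "m > 0" for k r m :: nat using that by arith
    from this[OF rank_plus_kernel_dim[OF B]] show ?thesis using n by simp
  qed
  finally show ?thesis .
qed

theorem theorem3p11:
  fixes f :: "'a::alg_closed_field mpoly" and n d :: nat
  assumes "d \<ge> 3" and "n \<ge> 1"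
    and "CHAR('a) = 0 \<or> CHAR('a) > d"
    and "f \<in> forms {..<n} d"
    and "nondegenerate n d f"
  shows "(reconstructible n d f \<longleftrightarrow> central n f)
       \<and> (central n f \<longleftrightarrow> vec_space.rank (n ^ d) (B_mat n d f) = n ^ 2 - 1)
       \<and> (vec_space.rank (n ^ d) (B_mat n d f) = n ^ 2 - 1 \<longleftrightarrow>
            indecomposable n d f \<and> \<not> LDS_form n d f)"
proof -
  have d: "d > 0" "d \<ge> 2" and n: "n > 0" using assms(1,2) by auto
  have "reconstructible n d f \<longleftrightarrow> central n f"
    using reconstructible_imp_central[OF assms(3) d(1) assms(4,5)]
      central_imp_reconstructible[OF assms(3) d(1) n assms(4,5)] by blast
  moreover have "central n f \<longleftrightarrow> vec_space.rank (n ^ d) (B_mat n d f) = n ^ 2 - 1"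
    by (rule central_iff_rank_B_mat[OF assms(3) d(2) n assms(4)])
  moreover have "central n f \<longleftrightarrow> indecomposable n d f \<and> \<not> LDS_form n d f"
    using not_central_imp_direct_sum_or_LDS[OF assms(3) d(1) assms(4)]
      direct_sum_imp_not_central[OF assms(4)] LDS_imp_not_central[OF assms(4)]
    unfolding indecomposable_def by blast
  ultimately show ?thesis by blast
qed

end
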